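(* Let $G_{(r,s,n)}=\langle x,y\mid x^r,\,y^s,\,\gamma_{n+1}(F)\rangle$ denote the $n$-th nilpotent product of the cyclic groups $Z_r$ and $Z_s$ (where $F$ is free on $\{x,y\}$), let $d=(r,s)=\gcd(r,s)$, and for each positive integer $m$ let $r(m)$ denote the number of basic commutators of weight $m$ on two letters. (i) For any odd integers $r$ and $s$, and all $c\ge 2$, $$\mathcal{N}_cM(G_{(r,s,2)})\cong \underbrace{Z_d\oplus\cdots\oplus Z_d}_{\sum_{i=1}^{2} r(c+i)\ \text{copies}}.$$ (ii) For all non-negative integers $r$ and $s$ neither of which is divisible by $2$ or by $3$, $$\mathcal{N}_cM(G_{(r,s,3)})\cong \underbrace{Z_d\oplus\cdots\oplus Z_d}_{\sum_{i=1}^{3} r(c+i)\ \text{copies}}\quad\text{for all } c\ge 3,$$ and $$\mathcal{N}_cM(G_{(r,s,4)})\cong \underbrace{Z_d\oplus\cdots\oplus Z_d}_{\sum_{i=1}^{4} r(c+i)\ \text{copies}}\quad\text{for all } c\ge 4.$$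
   Context: $Z_m$ denotes the cyclic group of order $m$; $Z_r=\langle x\mid x^r=1\rangle$ and $Z_s=\langle y\mid y^s=1\rangle$. $\gamma_k(F)$ is the $k$-th term of the lower central series of $F$ (with $\gamma_1(F)=F$). $F$ is the free group freely generated by $\{x,y\}$, and $G_{(r,s,n)}=F/\langle x^r,y^s,\gamma_{n+1}(F)\rangle^F$, where $\langle\cdot\rangle^F$ denotes normal closure in $F$. $\mathcal{N}_c$ is the variety of nilpotent groups of class at most $c$. For a group $G$ with a free presentation $1\to R\to F\to G\to 1$ (with $F$ a free group), the Baer-invariant (higher Schur-multiplicator) of $G$ with respect to $\mathcal{N}_c$ is $$\mathcal{N}_cM(G)=\frac{R\cap\gamma_{c+1}(F)}{[R,\,{}_cF]},\qquad [R,\,{}_cF]=[R,\underbrace{F,\ldots,F}_{c}]$$ (left-normed commutator subgroup). It is an abelian group which is, up to isomorphism, independent of the choice of free presentation. The symbol $r(m)$ (a function of the weight $m$, not to be confused with a product involving the integer $r$) is the number of basic commutators of weight $m$ on two letters; equivalently, the rank of the free abelian group $\gamma_m(F)/\gamma_{m+1}(F)$ for $F$ free of rank $2$. *)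

theory Defs
  imports "HOL-Algebra.Generated_Groups" "HOL-Algebra.Product_Groups"
begin

section \<open>Free groups\<close>

text \<open>The syllable \<open>(True, a)\<close> stands for the letter \<open>a\<close> and \<open>(False, a)\<close> for its formal inverse.
  Elements of the free group are the reduced words.\<close>

type_synonym 'a word = "(bool \<times> 'a) list"

fun reduced :: "'a word \<Rightarrow> bool" where
  "reduced (p # q # w) \<longleftrightarrow> \<not> (snd p = snd q \<and> fst p \<noteq> fst q) \<and> reduced (q # w)"
| "reduced _ \<longleftrightarrow> True"

fun push :: "bool \<times> 'a \<Rightarrow> 'a word \<Rightarrow> 'a word" where
  "push p [] = [p]"
| "push p (q # w) = (if snd p = snd q \<and> fst p \<noteq> fst q then w else p # q # w)"

text \<open>For reduced \<open>u\<close> and \<open>v\<close>, \<open>foldr push u v\<close> is the reduced form of the concatenation \<open>u @ v\<close>.\<close>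

definition free_group :: "'a set \<Rightarrow> 'a word monoid" where
  "free_group X = \<lparr>carrier = {w. reduced w \<and> snd ` set w \<subseteq> X},
                   monoid.mult = (\<lambda>u v. foldr push u v), one = []\<rparr>"

definition eval_word :: "('f, 'm) monoid_scheme \<Rightarrow> 'f word \<Rightarrow> 'f" where
  "eval_word F w =
     foldr (\<lambda>p g. (if fst p then snd p else inv\<^bsub>F\<^esub> (snd p)) \<otimes>\<^bsub>F\<^esub> g) w \<one>\<^bsub>F\<^esub>"

definition freely_generated_by :: "('f, 'm) monoid_scheme \<Rightarrow> 'f set \<Rightarrow> bool" where
  "freely_generated_by F X \<longleftrightarrow>
     group F \<and> X \<subseteq> carrier F \<and> eval_word F \<in> iso (free_group X) F"

text \<open>A free presentation \<open>1 \<rightarrow> R \<rightarrow> F \<rightarrow> G \<rightarrow> 1\<close> is given by the epimorphism \<open>\<pi> : F \<rightarrow> G\<close>;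
  then \<open>R = kernel F G \<pi>\<close>.\<close>

definition free_presentation ::
  "('f, 'm) monoid_scheme \<Rightarrow> ('f \<Rightarrow> 'g) \<Rightarrow> ('g, 'n) monoid_scheme \<Rightarrow> bool" where
  "free_presentation F \<pi> G \<longleftrightarrow> (\<exists>X. freely_generated_by F X) \<and> \<pi> \<in> epi F G"


section \<open>Commutator subgroups and the Baer-invariant\<close>

definition commutator :: "('f, 'm) monoid_scheme \<Rightarrow> 'f \<Rightarrow> 'f \<Rightarrow> 'f" where
  "commutator G a b = inv\<^bsub>G\<^esub> a \<otimes>\<^bsub>G\<^esub> inv\<^bsub>G\<^esub> b \<otimes>\<^bsub>G\<^esub> a \<otimes>\<^bsub>G\<^esub> b"

definition commutator_subgroup :: "('f, 'm) monoid_scheme \<Rightarrow> 'f set \<Rightarrow> 'f set \<Rightarrow> 'f set" where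
  "commutator_subgroup G H K = generate G {commutator G h k | h k. h \<in> H \<and> k \<in> K}"

text \<open>\<open>iterated_commutator G H c\<close> is the left-normed \<open>[H, G, \<dots>, G]\<close> with \<open>c\<close> entries \<open>G\<close>.\<close>

primrec iterated_commutator :: "('f, 'm) monoid_scheme \<Rightarrow> 'f set \<Rightarrow> nat \<Rightarrow> 'f set" where
  "iterated_commutator G H 0 = H"
| "iterated_commutator G H (Suc c) = commutator_subgroup G (iterated_commutator G H c) (carrier G)"

text \<open>Indexed so that \<open>lower_central G 1\<close> is the whole group; the index \<open>0\<close> is never used.\<close>

definition lower_central :: "('f, 'm) monoid_scheme \<Rightarrow> nat \<Rightarrow> 'f set" where
  "lower_central G k = iterated_commutator G (carrier G) (k - 1)"

definition normal_closure :: "('f, 'm) monoid_scheme \<Rightarrow> 'f set \<Rightarrow> 'f set" where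
  "normal_closure G S =
     generate G {inv\<^bsub>G\<^esub> g \<otimes>\<^bsub>G\<^esub> a \<otimes>\<^bsub>G\<^esub> g | g a. g \<in> carrier G \<and> a \<in> S}"

text \<open>The Baer-invariant with respect to the variety of nilpotent groups of class at most \<open>c\<close>,
  computed from the free presentation \<open>F / R\<close>.\<close>

definition baer_invariant :: "nat \<Rightarrow> ('f, 'm) monoid_scheme \<Rightarrow> 'f set \<Rightarrow> 'f set monoid" where
  "baer_invariant c F R =
     F\<lparr>carrier := R \<inter> lower_central F (c + 1)\<rparr> Mod iterated_commutator F R c"


section \<open>The nilpotent product of two cyclic groups\<close>

datatype letter = LX | LY

abbreviation F2 :: "letter word monoid" where
  "F2 \<equiv> free_group UNIV"

definition nilpotent_product :: "int \<Rightarrow> int \<Rightarrow> nat \<Rightarrow> letter word set monoid" where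
  "nilpotent_product r s n =
     F2 Mod normal_closure F2
       ({[(True, LX)] [^]\<^bsub>F2\<^esub> r, [(True, LY)] [^]\<^bsub>F2\<^esub> s} \<union> lower_central F2 (n + 1))"


section \<open>Basic commutators on two letters\<close>

datatype comm = Letter letter | Comm comm comm

primrec weight :: "comm \<Rightarrow> nat" where
  "weight (Letter a) = 1"
| "weight (Comm u v) = weight u + weight v"

text \<open>The ordering of the basic commutators has \<open>x < y\<close> and respects weights; commutators of equal
  weight may be ordered arbitrarily, and the lexicographic order is used here.\<close>

fun prec :: "comm \<Rightarrow> comm \<Rightarrow> bool" where
  "prec (Letter a) (Letter b) \<longleftrightarrow> a = LX \<and> b = LY"
| "prec (Letter a) (Comm u v) \<longleftrightarrow> True"
| "prec (Comm u v) (Letter a) \<longleftrightarrow> False"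
| "prec (Comm u v) (Comm u' v') \<longleftrightarrow>
     weight (Comm u v) < weight (Comm u' v') \<or>
     weight (Comm u v) = weight (Comm u' v') \<and> (prec u u' \<or> u = u' \<and> prec v v')"

fun basic :: "comm \<Rightarrow> bool" where
  "basic (Letter a) \<longleftrightarrow> True"
| "basic (Comm u v) \<longleftrightarrow> basic u \<and> basic v \<and> prec v u \<and>
     (case u of Letter a \<Rightarrow> True | Comm p q \<Rightarrow> q = v \<or> prec q v)"

definition num_basic_commutators :: "nat \<Rightarrow> nat" where
  "num_basic_commutators m = card {u. basic u \<and> weight u = m}"


section \<open>Direct sums of copies of a cyclic group\<close>

definition cyclic_sum :: "int \<Rightarrow> nat \<Rightarrow> (nat \<Rightarrow> int) monoid" where
  "cyclic_sum d k = sum_group {..<k} (\<lambda>_. integer_mod_group (nat d))"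

end

theory Submission
  imports Defs "HOL-Algebra.FiniteProduct" "HOL-Computational_Algebra.Primes"
begin

text \<open>The Baer-invariant does not depend on the presentation, so take the free group \<open>F\<close> on \<open>x, y\<close>
  and let \<open>R\<close> be the normal closure of \<open>x\<^sup>r\<close>, \<open>y\<^sup>s\<close> and \<open>\<gamma>\<^sub>n\<^sub>+\<^sub>1(F)\<close>. As \<open>n \<le> c\<close>, the invariant is
  the abelian group \<open>\<gamma>\<^sub>c\<^sub>+\<^sub>1(F)/T\<close> with \<open>T = [R, \<^sub>cF] \<supseteq> \<gamma>\<^sub>c\<^sub>+\<^sub>n\<^sub>+\<^sub>1(F)\<close>, and it is generated by the
  basic commutators of weights \<open>c + 1, \<dots>, c + n\<close> by Hall's rewriting argument. It remains to see that the
  only relations among them are the multiples of \<open>d\<close>.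

  A commutator involving \<open>x\<close> becomes, when one \<open>x\<close> is replaced by \<open>x\<^sup>k\<close>, a polynomial sequence
  in \<open>k\<close>, which lies in \<open>T\<close> for \<open>k = r\<close>. In Newton's expansion at \<open>k = r\<close> the coefficients
  \<open>r choose i\<close> with \<open>i \<le> n\<close> are divisible by \<open>d\<close>, since \<open>d\<close> is prime to \<open>n!\<close>, and the terms of higher
  degree lie in \<open>T\<close>. Descending induction on the weight shows that \<open>\<gamma>\<^sub>c\<^sub>+\<^sub>1(F)/T\<close> has exponent dividing
  \<open>d\<close>.

  Conversely, under the Magnus embedding into noncommutative power series with augmentation ideal
  \<open>I\<close>, the same divisibility puts \<open>T\<close> into \<open>1 + d A + I\<^bsup>c+n+1\<^esup>\<close>, while the leading terms of the basic
  commutators are the basic Lie polynomials, which are independent modulo every \<open>d\<close>.\<close>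

section \<open>Commutator calculus\<close>

text \<open>The obstacle is that replacing \<open>x\<close> by \<open>x^r\<close> puts
  \<open>[x^r, y]\<close> into \<open>T\<close>, whereas the power \<open>[x, y]^r\<close> is
  wanted: they differ by commutators of higher weight with binomial exponents. Polynomial sequences
  control these corrections without collecting them, because the i-th difference gains weight i. The
  condition \<open>n \<le> c\<close> serves twice. It puts the term \<open>c + 1\<close> of the
  lower central series into \<open>R\<close>, so the numerator is that whole term; and commutators
  of its elements have weight at least \<open>2 c + 2\<close>, hence lie in \<open>T\<close>. The
  divisibility of \<open>r choose i\<close> is used on both sides: it bounds the exponent from
  above, and it makes the relators trivial modulo \<open>d\<close> in low degrees. Independence of
  the Lie polynomials over the integers would not suffice for the lower bound; it is needed modulo
  \<open>d\<close>, and \<open>d\<close> may be composite, so no dimension count over a field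
  applies. Finite sets of coordinate vectors modulo \<open>d\<close> are counted instead, for which
  \<open>d > 0\<close> matters.\<close>

context group
begin

lemma inv_mult_cancel [simp]:
  assumes "a \<in> carrier G" "b \<in> carrier G"
  shows "inv a \<otimes> (a \<otimes> b) = b" "a \<otimes> (inv a \<otimes> b) = b"
  using assms by (simp_all flip: m_assoc)

lemma commutator_closed [simp]:
  "\<lbrakk>a \<in> carrier G; b \<in> carrier G\<rbrakk> \<Longrightarrow> commutator G a b \<in> carrier G"
  by (simp add: commutator_def)

lemma inv_commutator:
  "\<lbrakk>a \<in> carrier G; b \<in> carrier G\<rbrakk> \<Longrightarrow> inv (commutator G a b) = commutator G b a"
  by (simp add: commutator_def inv_mult_group m_assoc)

lemma commutator_swap:
  assumes "subgroup M G" "a \<in> carrier G" "b \<in> carrier G" "commutator G a b \<in> M"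
  shows "commutator G b a \<in> M"
  using assms inv_commutator[of a b] by (metis subgroup.m_inv_closed)

lemma commutator_mult_right:
  "\<lbrakk>a \<in> carrier G; b \<in> carrier G; c \<in> carrier G\<rbrakk> \<Longrightarrow>
    commutator G a (b \<otimes> c) = commutator G a c \<otimes> (inv c \<otimes> commutator G a b \<otimes> c)"
  by (simp add: commutator_def m_assoc inv_mult_group)

lemma commutator_inv_right:
  "\<lbrakk>a \<in> carrier G; b \<in> carrier G\<rbrakk> \<Longrightarrow>
    commutator G a (inv b) = b \<otimes> inv (commutator G a b) \<otimes> inv b"
  by (simp add: commutator_def m_assoc inv_mult_group)

text \<open>Pure cancellation, valid already in the free group on three letters; modulo higher
  weight it turns into the Jacobi identity.\<close>

lemma hall_witt:
  assumes [simp]: "a \<in> carrier G" "b \<in> carrier G" "c \<in> carrier G"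
  shows "(inv b \<otimes> commutator G (commutator G a (inv b)) c \<otimes> b) \<otimes>
         (inv c \<otimes> commutator G (commutator G b (inv c)) a \<otimes> c) \<otimes>
         (inv a \<otimes> commutator G (commutator G c (inv a)) b \<otimes> a) = \<one>"
  by (simp add: commutator_def m_assoc inv_mult_group)

lemma normal_inv_op_closed:
  assumes "M \<lhd> G" "g \<in> carrier G" "m \<in> M"
  shows "inv g \<otimes> m \<otimes> g \<in> M" "g \<otimes> m \<otimes> inv g \<in> M"
  using assms by (auto simp: normal.inv_op_closed1 normal.inv_op_closed2)

lemma normal_mem_carrier: "\<lbrakk>M \<lhd> G; m \<in> M\<rbrakk> \<Longrightarrow> m \<in> carrier G"
  by (rule subgroup.mem_carrier[OF normal_imp_subgroup])

lemma normal_conj_iff: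
  assumes "M \<lhd> G" "g \<in> carrier G" "m \<in> carrier G"
  shows "inv g \<otimes> m \<otimes> g \<in> M \<longleftrightarrow> m \<in> M"
proof
  assume "inv g \<otimes> m \<otimes> g \<in> M"
  then have "g \<otimes> (inv g \<otimes> m \<otimes> g) \<otimes> inv g \<in> M"
    using assms normal_inv_op_closed by blast
  then show "m \<in> M"
    using assms by (simp add: m_assoc)
qed (use assms normal_inv_op_closed in blast)

lemma normal_mult_closed: "\<lbrakk>M \<lhd> G; a \<in> M; b \<in> M\<rbrakk> \<Longrightarrow> a \<otimes> b \<in> M"
  by (rule subgroup.m_closed[OF normal_imp_subgroup])

lemma normal_inv_closed: "\<lbrakk>M \<lhd> G; a \<in> M\<rbrakk> \<Longrightarrow> inv a \<in> M"
  by (rule subgroup.m_inv_closed[OF normal_imp_subgroup])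

lemma normal_commutator_left:
  assumes "M \<lhd> G" "m \<in> M" "g \<in> carrier G"
  shows "commutator G m g \<in> M"
proof -
  have [simp]: "m \<in> carrier G" using assms normal_mem_carrier by blast
  have "commutator G m g = inv m \<otimes> (inv g \<otimes> m \<otimes> g)"
    using assms by (simp add: commutator_def m_assoc)
  then show ?thesis
    using assms by (simp add: normal_mult_closed normal_inv_closed normal_inv_op_closed)
qed

lemma normal_commutator_right:
  assumes "M \<lhd> G" "m \<in> M" "g \<in> carrier G"
  shows "commutator G g m \<in> M"
  using assms normal_commutator_left commutator_swap normal_imp_subgroup normal_mem_carrier by metis

text \<open>The preimage of the centralizer of \<open>aM\<close> in \<open>G / M\<close>.\<close>

definition centralizer_mod :: "'a set \<Rightarrow> 'a \<Rightarrow> 'a set" where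
  "centralizer_mod M a = {b \<in> carrier G. commutator G a b \<in> M}"

text \<open>Reduces claims about \<open>[a, b]\<close> modulo \<open>M\<close> to generators
  \<open>b\<close>. Expanding the second entry produces conjugates, which normality of
  \<open>M\<close> absorbs.\<close>

lemma subgroup_centralizer_mod:
  assumes M: "M \<lhd> G" and a: "a \<in> carrier G"
  shows "subgroup (centralizer_mod M a) G"
proof (rule subgroupI)
  show "centralizer_mod M a \<noteq> {}"
  proof -
    have "commutator G a \<one> = \<one>" using a by (simp add: commutator_def)
    then have "\<one> \<in> centralizer_mod M a"
      using subgroup.one_closed[OF normal_imp_subgroup[OF M]] by (simp add: centralizer_mod_def)
    then show ?thesis by blast
  qed
next
  show "centralizer_mod M a \<subseteq> carrier G" by (auto simp: centralizer_mod_def)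
next
  fix b assume "b \<in> centralizer_mod M a"
  then show "inv b \<in> centralizer_mod M a"
    using assms normal_inv_op_closed(2)[OF M, of b "inv (commutator G a b)"]
    by (simp add: centralizer_mod_def commutator_inv_right normal_inv_closed)
next
  fix b c assume "b \<in> centralizer_mod M a" "c \<in> centralizer_mod M a"
  then show "b \<otimes> c \<in> centralizer_mod M a"
    using assms normal_inv_op_closed(1)[OF M, of c "commutator G a b"]
    by (simp add: centralizer_mod_def commutator_mult_right normal_mult_closed)
qed

lemma centralizer_mod_sym:
  assumes "M \<lhd> G" "a \<in> carrier G" "b \<in> carrier G"
  shows "b \<in> centralizer_mod M a \<longleftrightarrow> a \<in> centralizer_mod M b"
  using assms commutator_swap[OF normal_imp_subgroup] by (auto simp: centralizer_mod_def)

section \<open>Commutator subgroups and the lower central series\<close>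

lemma commutator_subgroup_subset:
  assumes "subgroup M G" "\<And>h k. \<lbrakk>h \<in> H; k \<in> K\<rbrakk> \<Longrightarrow> commutator G h k \<in> M"
  shows "commutator_subgroup G H K \<subseteq> M"
  unfolding commutator_subgroup_def using assms by (intro generate_subgroup_incl) auto

lemma commutator_in_commutator_subgroup:
  "\<lbrakk>h \<in> H; k \<in> K\<rbrakk> \<Longrightarrow> commutator G h k \<in> commutator_subgroup G H K"
  unfolding commutator_subgroup_def by (rule generate.incl) auto

lemma conj_commutator:
  assumes "a \<in> carrier G" "b \<in> carrier G" "g \<in> carrier G"
  shows "g \<otimes> commutator G a b \<otimes> inv g = commutator G (g \<otimes> a \<otimes> inv g) (g \<otimes> b \<otimes> inv g)"
  using assms by (simp add: commutator_def m_assoc inv_mult_group)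

lemma normal_commutator_subgroup:
  assumes H: "H \<lhd> G" and K: "K \<lhd> G"
  shows "commutator_subgroup G H K \<lhd> G"
  unfolding commutator_subgroup_def
proof (rule normal_generateI)
  show "{commutator G h k |h k. h \<in> H \<and> k \<in> K} \<subseteq> carrier G"
    using assms normal_mem_carrier by auto
next
  fix h g assume h: "h \<in> {commutator G h k |h k. h \<in> H \<and> k \<in> K}" and g: "g \<in> carrier G"
  then obtain a b where "a \<in> H" "b \<in> K" "h = commutator G a b" by blast
  then show "g \<otimes> h \<otimes> inv g \<in> {commutator G h k |h k. h \<in> H \<and> k \<in> K}"
    using conj_commutator[of a b g] g assms normal_mem_carrier normal_inv_op_closed(2) by blast
qed

lemma normal_carrier [simp]: "carrier G \<lhd> G"
  by (rule normal_self)

lemma normal_iterated_commutator [simp]: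
  "R \<lhd> G \<Longrightarrow> iterated_commutator G R k \<lhd> G"
  by (induction k) (auto intro: normal_commutator_subgroup)

lemma normal_lower_central [simp]: "lower_central G k \<lhd> G"
  by (simp add: lower_central_def)

lemma lower_central_0 [simp]: "lower_central G 0 = carrier G"
  and lower_central_1 [simp]: "lower_central G (Suc 0) = carrier G"
  by (simp_all add: lower_central_def)

lemma lower_central_Suc:
  "0 < k \<Longrightarrow> lower_central G (Suc k) = commutator_subgroup G (lower_central G k) (carrier G)"
  by (cases k) (auto simp: lower_central_def)

lemma commutator_subgroup_le_left:
  "\<lbrakk>A \<lhd> G; B \<subseteq> carrier G\<rbrakk> \<Longrightarrow> commutator_subgroup G A B \<subseteq> A"
  by (rule commutator_subgroup_subset) (auto intro: normal_imp_subgroup normal_commutator_left)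

lemma iterated_commutator_antimono:
  assumes "R \<lhd> G" "i \<le> j"
  shows "iterated_commutator G R j \<subseteq> iterated_commutator G R i"
  using assms(2)
proof (induction rule: dec_induct)
  case (step k)
  then show ?case
    using commutator_subgroup_le_left[of "iterated_commutator G R k" "carrier G"] assms by auto
qed auto

lemma iterated_commutator_mono:
  assumes "R \<subseteq> R'"
  shows "iterated_commutator G R k \<subseteq> iterated_commutator G R' k"
  using assms by (induction k) (auto simp: commutator_subgroup_def intro!: mono_generate)

lemma lower_central_antimono: "i \<le> j \<Longrightarrow> lower_central G j \<subseteq> lower_central G i"
  unfolding lower_central_def by (intro iterated_commutator_antimono) auto

lemma iterated_commutator_add:
  "iterated_commutator G (iterated_commutator G R i) j = iterated_commutator G R (i + j)"
  by (induction j) auto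

text \<open>Hall-Witt expresses a conjugate of the third commutator through conjugates of the two
  given ones. The elementwise form fits the centralizer arguments and also yields
  \<open>jacobi_mod\<close>.\<close>

lemma three_subgroups_elementwise:
  assumes M: "M \<lhd> G"
    and [simp]: "a \<in> carrier G" "b \<in> carrier G" "c \<in> carrier G"
    and 1: "commutator G (commutator G a (inv b)) c \<in> M"
    and 2: "commutator G (commutator G c (inv a)) b \<in> M"
  shows "commutator G (commutator G b (inv c)) a \<in> M"
proof -
  let ?u = "inv b \<otimes> commutator G (commutator G a (inv b)) c \<otimes> b"
  let ?v = "inv c \<otimes> commutator G (commutator G b (inv c)) a \<otimes> c"
  let ?w = "inv a \<otimes> commutator G (commutator G c (inv a)) b \<otimes> a"
  have u: "?u \<in> M" and w: "?w \<in> M"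
    using 1 2 M by (auto intro: normal_inv_op_closed)
  have "?u \<otimes> ?v \<otimes> ?w = \<one>" by (rule hall_witt) auto
  then have "inv ?u \<otimes> (?u \<otimes> ?v \<otimes> ?w) \<otimes> inv ?w = inv ?u \<otimes> inv ?w"
    by simp
  moreover have "inv ?u \<otimes> (?u \<otimes> ?v \<otimes> ?w) \<otimes> inv ?w = ?v"
    if "?u \<in> carrier G" "?v \<in> carrier G" "?w \<in> carrier G"
    using that by (simp only: m_assoc inv_mult_cancel r_inv r_one m_closed inv_closed)
  ultimately have "?v = inv ?u \<otimes> inv ?w" by simp
  then have "?v \<in> M" using u w M normal_mult_closed normal_inv_closed by metis
  then show ?thesis using normal_conj_iff[OF M, of c] by simp
qed

text \<open>Index shift: \<open>iterated_commutator G (carrier G) j\<close> is the term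
  \<open>j + 1\<close> of the lower central series, so it counts for \<open>j + 1\<close>
  commutations. The induction keeps \<open>i\<close> free because Hall-Witt moves one factor
  \<open>G\<close> from the second entry to the first.\<close>

lemma commutator_iterated_lower_central:
  assumes R: "R \<lhd> G"
    and a: "a \<in> iterated_commutator G R i" and b: "b \<in> iterated_commutator G (carrier G) j"
  shows "commutator G a b \<in> iterated_commutator G R (Suc (i + j))"
  using a b
proof (induction j arbitrary: i a b)
  case 0
  then show ?case by (simp add: commutator_in_commutator_subgroup)
next
  case (Suc j)
  let ?M = "iterated_commutator G R (Suc (i + Suc j))"
  have M: "?M \<lhd> G" using R by (simp del: iterated_commutator.simps)
  have aG: "a \<in> carrier G"
    using Suc.prems R normal_mem_carrier normal_iterated_commutator by blast
  have "commutator_subgroup G (iterated_commutator G (carrier G) j) (carrier G)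
      \<subseteq> centralizer_mod ?M a"
  proof (rule commutator_subgroup_subset)
    show "subgroup (centralizer_mod ?M a) G"
      using M aG by (rule subgroup_centralizer_mod)
    fix b c assume b: "b \<in> iterated_commutator G (carrier G) j" and c: "c \<in> carrier G"
    have bG: "b \<in> carrier G"
      using b normal_mem_carrier normal_iterated_commutator[OF normal_carrier] by blast
    have ib: "inv b \<in> iterated_commutator G (carrier G) j"
      using b normal_inv_closed normal_iterated_commutator[OF normal_carrier] by blast
    \<comment> \<open>Hall-Witt is taken with \<open>inv c\<close> as third element, so that the
      commutator it delivers is \<open>[b, c]\<close> itself.\<close>
    have 1: "commutator G (commutator G a (inv b)) (inv c) \<in> ?M"
    proof -
      have "commutator G a (inv b) \<in> iterated_commutator G R (Suc (i + j))"
        using Suc.IH[OF Suc.prems(1) ib] .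
      then show ?thesis using c by (simp add: commutator_in_commutator_subgroup)
    qed
    have 2: "commutator G (commutator G (inv c) (inv a)) b \<in> ?M"
    proof -
      have "commutator G (inv a) (inv c) \<in> iterated_commutator G R (Suc i)"
        using Suc.prems(1) c normal_inv_closed[OF normal_iterated_commutator[OF R]]
        by (simp add: commutator_in_commutator_subgroup)
      then have "commutator G (inv c) (inv a) \<in> iterated_commutator G R (Suc i)"
        using commutator_swap[OF normal_imp_subgroup[OF normal_iterated_commutator[OF R]]] c aG
        by (meson inv_closed)
      from Suc.IH[OF this b] show ?thesis by simp
    qed
    have "commutator G (commutator G b (inv (inv c))) a \<in> ?M"
      using three_subgroups_elementwise[OF M aG bG _ 1 2] c by simp
    then show "commutator G b c \<in> centralizer_mod ?M a"
      using centralizer_mod_sym[OF M aG] bG c aG by (auto simp: centralizer_mod_def)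
  qed
  then show ?case using Suc.prems(2) by (auto simp: centralizer_mod_def)
qed

lemma commutator_lower_central:
  assumes "a \<in> lower_central G i" "b \<in> lower_central G j"
  shows "commutator G a b \<in> lower_central G (i + j)"
proof -
  have [simp]: "a \<in> carrier G" "b \<in> carrier G" using assms normal_mem_carrier normal_lower_central by blast+
  consider "i = 0" | "j = 0" | i' j' where "i = Suc i'" "j = Suc j'"
    by (metis not0_implies_Suc)
  then show ?thesis
  proof cases
    case 1 then show ?thesis using assms by (simp add: normal_commutator_right)
  next
    case 2 then show ?thesis using assms by (simp add: normal_commutator_left)
  next
    case 3 then show ?thesis
      using assms commutator_iterated_lower_central[OF normal_carrier, of a i' b j']
      by (simp add: lower_central_def)
  qed
qed

end

section \<open>Polynomial sequences\<close>

context group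
begin

text \<open>Polynomial sequences in the sense of Leibman, with respect to the lower central series. Only the
  derivatives of order below \<open>e\<close> are constrained, so that closure under products and commutators
  can be proved by induction on \<open>e\<close>, for all \<open>j\<close> at once.\<close>

primrec poly_seq :: "nat \<Rightarrow> nat \<Rightarrow> (nat \<Rightarrow> 'a) \<Rightarrow> bool" where
  "poly_seq 0 j g \<longleftrightarrow> True"
| "poly_seq (Suc e) j g \<longleftrightarrow>
     (\<forall>k. g k \<in> lower_central G j) \<and> poly_seq e (Suc j) (\<lambda>k. inv (g k) \<otimes> g (Suc k))"

lemma poly_seq_mono_depth: "poly_seq (Suc e) j g \<Longrightarrow> poly_seq e j g"
proof (induction e arbitrary: j g)
  case (Suc e)
  have "poly_seq e (Suc j) (\<lambda>k. inv (g k) \<otimes> g (Suc k))"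
    by (rule Suc.IH) (use Suc.prems in simp)
  then show ?case using Suc.prems by simp
qed simp

lemma poly_seq_antimono_weight: "\<lbrakk>poly_seq e j g; i \<le> j\<rbrakk> \<Longrightarrow> poly_seq e i g"
proof (induction e arbitrary: i j g)
  case (Suc e)
  have "poly_seq e (Suc i) (\<lambda>k. inv (g k) \<otimes> g (Suc k))"
    by (rule Suc.IH[where j = "Suc j"]) (use Suc.prems in simp_all)
  then show ?case using Suc.prems lower_central_antimono[of i j] by auto
qed auto

lemma poly_seq_const: "a \<in> lower_central G j \<Longrightarrow> poly_seq e j (\<lambda>_. a)"
proof (induction e arbitrary: j a)
  case (Suc e)
  have "a \<in> carrier G" using Suc.prems normal_lower_central normal_mem_carrier by blast
  moreover have "\<one> \<in> lower_central G (Suc j)"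
    by (rule subgroup.one_closed[OF normal_imp_subgroup[OF normal_lower_central]])
  ultimately show ?case using Suc by simp
qed simp

text \<open>A discrete Leibniz rule: \<open>a\<close> and \<open>b\<close> are the increments of
  \<open>f\<close> and \<open>g\<close>. Every factor on the right involves an increment and is
  built from products and commutators only, so it lies as deep as the increments do.\<close>

lemma commutator_mult_mult:
  assumes [simp]: "f \<in> carrier G" "g \<in> carrier G" "a \<in> carrier G" "b \<in> carrier G"
  defines "C \<equiv> commutator G f g"
  defines "X \<equiv> commutator G (f \<otimes> a) b"
    and "u \<equiv> commutator G C a \<otimes> commutator G a g"
  shows "inv C \<otimes> commutator G (f \<otimes> a) (g \<otimes> b) =
      X \<otimes> commutator G X C \<otimes> commutator G C b \<otimes> u \<otimes> commutator G u b"
proof -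
  have [simp]: "C \<in> carrier G" "X \<in> carrier G" "u \<in> carrier G" by (simp_all add: C_def X_def u_def)
  have 1: "commutator G (f \<otimes> a) (g \<otimes> b) = X \<otimes> (inv b \<otimes> commutator G (f \<otimes> a) g \<otimes> b)"
    by (simp add: commutator_mult_right X_def)
  have 2: "commutator G (f \<otimes> a) g = C \<otimes> u"
    unfolding u_def C_def by (simp add: commutator_def m_assoc inv_mult_group)
  show ?thesis unfolding 1 2 by (simp add: commutator_def m_assoc inv_mult_group)
qed

text \<open>The three closure properties need each other: the increment of a product or an inverse
  contains a commutator, that of a commutator contains products. Increments have one derivative less
  and weight one more, which the hypothesis for \<open>e\<close> covers.\<close>

lemma poly_seq_closed_aux:
  "(\<forall>j f g. poly_seq e j f \<longrightarrow> poly_seq e j g \<longrightarrow> poly_seq e j (\<lambda>k. f k \<otimes> g k)) \<and>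
   (\<forall>j f. poly_seq e j f \<longrightarrow> poly_seq e j (\<lambda>k. inv (f k))) \<and>
   (\<forall>i j f g. poly_seq e i f \<longrightarrow> poly_seq e j g \<longrightarrow>
      poly_seq e (i + j) (\<lambda>k. commutator G (f k) (g k)))"
proof (induction e)
  case (Suc e)
  have mult: "poly_seq e j (\<lambda>k. f k \<otimes> g k)" if "poly_seq e j f" "poly_seq e j g" for j f g
    using Suc.IH that by blast
  have inve: "poly_seq e j (\<lambda>k. inv (f k))" if "poly_seq e j f" for j f
    using Suc.IH that by blast
  have com: "poly_seq e l (\<lambda>k. commutator G (f k) (g k))"
    if "poly_seq e i f" "poly_seq e j g" "l \<le> i + j" for i j l f g
    using Suc.IH that(1,2) poly_seq_antimono_weight[OF _ that(3)] by blast
  have sub: "subgroup (lower_central G j) G" for j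
    by (simp add: normal_imp_subgroup)
  have carr: "f k \<in> carrier G" if "poly_seq (Suc e) j f" for f j k
    using that subgroup.mem_carrier[OF sub] by auto
  have D: "poly_seq e (Suc j) (\<lambda>k. inv (f k) \<otimes> f (Suc k))" if "poly_seq (Suc e) j f" for f j
    using that by simp
  have "poly_seq (Suc e) j (\<lambda>k. f k \<otimes> g k)"
    if f: "poly_seq (Suc e) j f" and g: "poly_seq (Suc e) j g" for j f g
  proof -
    define a where "a = (\<lambda>k. inv (f k) \<otimes> f (Suc k))"
    define b where "b = (\<lambda>k. inv (g k) \<otimes> g (Suc k))"
    have a: "poly_seq e (Suc j) a" and b: "poly_seq e (Suc j) b"
      using D[OF f] D[OF g] unfolding a_def b_def by simp_all
    \<comment> \<open>The increment of \<open>f g\<close> is \<open>g^-1 a g b\<close>, and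
      \<open>g^-1 a g = a [a, g]\<close>.\<close>
    have "poly_seq e (Suc j) (\<lambda>k. a k \<otimes> commutator G (a k) (g k) \<otimes> b k)"
      by (intro mult a b com[OF a poly_seq_mono_depth[OF g]]) simp
    moreover have "inv (f k \<otimes> g k) \<otimes> (f (Suc k) \<otimes> g (Suc k)) =
        a k \<otimes> commutator G (a k) (g k) \<otimes> b k" for k
      unfolding a_def b_def using carr[OF f] carr[OF g]
      by (simp add: commutator_def m_assoc inv_mult_group)
    ultimately show ?thesis
      using f g subgroup.m_closed[OF sub] by simp
  qed
  moreover have "poly_seq (Suc e) j (\<lambda>k. inv (f k))" if f: "poly_seq (Suc e) j f" for j f
  proof -
    define a where "a = (\<lambda>k. inv (f k) \<otimes> f (Suc k))"
    have a: "poly_seq e (Suc j) a"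
      using D[OF f] unfolding a_def by simp
    have "poly_seq e (Suc j) (\<lambda>k. inv (a k) \<otimes> commutator G (inv (a k)) (inv (f k)))"
      by (intro mult inve a com[OF inve[OF a] inve[OF poly_seq_mono_depth[OF f]]]) simp
    moreover have "inv (inv (f k)) \<otimes> inv (f (Suc k)) =
        inv (a k) \<otimes> commutator G (inv (a k)) (inv (f k))" for k
      unfolding a_def using carr[OF f] by (simp add: commutator_def m_assoc inv_mult_group)
    ultimately show ?thesis
      using f subgroup.m_inv_closed[OF sub] by simp
  qed
  moreover have "poly_seq (Suc e) (i + j) (\<lambda>k. commutator G (f k) (g k))"
    if f: "poly_seq (Suc e) i f" and g: "poly_seq (Suc e) j g" for i j f g
  proof -
    define a where "a = (\<lambda>k. inv (f k) \<otimes> f (Suc k))"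
    define b where "b = (\<lambda>k. inv (g k) \<otimes> g (Suc k))"
    define C where "C = (\<lambda>k. commutator G (f k) (g k))"
    define X where "X = (\<lambda>k. commutator G (f k \<otimes> a k) (b k))"
    define u where "u = (\<lambda>k. commutator G (C k) (a k) \<otimes> commutator G (a k) (g k))"
    note cf = carr[OF f] and cg = carr[OF g]
    have a: "poly_seq e (Suc i) a" and b: "poly_seq e (Suc j) b"
      using D[OF f] D[OF g] unfolding a_def b_def by simp_all
    have f': "poly_seq e i f" and g': "poly_seq e j g"
      using f g poly_seq_mono_depth by blast+
    have C: "poly_seq e (i + j) C"
      unfolding C_def using com[OF f' g'] by simp
    have "poly_seq e i (\<lambda>k. f k \<otimes> a k)"
      by (intro mult f' poly_seq_antimono_weight[OF a]) simp
    from com[OF this b] have X: "poly_seq e (Suc (i + j)) X" unfolding X_def by simp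
    have u: "poly_seq e (Suc (i + j)) u"
      unfolding u_def by (intro mult com[OF C a] com[OF a g']) auto
    have "poly_seq e (Suc (i + j)) (\<lambda>k. X k \<otimes> commutator G (X k) (C k) \<otimes>
        commutator G (C k) (b k) \<otimes> u k \<otimes> commutator G (u k) (b k))"
      by (intro mult X u com[OF X C] com[OF C b] com[OF u b]) auto
    moreover have "inv (C k) \<otimes> C (Suc k) = X k \<otimes> commutator G (X k) (C k) \<otimes>
        commutator G (C k) (b k) \<otimes> u k \<otimes> commutator G (u k) (b k)" for k
    proof -
      have ab: "a k \<in> carrier G" "b k \<in> carrier G"
        using cf cg unfolding a_def b_def by auto
      have "f (Suc k) = f k \<otimes> a k" "g (Suc k) = g k \<otimes> b k"
        using cf cg unfolding a_def b_def by auto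
      then show ?thesis
        using commutator_mult_mult[of "f k" "g k" "a k" "b k"] cf cg ab
        unfolding C_def X_def u_def by simp
    qed
    ultimately show ?thesis
      using f g commutator_lower_central unfolding C_def by simp
  qed
  ultimately show ?case by blast
qed auto

lemma poly_seq_commutator:
  "\<lbrakk>poly_seq e i f; poly_seq e j g\<rbrakk> \<Longrightarrow> poly_seq e (i + j) (\<lambda>k. commutator G (f k) (g k))"
  using poly_seq_closed_aux[of e] by blast

text \<open>The first increment is the constant \<open>a\<close>, of which only weight 1 is known;
  this forces the start in weight 0.\<close>

lemma poly_seq_power:
  assumes "a \<in> carrier G" shows "poly_seq e 0 (\<lambda>k::nat. a [^] k)"
proof (cases e)
  case (Suc e')
  have "inv (a [^] k) \<otimes> a [^] Suc k = a" for k :: nat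
    using assms by (simp only: nat_pow_Suc inv_mult_cancel nat_pow_closed)
  then show ?thesis using Suc assms poly_seq_const[of a "Suc 0" e'] by simp
qed simp

definition difference :: "(nat \<Rightarrow> 'a) \<Rightarrow> nat \<Rightarrow> 'a" where
  "difference g = (\<lambda>k. inv (g k) \<otimes> g (Suc k))"

lemma poly_seq_difference:
  "\<lbrakk>poly_seq e j g; i < e\<rbrakk> \<Longrightarrow> (difference ^^ i) g k \<in> lower_central G (j + i)"
proof (induction i arbitrary: e j g)
  case 0
  then show ?case by (cases e) auto
next
  case (Suc i)
  then obtain e' where e: "e = Suc e'" by (cases e) auto
  have "(difference ^^ i) (difference g) k \<in> lower_central G (Suc j + i)"
    using Suc.prems e by (intro Suc.IH[where e = e']) (auto simp: difference_def)
  then show ?case by (simp add: funpow_swap1)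
qed

lemma difference_funpow_closed:
  "(\<And>k. g k \<in> carrier G) \<Longrightarrow> (difference ^^ i) g k \<in> carrier G"
  by (induction i arbitrary: k) (auto simp: difference_def)

end

context comm_group
begin

text \<open>Newton's formula in multiplicative notation: \<open>g (n + 1)\<close> is
  \<open>difference g n\<close> times \<open>g n\<close>, both expanded by the induction hypothesis,
  and the exponents add up by Pascal's rule.\<close>

lemma newton_forward_difference:
  assumes "\<And>k. g k \<in> carrier G"
  shows "g n = finprod G (\<lambda>i. (difference ^^ i) g 0 [^] (n choose i)) {..n}"
  using assms
proof (induction n arbitrary: g)
  case 0
  have "finprod G (\<lambda>i. (difference ^^ i) g 0 [^] (0 choose i :: nat)) {..0} = g 0"
    using 0 by (simp add: finprod_insert[of "{}", simplified])
  then show ?case by simp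
next
  case (Suc n)
  let ?D = "\<lambda>i. (difference ^^ i) g 0"
  have D [simp]: "?D i \<in> carrier G" for i
    using Suc.prems by (rule difference_funpow_closed)
  have D0: "?D 0 = g 0" by simp
  have "g n = finprod G (\<lambda>i. ?D i [^] (n choose i)) {..n}"
    using Suc by blast
  \<comment> \<open>The added factor has exponent \<open>n choose (n + 1) = 0\<close>. Splitting off
    the factor at 0 afterwards aligns the indices with the expansion of
    \<open>difference g\<close>.\<close>
  also have "\<dots> = finprod G (\<lambda>i. ?D i [^] (n choose i)) {..Suc n}"
    by (subst finprod_Suc) (auto simp: binomial_eq_0 simp del: funpow.simps intro: finprod_closed)
  also have "\<dots> = finprod G (\<lambda>i. ?D (Suc i) [^] (n choose Suc i)) {..n} \<otimes> ?D 0 [^] (n choose 0)"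
    by (subst finprod_Suc2) auto
  finally have 1: "g n = finprod G (\<lambda>i. ?D (Suc i) [^] (n choose Suc i)) {..n} \<otimes> ?D 0"
    using Suc.prems by simp
  have "difference g n = finprod G (\<lambda>i. (difference ^^ i) (difference g) 0 [^] (n choose i)) {..n}"
    using Suc.prems by (intro Suc.IH) (simp add: difference_def)
  then have 2: "difference g n = finprod G (\<lambda>i. ?D (Suc i) [^] (n choose i)) {..n}"
    by (simp add: funpow_swap1)
  have "g (Suc n) = difference g n \<otimes> g n"
    using Suc.prems m_comm[of "inv (g n) \<otimes> g (Suc n)" "g n"] by (simp add: difference_def)
  also have "\<dots> = finprod G (\<lambda>i. ?D (Suc i) [^] (n choose i) \<otimes> ?D (Suc i) [^] (n choose Suc i)) {..n} \<otimes> ?D 0"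
    unfolding 1 2 using Suc.prems by (subst finprod_multf) (auto simp: m_assoc Pi_def simp del: funpow.simps)
  also have "\<dots> = finprod G (\<lambda>i. ?D (Suc i) [^] (Suc n choose Suc i)) {..n} \<otimes> ?D 0 [^] (Suc n choose 0)"
    using D[of 0] by (simp add: nat_pow_mult del: funpow.simps D)
       (simp add: Suc.prems D nat_pow_mult del: funpow.simps)
  also have "\<dots> = finprod G (\<lambda>i. ?D i [^] (Suc n choose i)) {..Suc n}"
    by (rule finprod_Suc2[symmetric]) auto
  finally show ?case .
qed

text \<open>In Newton's expansion at \<open>r\<close> the factor of degree 0 is \<open>g 0\<close>,
  those of degrees 2 to \<open>n\<close> are killed by \<open>d\<close>, and those beyond
  \<open>n\<close> are trivial. Only degree 1 is left, with exponent
  \<open>r choose 1 = r\<close>.\<close>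

lemma pow_first_difference:
  fixes d r n :: nat
  assumes g: "\<And>k. g k \<in> carrier G" and g0: "g 0 = \<one>" and gr: "g r = \<one>"
    and tors: "\<And>i. 2 \<le> i \<Longrightarrow> i \<le> n \<Longrightarrow> (difference ^^ i) g 0 [^] d = \<one>"
    and van: "\<And>i. n < i \<Longrightarrow> (difference ^^ i) g 0 = \<one>"
    and d: "\<And>i. 1 \<le> i \<Longrightarrow> i \<le> n \<Longrightarrow> d dvd (r choose i)"
  shows "g 1 [^] r = \<one>"
proof (cases r)
  case (Suc r')
  let ?D = "\<lambda>i. (difference ^^ i) g 0"
  have D [simp]: "?D i \<in> carrier G" for i
    using g by (rule difference_funpow_closed)
  have 1: "?D i [^] (r choose i) = \<one>" if i1: "i \<noteq> 1" for i
  proof -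
    consider "i = 0" | "n < i" | "2 \<le> i" "i \<le> n" proof -
      assume *: "i = 0 \<Longrightarrow> thesis" "n < i \<Longrightarrow> thesis" "2 \<le> i \<Longrightarrow> i \<le> n \<Longrightarrow> thesis"
      have "i = 0 \<or> n < i \<or> 2 \<le> i \<and> i \<le> n" using i1 by linarith
      then show thesis using * by blast
    qed
    then show ?thesis
    proof cases
      case 3
      then obtain q where "r choose i = d * q" using d[of i] by auto
      then show ?thesis using tors[OF 3] by (simp flip: nat_pow_pow)
    qed (use g0 van in auto)
  qed
  have "\<one> = finprod G (\<lambda>i. ?D i [^] (r choose i)) {..r}"
    using newton_forward_difference[of g r] g gr by simp
  also have "\<dots> = finprod G (\<lambda>i. if 1 = i then ?D i [^] (r choose i) else \<one>) {..r}"
    using 1 by (intro finprod_cong') auto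
  also have "\<dots> = ?D 1 [^] (r choose 1)"
    using Suc by (intro finprod_singleton) auto
  also have "?D 1 = g 1" using g g0 by (simp add: difference_def)
  finally show ?thesis by simp
qed simp

end

section \<open>Abelian sections\<close>

locale abelian_section = group G for G (structure) +
  fixes A T
  assumes normal_A: "A \<lhd> G" and normal_T: "T \<lhd> G" and T_subset: "T \<subseteq> A"
    and commutator_in_T: "\<lbrakk>a \<in> A; b \<in> A\<rbrakk> \<Longrightarrow> commutator G a b \<in> T"
begin

text \<open>Formed as a group with carrier restricted to \<open>A\<close> so as to agree literally
  with \<open>baer_invariant\<close>.\<close>

definition Q where "Q = G\<lparr>carrier := A\<rparr> Mod T"

lemma A_carrier: "a \<in> A \<Longrightarrow> a \<in> carrier G"
  using normal_A normal_mem_carrier by blast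

lemma normal_in_A: "T \<lhd> G\<lparr>carrier := A\<rparr>"
  using normal_restrict_supergroup normal_imp_subgroup[OF normal_A] normal_T T_subset by blast

lemma carrier_Q: "carrier Q = (\<lambda>a. T #> a) ` A"
  by (simp add: Q_def carrier_FactGroup r_coset_def)

lemma coset_in_Q [simp]: "a \<in> A \<Longrightarrow> T #> a \<in> carrier Q"
  by (simp add: carrier_Q)

lemma one_Q: "\<one>\<^bsub>Q\<^esub> = T"
  by (simp add: Q_def)

lemma coset_mult [simp]:
  assumes "a \<in> A" "b \<in> A" shows "(T #> a) \<otimes>\<^bsub>Q\<^esub> (T #> b) = T #> (a \<otimes> b)"
  using normal.rcos_sum[OF normal_T] assms A_carrier
  by (simp add: Q_def set_mult_def)

lemma coset_eq_one_iff:
  assumes "a \<in> carrier G" shows "T #> a = \<one>\<^bsub>Q\<^esub> \<longleftrightarrow> a \<in> T"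
  using assms coset_join1 coset_join2 normal_imp_subgroup[OF normal_T] unfolding one_Q by blast

lemma comm_group_Q: "comm_group Q"
proof -
  interpret QG: group Q
    unfolding Q_def using normal.factorgroup_is_group[OF normal_in_A] .
  show ?thesis
  proof (rule QG.group_comm_groupI)
    fix x y assume "x \<in> carrier Q" "y \<in> carrier Q"
    then obtain a b where ab: "a \<in> A" "b \<in> A" and xy: "x = T #> a" "y = T #> b"
      by (auto simp: carrier_Q)
    note [simp] = ab[THEN A_carrier]
    have "a \<otimes> b = (b \<otimes> a) \<otimes> commutator G a b"
      by (simp add: commutator_def m_assoc)
    also have "T #> \<dots> = T #> (b \<otimes> a)"
    proof -
      have c: "commutator G a b \<in> T" using ab commutator_in_T by blast
      have "T #> ((b \<otimes> a) \<otimes> commutator G a b) = (T #> (b \<otimes> a)) <#> (T #> commutator G a b)"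
        by (simp add: normal.rcos_sum[OF normal_T])
      also have "\<dots> = (T #> (b \<otimes> a)) <#> (T #> \<one>)"
        using c coset_join2[of _ T] normal_imp_subgroup[OF normal_T] subgroup.one_closed[of T G] by simp
      also have "\<dots> = T #> (b \<otimes> a)" by (subst normal.rcos_sum[OF normal_T]) auto
      finally show ?thesis .
    qed
    finally show "x \<otimes>\<^bsub>Q\<^esub> y = y \<otimes>\<^bsub>Q\<^esub> x"
      using ab xy by simp
  qed
qed

sublocale Q: comm_group Q by (rule comm_group_Q)

lemma subgroup_A: "subgroup A G" by (rule normal_imp_subgroup[OF normal_A])

lemma coset_inv:
  assumes "a \<in> A" shows "inv\<^bsub>Q\<^esub> (T #> a) = T #> inv a"
proof (rule Q.inv_equality)
  have "inv a \<in> A" using assms subgroup.m_inv_closed[OF subgroup_A] by blast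
  then show "(T #> inv a) \<otimes>\<^bsub>Q\<^esub> (T #> a) = \<one>\<^bsub>Q\<^esub>" "T #> inv a \<in> carrier Q"
    using assms A_carrier coset_join2[OF one_closed normal_imp_subgroup[OF normal_T]]
      subgroup.one_closed[OF normal_imp_subgroup[OF normal_T]]
    by (simp_all add: one_Q)
qed (use assms in simp)

lemma coset_pow:
  fixes n :: nat
  assumes "a \<in> A" shows "(T #> a) [^]\<^bsub>Q\<^esub> n = T #> (a [^] n)"
proof (induction n)
  case 0
  then show ?case using coset_eq_one_iff[of \<one>] subgroup.one_closed[OF normal_imp_subgroup[OF normal_T]]
    by simp
next
  case (Suc n)
  have "a [^] n \<in> A" using assms subgroup_A by (induction n) (auto simp: subgroup.one_closed subgroup.m_closed)
  then show ?case using assms Suc by simp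
qed

lemma difference_coset:
  assumes "\<And>k. g k \<in> A"
  shows "(Q.difference ^^ i) (\<lambda>k. T #> g k) k = T #> (difference ^^ i) g k \<and> (difference ^^ i) g k \<in> A"
proof (induction i arbitrary: k)
  case (Suc i)
  let ?g = "(difference ^^ i) g" and ?h = "(Q.difference ^^ i) (\<lambda>k. T #> g k)"
  have 1: "inv (?g k) \<in> A" using Suc[of k] subgroup.m_inv_closed[OF subgroup_A] by blast
  have 2: "(difference ^^ Suc i) g k = inv (?g k) \<otimes> ?g (Suc k)"
    by (simp add: difference_def)
  have 3: "(Q.difference ^^ Suc i) (\<lambda>k. T #> g k) k = inv\<^bsub>Q\<^esub> (?h k) \<otimes>\<^bsub>Q\<^esub> ?h (Suc k)"
    by (simp add: Q.difference_def)
  show ?case unfolding 2 3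
    using 1 Suc[of k] Suc[of "Suc k"] subgroup.m_closed[OF subgroup_A] by (simp add: coset_inv)
qed (use assms in auto)

end

section \<open>Free groups\<close>

definition flip :: "bool \<times> 'a \<Rightarrow> bool \<times> 'a" where
  "flip p = (\<not> fst p, snd p)"

lemma flip_flip [simp]: "flip (flip p) = p"
  and snd_flip [simp]: "snd (flip p) = snd p"
  by (simp_all add: flip_def)

lemma cancels_iff: "snd p = snd q \<and> fst p \<noteq> fst q \<longleftrightarrow> q = flip p"
  by (cases p; cases q) (auto simp: flip_def)

lemma push_Cons: "push p (q # w) = (if q = flip p then w else p # q # w)"
  by (simp only: push.simps cancels_iff)

lemma reduced_Cons2: "reduced (p # q # w) \<longleftrightarrow> q \<noteq> flip p \<and> reduced (q # w)"
  by (simp only: reduced.simps cancels_iff)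

declare push.simps(2) [simp del] reduced.simps(1) [simp del]

lemma reduced_tl: "reduced (p # w) \<Longrightarrow> reduced w"
  by (cases w) (simp_all add: reduced_Cons2)

lemma push_reduced_Cons: "reduced (p # w) \<Longrightarrow> push p w = p # w"
  by (cases w) (simp_all add: reduced_Cons2 push_Cons)

lemma reduced_push: "reduced w \<Longrightarrow> reduced (push p w)"
  by (cases w) (auto simp: reduced_Cons2 push_Cons intro: reduced_tl)

text \<open>Van der Waerden's device: each letter acts as a permutation of the reduced words,
  inverse to the action of its formal inverse. Multiplication of words is this action, whence
  associativity.\<close>

lemma push_flip: "reduced w \<Longrightarrow> push p (push (flip p) w) = w"
proof (cases w)
  case (Cons q w')
  assume "reduced w"
  then show ?thesis using Cons push_reduced_Cons[of p w'] by (auto simp: push_Cons)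
qed (simp add: push_Cons)

lemma reduced_foldr_push: "reduced w \<Longrightarrow> reduced (foldr push u w)"
  by (induction u) (auto intro: reduced_push)

text \<open>If \<open>p\<close> cancels against the head of \<open>z\<close>, the two opposite
  pushes on the right-hand side cancel as well.\<close>

lemma foldr_push_push:
  assumes "reduced w"
  shows "foldr push (push p z) w = push p (foldr push z w)"
  using push_flip[of "foldr push (tl z) w" p] reduced_foldr_push[OF assms]
  by (cases z) (auto simp: push_Cons)

lemma foldr_push_assoc:
  "reduced w \<Longrightarrow> foldr push (foldr push u v) w = foldr push u (foldr push v w)"
  by (induction u) (auto simp: foldr_push_push)

lemma foldr_push_inverse: "foldr push (rev (map flip w)) w = []"
  by (induction w) (auto simp: push_Cons)

lemma set_push: "set (push p w) \<subseteq> insert p (set w)"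
  by (cases w) (auto simp: push_Cons)

lemma set_foldr_push: "set (foldr push u v) \<subseteq> set u \<union> set v"
proof (induction u)
  case (Cons p u)
  then show ?case using set_push[of p "foldr push u v"] by auto
qed simp

lemma carrier_free_group: "carrier (free_group X) = {w. reduced w \<and> snd ` set w \<subseteq> X}"
  and mult_free_group: "u \<otimes>\<^bsub>free_group X\<^esub> v = foldr push u v"
  and one_free_group: "\<one>\<^bsub>free_group X\<^esub> = []"
  by (simp_all add: free_group_def)

lemma foldr_push_closed:
  assumes "snd ` set u \<subseteq> X" "v \<in> carrier (free_group X)"
  shows "foldr push u v \<in> carrier (free_group X)"
  using assms set_foldr_push[of u v] reduced_foldr_push[of v u]
  unfolding carrier_free_group by fast

lemma group_free_group: "group (free_group X)"
proof (rule groupI)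
  fix w assume w: "w \<in> carrier (free_group X)"
  let ?u = "foldr push (rev (map flip w)) []"
  have "?u \<in> carrier (free_group X)"
    using w by (intro foldr_push_closed) (auto simp: carrier_free_group)
  moreover have "?u \<otimes>\<^bsub>free_group X\<^esub> w = \<one>\<^bsub>free_group X\<^esub>"
    using w by (simp add: mult_free_group one_free_group carrier_free_group foldr_push_assoc
        foldr_push_inverse)
  ultimately show "\<exists>v\<in>carrier (free_group X). v \<otimes>\<^bsub>free_group X\<^esub> w = \<one>\<^bsub>free_group X\<^esub>"
    by blast
next
  fix u v assume "u \<in> carrier (free_group X)" "v \<in> carrier (free_group X)"
  then show "u \<otimes>\<^bsub>free_group X\<^esub> v \<in> carrier (free_group X)"
    unfolding mult_free_group by (intro foldr_push_closed) (auto simp: carrier_free_group)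
qed (auto simp: mult_free_group one_free_group carrier_free_group foldr_push_assoc)

lemma Cons_in_free_group:
  assumes "p # w \<in> carrier (free_group X)"
  shows "w \<in> carrier (free_group X)" "[p] \<in> carrier (free_group X)"
    "p # w = [p] \<otimes>\<^bsub>free_group X\<^esub> w"
  using assms reduced_tl[of p w] by (auto simp: carrier_free_group mult_free_group push_reduced_Cons)

lemma inv_letter_free_group:
  assumes "a \<in> X"
  shows "inv\<^bsub>free_group X\<^esub> [(True, a)] = [(False, a)]"
  using assms
  by (intro group.inv_equality[OF group_free_group])
     (auto simp: carrier_free_group mult_free_group one_free_group push_Cons flip_def)

section \<open>The universal property and projectivity of free groups\<close>

definition lift_word :: "('h, 'm) monoid_scheme \<Rightarrow> ('a \<Rightarrow> 'h) \<Rightarrow> 'a word \<Rightarrow> 'h" where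
  "lift_word H \<phi> w = foldr (\<lambda>p g. (if fst p then \<phi> (snd p) else inv\<^bsub>H\<^esub> (\<phi> (snd p))) \<otimes>\<^bsub>H\<^esub> g) w \<one>\<^bsub>H\<^esub>"

context group
begin

lemma lift_word_Nil [simp]: "lift_word G \<phi> [] = \<one>"
  and lift_word_Cons: "lift_word G \<phi> (p # w) =
    (if fst p then \<phi> (snd p) else inv (\<phi> (snd p))) \<otimes> lift_word G \<phi> w"
  by (simp_all add: lift_word_def)

lemma lift_word_closed:
  assumes "\<phi> ` X \<subseteq> carrier G" "snd ` set w \<subseteq> X"
  shows "lift_word G \<phi> w \<in> carrier G"
  using assms(2)
proof (induction w)
  case (Cons p w)
  then have "\<phi> (snd p) \<in> carrier G" using assms(1) by auto
  then show ?case using Cons by (simp add: lift_word_Cons)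
qed simp

lemma lift_word_push:
  assumes "\<phi> ` X \<subseteq> carrier G" "snd ` set (p # w) \<subseteq> X"
  shows "lift_word G \<phi> (push p w) = lift_word G \<phi> (p # w)"
proof (cases w)
  case (Cons q v)
  have "\<phi> (snd p) \<in> carrier G" "lift_word G \<phi> v \<in> carrier G"
    using assms Cons lift_word_closed[of \<phi> X v] by auto
  then show ?thesis
    using Cons by (cases p) (auto simp: push_Cons flip_def lift_word_Cons simp flip: m_assoc)
qed simp

lemma lift_word_hom:
  assumes \<phi>: "\<phi> ` X \<subseteq> carrier G"
  shows "lift_word G \<phi> \<in> hom (free_group X) G"
proof (rule homI)
  fix u v assume u: "u \<in> carrier (free_group X)" and v: "v \<in> carrier (free_group X)"
  have "snd ` set u \<subseteq> X" using u by (simp add: carrier_free_group)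
  then have "lift_word G \<phi> (foldr push u v) = lift_word G \<phi> u \<otimes> lift_word G \<phi> v"
  proof (induction u)
    case Nil
    then show ?case using v lift_word_closed[OF \<phi>] by (simp add: carrier_free_group)
  next
    case (Cons p u)
    have c: "lift_word G \<phi> u \<in> carrier G" "lift_word G \<phi> v \<in> carrier G" "\<phi> (snd p) \<in> carrier G"
      using Cons.prems v \<phi> lift_word_closed[OF \<phi>] by (auto simp: carrier_free_group)
    have "snd ` set (p # foldr push u v) \<subseteq> X"
      using Cons.prems v set_foldr_push[of u v] unfolding carrier_free_group by fastforce
    from lift_word_push[OF \<phi> this] show ?case
      using Cons c by (auto simp: lift_word_Cons m_assoc)
  qed
  then show "lift_word G \<phi> (u \<otimes>\<^bsub>free_group X\<^esub> v) = lift_word G \<phi> u \<otimes> lift_word G \<phi> v"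
    by (simp add: mult_free_group)
qed (use lift_word_closed[OF \<phi>] in \<open>auto simp: carrier_free_group\<close>)

end

lemma generate_free_group:
  "carrier (free_group X) = generate (free_group X) ((\<lambda>a. [(True, a)]) ` X)"
proof -
  interpret F: group "free_group X" by (rule group_free_group)
  have X: "(\<lambda>a. [(True, a)]) ` X \<subseteq> carrier (free_group X)"
    by (auto simp: carrier_free_group)
  have "w \<in> generate (free_group X) ((\<lambda>a. [(True, a)]) ` X)" if "w \<in> carrier (free_group X)" for w
    using that
  proof (induction w)
    case Nil
    then show ?case using generate.one[of "free_group X"] by (simp add: one_free_group)
  next
    case (Cons p w)
    have a: "snd p \<in> X" using Cons.prems by (simp add: carrier_free_group)
    have "[p] \<in> generate (free_group X) ((\<lambda>a. [(True, a)]) ` X)"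
    proof (cases "fst p")
      case True
      then have "[p] = [(True, snd p)]" by (cases p) simp
      then show ?thesis using a by (auto intro!: generate.incl)
    next
      case False
      then have "[p] = inv\<^bsub>free_group X\<^esub> [(True, snd p)]"
        using a by (cases p) (simp add: inv_letter_free_group)
      then show ?thesis using a by (auto intro!: generate.inv)
    qed
    then show ?case
      using Cons Cons_in_free_group[OF Cons.prems] by (auto intro: generate.eng)
  qed
  then show ?thesis using F.generate_incl[OF X] by blast
qed

lemma free_presentation_group: "free_presentation F \<pi> G \<Longrightarrow> group F"
  by (auto simp: free_presentation_def freely_generated_by_def)

text \<open>Projectivity: preimages under \<open>\<rho>\<close> of the images of the generators are
  chosen, and agreement is then checked letter by letter.\<close>

lemma free_group_lift:
  assumes G: "group G" and H: "group H" and \<rho>: "\<rho> \<in> epi H G"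
    and \<pi>: "\<pi> \<in> hom (free_group X) G"
  obtains \<alpha> where "\<alpha> \<in> hom (free_group X) H"
    "\<And>w. w \<in> carrier (free_group X) \<Longrightarrow> \<rho> (\<alpha> w) = \<pi> w"
proof -
  interpret F: group "free_group X" by (rule group_free_group)
  interpret H: group H by (rule H)
  interpret \<pi>: group_hom "free_group X" G \<pi>
    using \<pi> G by (simp add: group_hom_def group_hom_axioms_def F.is_group)
  interpret \<rho>: group_hom H G \<rho>
    using \<rho> G H by (simp add: group_hom_def group_hom_axioms_def epi_def)
  have gen: "[(True, x)] \<in> carrier (free_group X)" if "x \<in> X" for x
    using that by (simp add: carrier_free_group)
  define \<phi> where "\<phi> = (\<lambda>x. SOME h. h \<in> carrier H \<and> \<rho> h = \<pi> [(True, x)])"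
  have \<phi>: "\<phi> x \<in> carrier H \<and> \<rho> (\<phi> x) = \<pi> [(True, x)]" if "x \<in> X" for x
  proof -
    have "\<pi> [(True, x)] \<in> \<rho> ` carrier H" using gen[OF that] \<rho> by (auto simp: epi_def)
    then have "\<exists>h. h \<in> carrier H \<and> \<rho> h = \<pi> [(True, x)]" by auto
    then show ?thesis unfolding \<phi>_def by (rule someI_ex)
  qed
  then have \<phi>X: "\<phi> ` X \<subseteq> carrier H" by blast
  have "\<rho> (lift_word H \<phi> w) = \<pi> w" if "w \<in> carrier (free_group X)" for w
    using that
  proof (induction w)
    case Nil
    then show ?case using \<pi>.hom_one by (simp add: one_free_group)
  next
    case (Cons p w)
    note w = Cons_in_free_group[OF Cons.prems]
    have p: "snd p \<in> X" using Cons.prems by (simp add: carrier_free_group)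
    have "\<pi> [p] = (if fst p then \<pi> [(True, snd p)] else inv\<^bsub>G\<^esub> (\<pi> [(True, snd p)]))"
      using inv_letter_free_group[OF p] \<pi>.hom_inv[OF gen[OF p]] by (cases p) auto
    moreover have "lift_word H \<phi> w \<in> carrier H"
      using w(1) H.lift_word_closed[OF \<phi>X] by (simp add: carrier_free_group)
    moreover have "\<pi> (p # w) = \<pi> [p] \<otimes>\<^bsub>G\<^esub> \<pi> w"
      unfolding w(3) using w(2,1) by (rule \<pi>.hom_mult)
    ultimately show ?case
      using Cons.IH[OF w(1)] \<phi>[OF p] by (simp add: H.lift_word_Cons)
  qed
  then show thesis using that H.lift_word_hom[OF \<phi>X] by blast
qed

text \<open>Here \<open>F\<close> is free only up to isomorphism, so the lift is transported along
  the inverse of \<open>eval_word\<close>.\<close>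

lemma free_presentation_lift:
  assumes pres: "free_presentation F \<pi> G" and G: "group G" and H: "group H" and \<rho>: "\<rho> \<in> epi H G"
  obtains \<alpha> where "\<alpha> \<in> hom F H" "\<And>f. f \<in> carrier F \<Longrightarrow> \<rho> (\<alpha> f) = \<pi> f"
proof -
  obtain X where X: "freely_generated_by F X" and \<pi>: "\<pi> \<in> hom F G"
    using pres by (auto simp: free_presentation_def epi_def)
  have iso: "eval_word F \<in> iso (free_group X) F"
    using X by (simp add: freely_generated_by_def)
  then have "\<pi> \<circ> eval_word F \<in> hom (free_group X) G"
    using hom_compose \<pi> by (auto simp: iso_def)
  then obtain \<alpha> where \<alpha>: "\<alpha> \<in> hom (free_group X) H"
    and comp: "\<And>w. w \<in> carrier (free_group X) \<Longrightarrow> \<rho> (\<alpha> w) = \<pi> (eval_word F w)"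
    using free_group_lift[OF G H \<rho>] by (metis comp_apply)
  define e where "e = inv_into (carrier (free_group X)) (eval_word F)"
  have e: "e \<in> iso F (free_group X)"
    unfolding e_def using group.iso_set_sym[OF group_free_group iso] .
  show thesis
  proof
    show "\<alpha> \<circ> e \<in> hom F H"
      using hom_compose[OF _ \<alpha>] e by (auto simp: iso_def)
    fix f assume f: "f \<in> carrier F"
    have "e f \<in> carrier (free_group X)" using e f by (auto simp: iso_def hom_def)
    moreover have "eval_word F (e f) = f"
      using iso f unfolding e_def iso_def by (auto simp: bij_betw_def f_inv_into_f)
    ultimately show "\<rho> ((\<alpha> \<circ> e) f) = \<pi> f"
      using comp[of "e f"] by simp
  qed
qed

section \<open>Independence of the Baer-invariant of the presentation\<close>

context group_hom
begin

lemma hom_commutator: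
  "\<lbrakk>a \<in> carrier G; b \<in> carrier G\<rbrakk> \<Longrightarrow> h (commutator G a b) = commutator H (h a) (h b)"
  by (simp add: commutator_def)

lemma hom_iterated_commutator:
  assumes R: "R \<lhd> G" and S: "S \<lhd> H" and RS: "h ` R \<subseteq> S"
  shows "h ` iterated_commutator G R k \<subseteq> iterated_commutator H S k"
proof (induction k)
  case (Suc k)
  let ?K = "{commutator G a b |a b. a \<in> iterated_commutator G R k \<and> b \<in> carrier G}"
  have sub: "a \<in> carrier G" if "a \<in> iterated_commutator G R k" for a
    using that G.normal_mem_carrier[OF G.normal_iterated_commutator[OF R]] by blast
  have "h ` generate G ?K = generate H (h ` ?K)"
    using sub by (intro generate_img[symmetric]) auto
  also have "\<dots> \<subseteq> iterated_commutator H S (Suc k)"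
    unfolding iterated_commutator.simps commutator_subgroup_def
  proof (rule H.mono_generate, rule subsetI)
    fix z assume "z \<in> h ` ?K"
    then obtain a b where ab: "a \<in> iterated_commutator G R k" "b \<in> carrier G"
      and z: "z = h (commutator G a b)" by blast
    then show "z \<in> {commutator H a b |a b. a \<in> iterated_commutator H S k \<and> b \<in> carrier H}"
      using Suc.IH sub hom_commutator by fastforce
  qed
  finally show ?case by (simp add: commutator_subgroup_def)
qed (use RS in simp)

lemma hom_lower_central:
  "h ` lower_central G k \<subseteq> lower_central H k"
  unfolding lower_central_def by (rule hom_iterated_commutator) auto

end

context group
begin

text \<open>The endomorphism multiplies \<open>a\<close> and \<open>f\<close> by errors
  \<open>t\<close> and \<open>r\<close>. In \<open>commutator_mult_mult\<close> every factor
  contains an error, and commuting \<open>r\<close> with the current term, or \<open>t\<close> with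
  \<open>G\<close>, gains the missing step. This is why the Baer-invariant does not see the choice
  of lifts.\<close>

lemma endomorphism_congruent_identity:
  assumes R: "R \<lhd> G" and \<theta>: "\<theta> \<in> hom G G"
    and cong: "\<And>f. f \<in> carrier G \<Longrightarrow> inv f \<otimes> \<theta> f \<in> R"
    and g: "g \<in> iterated_commutator G (carrier G) k"
  shows "inv g \<otimes> \<theta> g \<in> iterated_commutator G R k"
  using g
proof (induction k arbitrary: g)
  case 0
  then show ?case using cong by simp
next
  case (Suc k)
  interpret \<theta>: group_hom G G \<theta>
    using \<theta> by (simp add: group_hom_def group_hom_axioms_def is_group)
  let ?M = "iterated_commutator G R (Suc k)" and ?C = "iterated_commutator G (carrier G)"
  have M: "?M \<lhd> G" using R by (simp del: iterated_commutator.simps)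
  note Mclosed = normal_mult_closed[OF M] normal_inv_closed[OF M] normal_inv_op_closed[OF M]
  have sub: "subgroup {g \<in> carrier G. inv g \<otimes> \<theta> g \<in> ?M} G"
  proof (rule subgroupI)
    show "{g \<in> carrier G. inv g \<otimes> \<theta> g \<in> ?M} \<noteq> {}"
      using subgroup.one_closed[OF normal_imp_subgroup[OF M]] by auto
  next
    fix g assume "g \<in> {g \<in> carrier G. inv g \<otimes> \<theta> g \<in> ?M}"
    moreover from this have "inv (inv g) \<otimes> \<theta> (inv g) = g \<otimes> inv (inv g \<otimes> \<theta> g) \<otimes> inv g"
      by (simp add: inv_mult_group m_assoc)
    ultimately show "inv g \<in> {g \<in> carrier G. inv g \<otimes> \<theta> g \<in> ?M}"
      using Mclosed by simp
  next
    fix g h assume gh: "g \<in> {g \<in> carrier G. inv g \<otimes> \<theta> g \<in> ?M}" "h \<in> {g \<in> carrier G. inv g \<otimes> \<theta> g \<in> ?M}"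
    then have "inv (g \<otimes> h) \<otimes> \<theta> (g \<otimes> h) = (inv h \<otimes> (inv g \<otimes> \<theta> g) \<otimes> h) \<otimes> (inv h \<otimes> \<theta> h)"
      by (simp add: inv_mult_group m_assoc)
    then show "g \<otimes> h \<in> {g \<in> carrier G. inv g \<otimes> \<theta> g \<in> ?M}"
      using Mclosed gh by simp
  qed auto
  have "commutator_subgroup G (?C k) (carrier G) \<subseteq> {g \<in> carrier G. inv g \<otimes> \<theta> g \<in> ?M}"
  proof (rule commutator_subgroup_subset[OF sub])
    fix a f assume a: "a \<in> ?C k" and f: "f \<in> carrier G"
    have aG: "a \<in> carrier G" using a normal_mem_carrier[OF normal_iterated_commutator[OF normal_carrier]] by blast
    define t where "t = inv a \<otimes> \<theta> a"
    define r where "r = inv f \<otimes> \<theta> f"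
    define C where "C = commutator G a f"
    have t: "t \<in> iterated_commutator G R k" unfolding t_def using Suc.IH[OF a] .
    have r: "r \<in> R" unfolding r_def using cong[OF f] .
    have [simp]: "t \<in> carrier G" "r \<in> carrier G" "C \<in> carrier G" using aG f by (auto simp: t_def r_def C_def)
    have tC: "t \<in> ?C k"
      using t iterated_commutator_mono[of R "carrier G" k] normal_mem_carrier[OF R] by blast
    have rM: "commutator G z r \<in> ?M" if "z \<in> ?C k" for z
    proof -
      have "commutator G r z \<in> ?M"
        using commutator_iterated_lower_central[OF R, of r 0 z k] r that by simp
      moreover have "z \<in> carrier G" using that normal_mem_carrier[OF normal_iterated_commutator[OF normal_carrier]] by blast
      ultimately show ?thesis using commutator_swap[OF normal_imp_subgroup[OF M]] by simp
    qed
    have tM: "commutator G t z \<in> ?M" if "z \<in> carrier G" for z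
      using t that by (simp add: commutator_in_commutator_subgroup)
    have CC: "C \<in> ?C k"
      using a f iterated_commutator_antimono[OF normal_carrier, of k "Suc k"]
      by (auto simp: C_def intro: commutator_in_commutator_subgroup)
    have X: "commutator G (a \<otimes> t) r \<in> ?M"
      using rM normal_mult_closed[OF normal_iterated_commutator[OF normal_carrier] a tC] by blast
    have u: "commutator G C t \<otimes> commutator G t f \<in> ?M"
      using tM[of C] tM[OF f] commutator_swap[OF normal_imp_subgroup[OF M], of t C] Mclosed by simp
    have "inv C \<otimes> commutator G (a \<otimes> t) (f \<otimes> r) \<in> ?M"
      using commutator_mult_mult[of a f t r] aG f X u rM[OF CC]
      by (simp add: C_def Mclosed normal_commutator_left[OF M] del: iterated_commutator.simps)
    moreover have "a \<otimes> t = \<theta> a" "f \<otimes> r = \<theta> f" using aG f by (simp_all add: t_def r_def)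
    ultimately show "commutator G a f \<in> {g \<in> carrier G. inv g \<otimes> \<theta> g \<in> ?M}"
      using aG f \<theta>.hom_commutator by (simp add: C_def)
  qed
  then show ?case using Suc.prems by auto
qed

end

text \<open>Both composites are congruent to the identity on the relevant term, modulo the
  denominators. The isomorphism is induced by \<open>\<alpha>\<close>; \<open>\<beta>\<close>
  supplies injectivity and preimages.\<close>

lemma baer_invariant_iso:
  fixes F1 :: "('a, 'm) monoid_scheme" and F2 :: "('b, 'n) monoid_scheme"
  assumes F1: "group F1" and F2: "group F2" and R1: "R1 \<lhd> F1" and R2: "R2 \<lhd> F2"
    and \<alpha>: "\<alpha> \<in> hom F1 F2" and \<beta>: "\<beta> \<in> hom F2 F1"
    and \<alpha>R: "\<alpha> ` R1 \<subseteq> R2" and \<beta>R: "\<beta> ` R2 \<subseteq> R1"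
    and \<beta>\<alpha>: "\<And>f. f \<in> carrier F1 \<Longrightarrow> inv\<^bsub>F1\<^esub> f \<otimes>\<^bsub>F1\<^esub> \<beta> (\<alpha> f) \<in> R1"
    and \<alpha>\<beta>: "\<And>f. f \<in> carrier F2 \<Longrightarrow> inv\<^bsub>F2\<^esub> f \<otimes>\<^bsub>F2\<^esub> \<alpha> (\<beta> f) \<in> R2"
  shows "baer_invariant c F1 R1 \<cong> baer_invariant c F2 R2"
proof -
  interpret F1: group F1 by (rule F1)
  interpret F2: group F2 by (rule F2)
  interpret \<alpha>: group_hom F1 F2 \<alpha> using \<alpha> by (simp add: group_hom_def group_hom_axioms_def F1 F2)
  interpret \<beta>: group_hom F2 F1 \<beta> using \<beta> by (simp add: group_hom_def group_hom_axioms_def F1 F2)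
  define L1 where "L1 = R1 \<inter> lower_central F1 (c + 1)"
  define L2 where "L2 = R2 \<inter> lower_central F2 (c + 1)"
  define N1 where "N1 = iterated_commutator F1 R1 c"
  define N2 where "N2 = iterated_commutator F2 R2 c"
  have N1: "N1 \<lhd> F1" and N2: "N2 \<lhd> F2" by (simp_all add: N1_def N2_def R1 R2)
  have L1: "subgroup L1 F1" and L2: "subgroup L2 F2"
    by (auto simp: L1_def L2_def R1 R2 normal_imp_subgroup intro!: F1.subgroups_Inter_pair F2.subgroups_Inter_pair)
  have NL1: "N1 \<subseteq> L1"
    unfolding N1_def L1_def lower_central_def
    using F1.iterated_commutator_antimono[OF R1, of 0 c] F1.iterated_commutator_mono[of R1 "carrier F1" c]
      F1.normal_mem_carrier[OF R1] by auto
  have NL2: "N2 \<subseteq> L2"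
    unfolding N2_def L2_def lower_central_def
    using F2.iterated_commutator_antimono[OF R2, of 0 c] F2.iterated_commutator_mono[of R2 "carrier F2" c]
      F2.normal_mem_carrier[OF R2] by auto
  have L1F: "x \<in> carrier F1" if "x \<in> L1" for x using that subgroup.mem_carrier[OF L1] by blast
  have L2F: "x \<in> carrier F2" if "x \<in> L2" for x using that subgroup.mem_carrier[OF L2] by blast
  let ?G1 = "F1\<lparr>carrier := L1\<rparr>" and ?G2 = "F2\<lparr>carrier := L2\<rparr>"
  have n2: "N2 \<lhd> ?G2" by (rule F2.normal_restrict_supergroup[OF L2 N2 NL2])
  have \<alpha>L: "\<alpha> x \<in> L2" if "x \<in> L1" for x
    using that \<alpha>R \<alpha>.hom_lower_central by (auto simp: L1_def L2_def)
  have \<beta>L: "\<beta> x \<in> L1" if "x \<in> L2" for x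
    using that \<beta>R \<beta>.hom_lower_central by (auto simp: L1_def L2_def)
  have \<alpha>N: "\<alpha> x \<in> N2" if "x \<in> N1" for x
    using that \<alpha>.hom_iterated_commutator[OF R1 R2 \<alpha>R] by (auto simp: N1_def N2_def)
  have \<beta>N: "\<beta> x \<in> N1" if "x \<in> N2" for x
    using that \<beta>.hom_iterated_commutator[OF R2 R1 \<beta>R] by (auto simp: N1_def N2_def)
  have c1: "inv\<^bsub>F1\<^esub> x \<otimes>\<^bsub>F1\<^esub> \<beta> (\<alpha> x) \<in> N1" if "x \<in> L1" for x
    using F1.endomorphism_congruent_identity[OF R1, of "\<beta> \<circ> \<alpha>" x c] \<beta>\<alpha> that hom_compose[OF \<alpha> \<beta>]
    by (simp add: N1_def L1_def lower_central_def)
  have c2: "inv\<^bsub>F2\<^esub> x \<otimes>\<^bsub>F2\<^esub> \<alpha> (\<beta> x) \<in> N2" if "x \<in> L2" for x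
    using F2.endomorphism_congruent_identity[OF R2, of "\<alpha> \<circ> \<beta>" x c] \<alpha>\<beta> that hom_compose[OF \<beta> \<alpha>]
    by (simp add: N2_def L2_def lower_central_def)
  let ?B2 = "?G2 Mod N2"
  define \<phi> where "\<phi> = (\<lambda>x. N2 #>\<^bsub>F2\<^esub> \<alpha> x)"
  have \<phi>: "\<phi> \<in> hom ?G1 ?B2"
    using \<alpha>L \<alpha>.hom_mult L1F normal.rcos_sum[OF N2]
    by (auto simp: hom_def \<phi>_def carrier_FactGroup r_coset_def set_mult_def)
  interpret \<phi>: group_hom ?G1 ?B2 \<phi>
    using \<phi> F1.subgroup_imp_group[OF L1] normal.factorgroup_is_group[OF n2]
    by (simp add: group_hom_def group_hom_axioms_def)
  have "kernel ?G1 ?B2 \<phi> = N1"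
  proof (intro equalityI subsetI)
    fix x assume "x \<in> kernel ?G1 ?B2 \<phi>"
    then have x: "x \<in> L1" and "N2 #>\<^bsub>F2\<^esub> \<alpha> x = N2" by (auto simp: kernel_def \<phi>_def)
    then have "\<alpha> x \<in> N2"
      using F2.coset_join1[OF _ _ normal_imp_subgroup[OF N2]] L1F by simp
    then have "\<beta> (\<alpha> x) \<in> N1" by (rule \<beta>N)
    from F1.normal_mult_closed[OF N1 this F1.normal_inv_closed[OF N1 c1[OF x]]]
    show "x \<in> N1" using L1F[OF x] by (simp add: F1.inv_mult_group)
  next
    fix x assume x: "x \<in> N1"
    then have "N2 #>\<^bsub>F2\<^esub> \<alpha> x = N2"
      using \<alpha>N[OF x] F2.coset_join2[OF _ normal_imp_subgroup[OF N2]] F2.normal_mem_carrier[OF N2] by blast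
    then show "x \<in> kernel ?G1 ?B2 \<phi>" using x NL1 by (auto simp: kernel_def \<phi>_def)
  qed
  moreover have "\<phi> ` carrier ?G1 = carrier ?B2"
  proof (intro equalityI subsetI)
    fix Z assume "Z \<in> carrier ?B2"
    then obtain y where y: "y \<in> L2" and Z: "Z = N2 #>\<^bsub>F2\<^esub> y"
      by (auto simp: carrier_FactGroup r_coset_def)
    let ?z = "inv\<^bsub>F2\<^esub> y \<otimes>\<^bsub>F2\<^esub> \<alpha> (\<beta> y)"
    have "N2 #>\<^bsub>F2\<^esub> \<alpha> (\<beta> y) = N2 #>\<^bsub>F2\<^esub> y"
    proof -
      have "N2 #>\<^bsub>F2\<^esub> \<alpha> (\<beta> y) = N2 #>\<^bsub>F2\<^esub> (y \<otimes>\<^bsub>F2\<^esub> ?z)" using L2F[OF y] by simp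
      also have "\<dots> = (N2 #>\<^bsub>F2\<^esub> y) <#>\<^bsub>F2\<^esub> (N2 #>\<^bsub>F2\<^esub> ?z)"
        using L2F[OF y] by (simp add: normal.rcos_sum[OF N2])
      also have "N2 #>\<^bsub>F2\<^esub> ?z = N2 #>\<^bsub>F2\<^esub> \<one>\<^bsub>F2\<^esub>"
        using c2[OF y] F2.coset_join2[OF _ normal_imp_subgroup[OF N2]] F2.normal_mem_carrier[OF N2]
          subgroup.one_closed[OF normal_imp_subgroup[OF N2]] by simp
      also have "(N2 #>\<^bsub>F2\<^esub> y) <#>\<^bsub>F2\<^esub> (N2 #>\<^bsub>F2\<^esub> \<one>\<^bsub>F2\<^esub>) = N2 #>\<^bsub>F2\<^esub> y"
        using L2F[OF y] by (simp add: normal.rcos_sum[OF N2])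
      finally show ?thesis .
    qed
    then show "Z \<in> \<phi> ` carrier ?G1" using \<beta>L[OF y] Z by (auto simp: \<phi>_def)
  next
    fix Z assume "Z \<in> \<phi> ` carrier ?G1"
    then show "Z \<in> carrier ?B2" using \<phi>.hom_closed by blast
  qed
  ultimately have "?G1 Mod N1 \<cong> ?B2" using \<phi>.FactGroup_iso by simp
  then show ?thesis by (simp add: baer_invariant_def L1_def L2_def N1_def N2_def)
qed

text \<open>Each free group is lifted through the other presentation. The lifts are compatible with
  the maps to \<open>G\<close>, so the composites differ from the identity by elements of the
  kernels.\<close>

lemma baer_invariant_free_presentation:
  fixes G :: "('g, 'n) monoid_scheme" and F :: "('f, 'm) monoid_scheme"
  assumes pres: "free_presentation F \<pi> G" and G: "group G" and \<rho>: "\<rho> \<in> epi (free_group X) G"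
  shows "baer_invariant c F (kernel F G \<pi>) \<cong>
    baer_invariant c (free_group X) (kernel (free_group X) G \<rho>)"
proof -
  let ?E = "free_group X"
  have F: "group F" using pres by (rule free_presentation_group)
  have \<pi>: "\<pi> \<in> epi F G" using pres by (simp add: free_presentation_def)
  interpret \<pi>: group_hom F G \<pi> using \<pi> F G by (simp add: epi_def group_hom_def group_hom_axioms_def)
  interpret \<rho>: group_hom ?E G \<rho>
    using \<rho> G group_free_group by (auto simp: epi_def group_hom_def group_hom_axioms_def)
  obtain \<alpha> where \<alpha>: "\<alpha> \<in> hom F ?E" and \<rho>\<alpha>: "\<And>f. f \<in> carrier F \<Longrightarrow> \<rho> (\<alpha> f) = \<pi> f"
    using free_presentation_lift[OF pres G group_free_group \<rho>] by blast
  have "\<rho> \<in> hom ?E G" using \<rho> by (simp add: epi_def)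
  then obtain \<beta> where \<beta>: "\<beta> \<in> hom ?E F" and \<pi>\<beta>: "\<And>w. w \<in> carrier ?E \<Longrightarrow> \<pi> (\<beta> w) = \<rho> w"
    using free_group_lift[OF G F \<pi>, of \<rho> X] by blast
  have [simp]: "\<alpha> f \<in> carrier ?E" if "f \<in> carrier F" for f using \<alpha> that by (auto simp: hom_def)
  have [simp]: "\<beta> f \<in> carrier F" if "f \<in> carrier ?E" for f using \<beta> that by (auto simp: hom_def)
  show ?thesis
    by (rule baer_invariant_iso[OF F group_free_group \<pi>.normal_kernel \<rho>.normal_kernel \<alpha> \<beta>])
       (auto simp: kernel_def \<rho>\<alpha> \<pi>\<beta>)
qed

section \<open>Basic commutators generate the lower central factors\<close>

lemma weight_pos [simp]: "0 < weight t"
  by (induction t) auto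

lemma weight_nonzero [simp]: "weight t \<noteq> 0"
  using weight_pos[of t] by linarith

lemma weight_Suc_0_le [simp]: "Suc 0 \<le> weight t"
  using weight_pos[of t] by linarith

lemma prec_irrefl [simp]: "\<not> prec t t"
  by (induction t) auto

lemma prec_total: "prec u v \<or> u = v \<or> prec v u"
proof (induction u arbitrary: v)
  case (Letter a)
  show ?case by (cases v; cases a) (auto, (metis letter.exhaust)+)
next
  case (Comm u1 u2)
  show ?case
  proof (cases v)
    case (Comm v1 v2)
    then show ?thesis using Comm.IH(1)[of v1] Comm.IH(2)[of v2]
      by (simp only: prec.simps comm.inject) (metis linorder_neqE_nat)
  qed simp
qed

lemma prec_trans: "\<lbrakk>prec u v; prec v w\<rbrakk> \<Longrightarrow> prec u w"
proof (induction u arbitrary: v w)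
  case (Letter a)
  then show ?case by (cases v; cases w) auto
next
  case (Comm u1 u2)
  obtain v1 v2 where v: "v = Comm v1 v2" using Comm.prems(1) by (cases v) auto
  obtain w1 w2 where w: "w = Comm w1 w2" using Comm.prems(2) v by (cases w) auto
  show ?case
    using Comm.prems Comm.IH(1)[of v1 w1] Comm.IH(2)[of v2 w2]
    unfolding v w prec.simps by (metis less_trans)
qed

lemma prec_if_weight_less: "weight u < weight v \<Longrightarrow> prec u v"
  by (cases u; cases v) auto

lemma weight_mono_prec: "prec u v \<Longrightarrow> weight u \<le> weight v"
  using prec_if_weight_less prec_trans prec_irrefl by (metis linorder_not_less)

lemma prec_Comm_right [simp]: "prec v (Comm u v)"
  by (rule prec_if_weight_less) simp

lemma finite_letter [simp]: "finite (A :: letter set)"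
proof (rule finite_subset)
  show "A \<subseteq> {LX, LY}" using letter.exhaust by blast
qed simp

lemma finite_weight_le [simp]: "finite {t. weight t \<le> m}"
proof (induction m)
  case 0
  have "{t. weight t \<le> 0} = {}" by auto
  then show ?case by simp
next
  case (Suc m)
  have "{t. weight t \<le> Suc m} \<subseteq> range Letter \<union> (\<lambda>(u, v). Comm u v) ` ({t. weight t \<le> m} \<times> {t. weight t \<le> m})"
  proof
    fix t assume t: "t \<in> {t. weight t \<le> Suc m}"
    show "t \<in> range Letter \<union> (\<lambda>(u, v). Comm u v) ` ({t. weight t \<le> m} \<times> {t. weight t \<le> m})"
    proof (cases t)
      case (Comm u v)
      then have "weight u \<le> m" "weight v \<le> m"
        using t weight_Suc_0_le[of u] weight_Suc_0_le[of v] by (simp_all del: weight_Suc_0_le)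
      then show ?thesis using Comm by auto
    qed simp
  qed
  then show ?case by (rule finite_subset) (use Suc in simp)
qed

lemma finite_basic_weight [simp]: "finite {t. basic t \<and> weight t = m}"
  by (rule finite_subset[OF _ finite_weight_le[of m]]) auto

primrec tree_value :: "('a, 'm) monoid_scheme \<Rightarrow> (letter \<Rightarrow> 'a) \<Rightarrow> comm \<Rightarrow> 'a" where
  "tree_value G \<phi> (Letter l) = \<phi> l"
| "tree_value G \<phi> (Comm u v) = commutator G (tree_value G \<phi> u) (tree_value G \<phi> v)"

primrec letters :: "comm \<Rightarrow> letter set" where
  "letters (Letter l) = {l}"
| "letters (Comm u v) = letters u \<union> letters v"

lemma letters_nonempty: "letters t \<noteq> {}"
  by (induction t) auto

context group
begin

text \<open>The factors of the lower central series are central: conjugation changes an element of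
  \<open>U\<close> by an element of the next term.\<close>

lemma normal_between_lower_central:
  assumes U: "subgroup U G" and "lower_central G (Suc m) \<subseteq> U" "U \<subseteq> lower_central G m"
  shows "U \<lhd> G"
  unfolding normal_inv_iff
proof (intro conjI ballI)
  fix x h assume x: "x \<in> carrier G" and h: "h \<in> U"
  have hG: "h \<in> carrier G" using subgroup.mem_carrier[OF U h] .
  have "commutator G h (inv x) \<in> lower_central G (m + 1)"
    using h assms(3) x by (intro commutator_lower_central) auto
  then have "h \<otimes> commutator G h (inv x) \<in> U"
    using h assms(2) subgroup.m_closed[OF U] by auto
  also have "h \<otimes> commutator G h (inv x) = x \<otimes> h \<otimes> inv x"
    using x hG by (simp add: commutator_def m_assoc)
  finally show "x \<otimes> h \<otimes> inv x \<in> U" .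
qed (rule U)

text \<open>Up to the next weight, an inverse can be pulled out of a commutator. \<open>D\<close> is
  only a subgroup because it will be a \<open>centralizer_mod\<close>.\<close>

lemma commutator_inv_right_mem:
  assumes D: "subgroup D G" and sub: "lower_central G (Suc (i + j)) \<subseteq> D"
    and a: "a \<in> lower_central G i" and b: "b \<in> lower_central G j" and ab: "commutator G a b \<in> D"
  shows "commutator G a (inv b) \<in> D"
proof -
  let ?c = "inv (commutator G a b)"
  have [simp]: "a \<in> carrier G" "b \<in> carrier G" using a b normal_mem_carrier normal_lower_central by blast+
  have "?c \<in> lower_central G (i + j)"
    using commutator_lower_central[OF a b] normal_inv_closed normal_lower_central by blast
  then have "commutator G ?c (inv b) \<in> lower_central G (i + j + 1)"
    by (rule commutator_lower_central) simp
  then have "?c \<otimes> commutator G ?c (inv b) \<in> D"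
    using sub ab subgroup.m_closed[OF D] subgroup.m_inv_closed[OF D] by auto
  then show ?thesis by (simp add: commutator_def m_assoc inv_mult_group)
qed

lemma jacobi_mod:
  assumes M: "M \<lhd> G" and sub: "lower_central G (Suc (i + j + k)) \<subseteq> M"
    and a: "a \<in> lower_central G i" and b: "b \<in> lower_central G j" and c: "c \<in> lower_central G k"
    and 1: "commutator G (commutator G b c) a \<in> M" and 2: "commutator G (commutator G c a) b \<in> M"
  shows "commutator G (commutator G a b) c \<in> M"
proof -
  have abc [simp]: "a \<in> carrier G" "b \<in> carrier G" "c \<in> carrier G"
    using a b c normal_mem_carrier normal_lower_central by blast+
  note inv_lower = normal_inv_closed[OF normal_lower_central]
  have C: "subgroup (centralizer_mod M a) G" "subgroup (centralizer_mod M b) G"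
    using subgroup_centralizer_mod[OF M] by simp_all
  have Ca: "lower_central G (Suc (j + k)) \<subseteq> centralizer_mod M a"
  proof
    fix z assume z: "z \<in> lower_central G (Suc (j + k))"
    then have "commutator G a z \<in> lower_central G (i + Suc (j + k))"
      using a by (intro commutator_lower_central)
    then show "z \<in> centralizer_mod M a"
      using z sub normal_mem_carrier[OF normal_lower_central z] by (auto simp: centralizer_mod_def ac_simps)
  qed
  have Cb: "lower_central G (Suc (k + i)) \<subseteq> centralizer_mod M b"
  proof
    fix z assume z: "z \<in> lower_central G (Suc (k + i))"
    then have "commutator G b z \<in> lower_central G (j + Suc (k + i))"
      using b by (intro commutator_lower_central)
    then show "z \<in> centralizer_mod M b"
      using z sub normal_mem_carrier[OF normal_lower_central z] by (auto simp: centralizer_mod_def ac_simps)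
  qed
  have "commutator G c a \<in> centralizer_mod M b"
    using 2 commutator_swap[OF normal_imp_subgroup[OF M] _ _ 2] by (simp add: centralizer_mod_def)
  then have "commutator G c (inv a) \<in> centralizer_mod M b"
    using commutator_inv_right_mem[OF C(2) Cb c a] by blast
  then have "b \<in> centralizer_mod M (commutator G c (inv a))"
    using centralizer_mod_sym[OF M] by simp
  then have "inv b \<in> centralizer_mod M (commutator G c (inv a))"
    using subgroup.m_inv_closed[OF subgroup_centralizer_mod[OF M]] by simp
  then have 3: "commutator G (commutator G c (inv a)) (inv b) \<in> M"
    by (simp add: centralizer_mod_def)
  have "commutator G b c \<in> centralizer_mod M a"
    using commutator_swap[OF normal_imp_subgroup[OF M] _ _ 1] by (simp add: centralizer_mod_def)
  then have "commutator G b (inv c) \<in> centralizer_mod M a"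
    by (rule commutator_inv_right_mem[OF C(1) Ca b c])
  then have "commutator G (inv c) b \<in> centralizer_mod M a"
    using commutator_swap[OF C(1)] by simp
  moreover have "lower_central G (Suc (k + j)) \<subseteq> centralizer_mod M a" using Ca by (simp add: ac_simps)
  ultimately have "commutator G (inv c) (inv b) \<in> centralizer_mod M a"
    using commutator_inv_right_mem[OF C(1) _ inv_lower[OF c] b] by blast
  then have "commutator G (inv b) (inv c) \<in> centralizer_mod M a"
    using commutator_swap[OF C(1)] by simp
  then have 4: "commutator G (commutator G (inv b) (inv c)) a \<in> M"
    using commutator_swap[OF normal_imp_subgroup[OF M]] by (simp add: centralizer_mod_def)
  show ?thesis
    using three_subgroups_elementwise[OF M abc(3) abc(1) _ 3 4] by simp
qed

end

locale two_generated = group G for G (structure) +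
  fixes \<phi> :: "letter \<Rightarrow> 'a"
  assumes letter_closed [simp]: "\<phi> l \<in> carrier G"
    and generated: "carrier G = generate G (range \<phi>)"
begin

abbreviation val where "val \<equiv> tree_value G \<phi>"

lemma val_lower_central: "val t \<in> lower_central G (weight t)"
  by (induction t) (auto intro: commutator_lower_central)

lemma val_closed [simp]: "val t \<in> carrier G"
  by (induction t) auto

text \<open>Containing the term \<open>m + 1\<close>, it stands for a subgroup of the factor of
  weight \<open>m\<close>. It is thereby normal and can serve as the modulus \<open>M\<close> of the
  lemmas above.\<close>

definition basic_span :: "nat \<Rightarrow> (comm \<Rightarrow> bool) \<Rightarrow> 'a set" where
  "basic_span m P = generate G ({val t |t. basic t \<and> weight t = m \<and> P t} \<union> lower_central G (Suc m))"

lemma basic_span_gens: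
  "{val t |t. basic t \<and> weight t = m \<and> P t} \<union> lower_central G (Suc m) \<subseteq> carrier G"
  using normal_mem_carrier[OF normal_lower_central] by auto

lemma subgroup_basic_span: "subgroup (basic_span m P) G"
  unfolding basic_span_def using basic_span_gens by (rule generate_is_subgroup)

lemma lower_central_basic_span: "lower_central G (Suc m) \<subseteq> basic_span m P"
  unfolding basic_span_def by (auto intro: generate.incl)

lemma val_basic_span: "\<lbrakk>basic t; weight t = m; P t\<rbrakk> \<Longrightarrow> val t \<in> basic_span m P"
  unfolding basic_span_def by (auto intro!: generate.incl)

lemma basic_span_subset:
  assumes "subgroup U G" "\<And>t. \<lbrakk>basic t; weight t = m; P t\<rbrakk> \<Longrightarrow> val t \<in> U"
    "lower_central G (Suc m) \<subseteq> U"
  shows "basic_span m P \<subseteq> U"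
  unfolding basic_span_def using assms by (intro generate_subgroup_incl) auto

lemma basic_span_lower_central: "basic_span m P \<subseteq> lower_central G m"
  using val_lower_central lower_central_antimono[of m "Suc m"]
  by (intro basic_span_subset) (auto intro: normal_imp_subgroup)

lemma normal_basic_span: "basic_span m P \<lhd> G"
  using normal_between_lower_central[OF subgroup_basic_span lower_central_basic_span
      basic_span_lower_central] .

lemma basic_span_mono:
  "(\<And>t. \<lbrakk>basic t; weight t = m; P t\<rbrakk> \<Longrightarrow> Q t) \<Longrightarrow> basic_span m P \<subseteq> basic_span m Q"
  by (intro basic_span_subset subgroup_basic_span lower_central_basic_span val_basic_span) auto

text \<open>Invariant of the rewriting: right entries never precede \<open>v\<close>, hence
  \<open>v\<close> precedes every commutator that arises.\<close>

definition right_ge :: "comm \<Rightarrow> comm \<Rightarrow> bool" where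
  "right_ge v t \<longleftrightarrow> (\<exists>a b. t = Comm a b \<and> (b = v \<or> prec v b))"

text \<open>Hall's rewriting step. A commutator \<open>[[p, q], v]\<close> with \<open>v < q\<close> is not basic; the Jacobi identity
  replaces it by commutators whose smaller entry exceeds \<open>v\<close>, and only finitely many basic
  commutators exceed \<open>v\<close> in a given weight.\<close>

lemma commutator_basic_span:
  assumes "basic u" "basic v" "prec v u" "weight u + weight v = N"
  shows "commutator G (val u) (val v) \<in> basic_span N (right_ge v)"
  using assms
proof (induction N arbitrary: u v rule: less_induct)
  case (less N)
  note IH_weight = less.IH
  show ?case using less.prems
  \<comment> \<open>The outer induction serves inner brackets, which have smaller weight; the inner
    one serves brackets of the same weight \<open>N\<close> with a larger smaller entry.\<close>
  proof (induction "card {z. basic z \<and> weight z < N \<and> prec v z}" arbitrary: u v rule: less_induct)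
    case less
    let ?S = "\<lambda>v. {z. basic z \<and> weight z < N \<and> prec v z}"
    let ?M = "basic_span N (right_ge v)"
    note M = normal_basic_span[of N "right_ge v"]
    have IH_inner: "commutator G (val u') (val v') \<in> ?M"
      if "basic u'" "basic v'" "prec v' u'" "weight u' + weight v' = N" "prec v v'" for u' v'
    proof -
      have "weight v' < N" using that(4) weight_pos[of u'] by linarith
      then have "v' \<in> ?S v" "v' \<notin> ?S v'" using that(2,5) by auto
      moreover have "?S v' \<subseteq> ?S v" using prec_trans[OF that(5)] by auto
      ultimately have "?S v' \<subset> ?S v" by blast
      moreover have "finite (?S v)" by (rule finite_subset[OF _ finite_weight_le[of N]]) auto
      ultimately have "card (?S v') < card (?S v)" by (rule psubset_card_mono[rotated])
      from less.hyps[OF this that(1-4)] show ?thesis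
        using basic_span_mono[of N "right_ge v'" "right_ge v"] that(5) prec_trans[of v v']
        by (auto simp: right_ge_def)
    qed
    show ?case
    proof (cases "basic (Comm u v)")
      case True
      then show ?thesis
        using val_basic_span[of "Comm u v" N "right_ge v"] less.prems by (auto simp: right_ge_def)
    next
      case False
      then obtain p q where u: "u = Comm p q" and qv: "q \<noteq> v" "\<not> prec q v"
        using less.prems(1-3) by (auto split: comm.splits)
      have vq: "prec v q" using prec_total[of q v] qv by blast
      have p: "basic p" and q: "basic q" and qp: "prec q p" using less.prems(1) u by auto
      have vp: "prec v p" using prec_trans[OF vq qp] .
      have w: "weight p + weight q + weight v = N" using less.prems(4) u by simp
      \<comment> \<open>The outer hypothesis spreads \<open>[s, v]\<close> over basic
        \<open>z\<close> above \<open>v\<close>. Then \<open>z\<close> and \<open>t\<close> both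
        exceed \<open>v\<close>, and their commutator, in the right order, falls under the inner
        hypothesis.\<close>
      have reduce: "commutator G (commutator G (val s) (val v)) (val t) \<in> ?M"
        if st: "weight s + weight t + weight v = N" "basic s" "basic t" "prec v s" "prec v t" for s t
      proof -
        let ?C = "centralizer_mod ?M (val t)"
        have "basic_span (weight s + weight v) (right_ge v) \<subseteq> ?C"
        proof (rule basic_span_subset)
          show "subgroup ?C G" by (rule subgroup_centralizer_mod[OF M]) simp
          show "lower_central G (Suc (weight s + weight v)) \<subseteq> ?C"
          proof
            fix z assume z: "z \<in> lower_central G (Suc (weight s + weight v))"
            have "commutator G (val t) z \<in> lower_central G (weight t + Suc (weight s + weight v))"
              using val_lower_central z by (rule commutator_lower_central)
            also have "\<dots> \<subseteq> ?M" using lower_central_basic_span[of N] st(1) by (simp add: ac_simps)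
            finally show "z \<in> ?C" using z normal_mem_carrier[OF normal_lower_central]
              by (auto simp: centralizer_mod_def)
          qed
        next
          fix z assume z: "basic z" "weight z = weight s + weight v" "right_ge v z"
          then obtain a b where ab: "z = Comm a b" "b = v \<or> prec v b" by (auto simp: right_ge_def)
          then have vz: "prec v z" using prec_trans[of v b z] by auto
          have wt: "weight z + weight t = N" using z(2) st(1) by simp
          have "commutator G (val t) (val z) \<in> ?M"
          proof -
            consider "prec t z" | "t = z" | "prec z t" using prec_total by blast
            then show ?thesis
            proof cases
              case 1
              then have "commutator G (val z) (val t) \<in> ?M"
                using IH_inner[of z t] z st wt by simp
              then show ?thesis using commutator_swap[OF normal_imp_subgroup[OF M]] by simp
            next
              case 2
              then have "commutator G (val t) (val z) = \<one>" by (simp add: commutator_def m_assoc)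
              then show ?thesis using subgroup.one_closed[OF normal_imp_subgroup[OF M]] by simp
            next
              case 3
              then show ?thesis using IH_inner[of t z] z st wt vz by (simp add: add.commute)
            qed
          qed
          then show "val z \<in> ?C" by (simp add: centralizer_mod_def)
        qed
        moreover have "weight s + weight v < N" using st(1) weight_pos[of t] by linarith
        then have "commutator G (val s) (val v) \<in> basic_span (weight s + weight v) (right_ge v)"
          using IH_weight st(2,4) less.prems(2) by blast
        ultimately have "commutator G (val t) (commutator G (val s) (val v)) \<in> ?M"
          by (auto simp: centralizer_mod_def)
        then show ?thesis using commutator_swap[OF normal_imp_subgroup[OF M]] by simp
      qed
      have "commutator G (commutator G (val p) (val v)) (val q) \<in> ?M"
        using reduce[of p q] w p q vp vq by simp
      then have "commutator G (val p) (val v) \<in> centralizer_mod ?M (val q)"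
        using commutator_swap[OF normal_imp_subgroup[OF M]] by (simp add: centralizer_mod_def)
      then have "commutator G (val v) (val p) \<in> centralizer_mod ?M (val q)"
        using commutator_swap[OF subgroup_centralizer_mod[OF M]] by simp
      then have 2: "commutator G (commutator G (val v) (val p)) (val q) \<in> ?M"
        using commutator_swap[OF normal_imp_subgroup[OF M]] by (simp add: centralizer_mod_def)
      have 1: "commutator G (commutator G (val q) (val v)) (val p) \<in> ?M"
        using reduce[of q p] w p q vp vq by simp
      have "lower_central G (Suc (weight p + weight q + weight v)) \<subseteq> ?M"
        using lower_central_basic_span[of N] w by simp
      from jacobi_mod[OF M this val_lower_central val_lower_central val_lower_central 1 2]
      show ?thesis using u by simp
    qed
  qed
qed

text \<open>Centralizers modulo the span are subgroups, so one entry of \<open>[a, g]\<close>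
  reduces to basic commutators and the other to letters. Ordering the two entries leads to
  \<open>commutator_basic_span\<close>.\<close>

theorem lower_central_eq_basic_span:
  assumes "0 < m"
  shows "lower_central G m = basic_span m (\<lambda>_. True)"
  using assms
proof (induction m rule: nat_induct_non_zero)
  case 1
  have "generate G (range \<phi>) \<subseteq> basic_span 1 (\<lambda>_. True)"
  proof (rule generate_subgroup_incl[OF _ subgroup_basic_span])
    show "range \<phi> \<subseteq> basic_span 1 (\<lambda>_. True)"
      using val_basic_span[of "Letter _" 1 "\<lambda>_. True"] by auto
  qed
  then show ?case using generated basic_span_lower_central[of 1] by auto
next
  case (Suc m)
  let ?W = "basic_span (Suc m) (\<lambda>_. True)"
  note W = normal_basic_span[of "Suc m" "\<lambda>_. True"]
  have l: "lower_central G m \<subseteq> centralizer_mod ?W (\<phi> l)" for l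
    unfolding Suc.IH
  proof (rule basic_span_subset)
    show "subgroup (centralizer_mod ?W (\<phi> l)) G" by (rule subgroup_centralizer_mod[OF W]) simp
    show "lower_central G (Suc m) \<subseteq> centralizer_mod ?W (\<phi> l)"
    proof
      fix z assume z: "z \<in> lower_central G (Suc m)"
      have "commutator G (\<phi> l) z \<in> lower_central G (1 + Suc m)"
        using z by (intro commutator_lower_central) auto
      then show "z \<in> centralizer_mod ?W (\<phi> l)"
        using lower_central_basic_span[of "Suc m"] z normal_mem_carrier[OF normal_lower_central]
        by (auto simp: centralizer_mod_def)
    qed
  next
    fix t assume t: "basic t" "weight t = m"
    consider "prec t (Letter l)" | "t = Letter l" | "prec (Letter l) t" using prec_total by blast
    then have "commutator G (\<phi> l) (val t) \<in> ?W"
    proof cases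
      case 1
      then have "commutator G (val (Letter l)) (val t) \<in> basic_span (Suc m) (right_ge t)"
        using t by (intro commutator_basic_span) auto
      then show ?thesis using basic_span_mono[of "Suc m" "right_ge t" "\<lambda>_. True"] by auto
    next
      case 2
      then have "commutator G (\<phi> l) (val t) = \<one>" by (simp add: commutator_def m_assoc)
      then show ?thesis using subgroup.one_closed[OF normal_imp_subgroup[OF W]] by simp
    next
      case 3
      then have "commutator G (val t) (val (Letter l)) \<in> basic_span (Suc m) (right_ge (Letter l))"
        using t by (intro commutator_basic_span) auto
      then have "commutator G (val t) (\<phi> l) \<in> ?W"
        using basic_span_mono[of "Suc m" "right_ge (Letter l)" "\<lambda>_. True"] by auto
      then show ?thesis using commutator_swap[OF normal_imp_subgroup[OF W]] by simp
    qed
    then show "val t \<in> centralizer_mod ?W (\<phi> l)" by (simp add: centralizer_mod_def)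
  qed
  have "commutator_subgroup G (lower_central G m) (carrier G) \<subseteq> ?W"
  proof (rule commutator_subgroup_subset[OF normal_imp_subgroup[OF W]])
    fix a g assume a: "a \<in> lower_central G m" and g: "g \<in> carrier G"
    have aG: "a \<in> carrier G" using a normal_mem_carrier[OF normal_lower_central] by blast
    have "\<phi> l \<in> centralizer_mod ?W a" for l
      using l[of l] a centralizer_mod_sym[OF W, of "\<phi> l" a] aG by auto
    then have "generate G (range \<phi>) \<subseteq> centralizer_mod ?W a"
      using subgroup_centralizer_mod[OF W aG] by (intro generate_subgroup_incl) auto
    then show "commutator G a g \<in> ?W" using g generated by (auto simp: centralizer_mod_def)
  qed
  then show ?case
    using basic_span_lower_central[of "Suc m"] Suc.hyps by (auto simp: lower_central_Suc)
qed

section \<open>Powers of commutators\<close>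

text \<open>Handles the commutators from which one letter is absent, where there is no occurrence to
  replace by a power.\<close>

lemma val_single_letter:
  assumes "\<And>l. l \<in> letters t \<Longrightarrow> \<phi> l = z"
  shows "(val t = \<one> \<or> val t = z) \<and> (1 < weight t \<longrightarrow> val t = \<one>)"
  using assms
proof (induction t)
  case (Comm u v)
  then have "val u = \<one> \<or> val u = z" "val v = \<one> \<or> val v = z" by auto
  moreover obtain l where "l \<in> letters u" using letters_nonempty[of u] by blast
  then have "z \<in> carrier G" using Comm.prems[of l] letter_closed[of l] by simp
  ultimately have "val (Comm u v) = \<one>"
    by (auto simp: commutator_def m_assoc)
  then show ?case by blast
qed simp

text \<open>The witness replaces one occurrence of \<open>l\<close> in \<open>t\<close> by its \<open>k\<close>-th power.\<close>

lemma substitute_power: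
  fixes r :: nat
  assumes R: "R \<lhd> G" and r: "\<phi> l [^] r \<in> R" and l: "l \<in> letters t"
  obtains g where "\<And>e. poly_seq e (weight t - 1) g" "\<And>k. g k \<in> lower_central G (weight t)"
    "g 0 = \<one>" "g 1 = val t" "g r \<in> iterated_commutator G R (weight t - 1)"
  using l
proof (induction t arbitrary: thesis)
  \<comment> \<open>The replaced letter counts with weight 0 instead of 1, hence the offset
    \<open>weight t - 1\<close> of the sequence; its values nevertheless stay in weight
    \<open>weight t\<close>.\<close>
  case (Letter l')
  then show ?case
    using r poly_seq_power[of "\<phi> l"] by (intro Letter.prems(1)[of "\<lambda>k. \<phi> l [^] k"]) auto
next
  case (Comm u v)
  \<comment> \<open>Commuting with an element of weight \<open>weight s\<close> counts as
    \<open>weight s\<close> commutations with \<open>G\<close>.\<close>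
  have mem: "commutator G a b \<in> iterated_commutator G R (weight t - 1 + weight s)"
    if "a \<in> iterated_commutator G R (weight t - 1)" "b \<in> lower_central G (weight s)" for a b s t
  proof -
    have "Suc (weight t - 1 + (weight s - 1)) = weight t - 1 + weight s" using weight_pos[of s] by linarith
    then show ?thesis
      using commutator_iterated_lower_central[OF R that(1) that(2)[unfolded lower_central_def]]
      by simp
  qed
  have carr: "a \<in> carrier G" if "a \<in> lower_central G m" for a m
    using that normal_mem_carrier[OF normal_lower_central] by blast
  show ?case
  proof (cases "l \<in> letters u")
    case True
    obtain g where g: "\<And>e. poly_seq e (weight u - 1) g" "\<And>k. g k \<in> lower_central G (weight u)"
      "g 0 = \<one>" "g 1 = val u" "g r \<in> iterated_commutator G R (weight u - 1)"
      using Comm.IH(1) True by blast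
    have w: "weight (Comm u v) - 1 = weight u - 1 + weight v" using weight_pos[of u] by simp
    show ?thesis
    proof (rule Comm.prems(1)[of "\<lambda>k. commutator G (g k) (val v)"])
      fix e show "poly_seq e (weight (Comm u v) - 1) (\<lambda>k. commutator G (g k) (val v))"
        unfolding w by (intro poly_seq_commutator g poly_seq_const val_lower_central)
    next
      fix k show "commutator G (g k) (val v) \<in> lower_central G (weight (Comm u v))"
        using commutator_lower_central[OF g(2) val_lower_central] by simp
    next
      show "commutator G (g r) (val v) \<in> iterated_commutator G R (weight (Comm u v) - 1)"
        unfolding w using g(5) val_lower_central by (rule mem)
    qed (use g(3,4) in \<open>simp_all add: commutator_def\<close>)
  next
    case False
    then have "l \<in> letters v" using Comm.prems(2) by simp
    then obtain g where g: "\<And>e. poly_seq e (weight v - 1) g" "\<And>k. g k \<in> lower_central G (weight v)"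
      "g 0 = \<one>" "g 1 = val v" "g r \<in> iterated_commutator G R (weight v - 1)"
      using Comm.IH(2) by blast
    have w: "weight (Comm u v) - 1 = weight u + (weight v - 1)"
      and w': "weight (Comm u v) - 1 = weight v - 1 + weight u" using weight_pos[of v] by simp_all
    show ?thesis
    proof (rule Comm.prems(1)[of "\<lambda>k. commutator G (val u) (g k)"])
      fix e show "poly_seq e (weight (Comm u v) - 1) (\<lambda>k. commutator G (val u) (g k))"
        unfolding w by (intro poly_seq_commutator g poly_seq_const val_lower_central)
    next
      fix k show "commutator G (val u) (g k) \<in> lower_central G (weight (Comm u v))"
        using commutator_lower_central[OF val_lower_central g(2)] by simp
    next
      have "commutator G (g r) (val u) \<in> iterated_commutator G R (weight (Comm u v) - 1)"
        unfolding w' using g(5) val_lower_central by (rule mem)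
      then show "commutator G (val u) (g r) \<in> iterated_commutator G R (weight (Comm u v) - 1)"
        using commutator_swap[OF normal_imp_subgroup[OF normal_iterated_commutator[OF R]]] carr[OF g(2)]
        by simp
    qed (use g(3,4) carr[OF g(2)] in \<open>simp_all add: commutator_def\<close>)
  qed
qed

end

section \<open>Noncommutative power series and the Magnus embedding\<close>

text \<open>A type of its own, not a function type, so that convolution can be the multiplication of
  a \<open>ring_1\<close> instance.\<close>

datatype series = Series (coeff: "letter list \<Rightarrow> int")

text \<open>The recursion sums \<open>f u * g v\<close> over the splittings \<open>w = u @ v\<close>.\<close>

primrec conv :: "letter list \<Rightarrow> (letter list \<Rightarrow> int) \<Rightarrow> (letter list \<Rightarrow> int) \<Rightarrow> int" where
  "conv [] f g = f [] * g []"
| "conv (a # w) f g = f [] * g (a # w) + conv w (\<lambda>v. f (a # v)) g"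

lemma conv_add_left: "conv w (\<lambda>v. f v + f' v) g = conv w f g + conv w f' g"
  by (induction w arbitrary: f f') (simp_all add: algebra_simps)

lemma conv_add_right: "conv w f (\<lambda>v. g v + g' v) = conv w f g + conv w f g'"
  by (induction w arbitrary: f) (simp_all add: algebra_simps)

lemma conv_scale_left: "conv w (\<lambda>v. c * f v) g = c * conv w f g"
  by (induction w arbitrary: f) (simp_all add: algebra_simps)

lemma conv_zero_left [simp]: "conv w (\<lambda>v. 0) g = 0"
  by (induction w) simp_all

lemma conv_assoc: "conv w (\<lambda>v. conv v f g) h = conv w f (\<lambda>v. conv v g h)"
  by (induction w arbitrary: f g) (simp_all add: conv_add_left conv_scale_left algebra_simps)

lemma conv_one_left: "conv w (\<lambda>v. if v = [] then 1 else 0) g = g w"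
  by (cases w) simp_all

lemma conv_one_right: "conv w f (\<lambda>v. if v = [] then 1 else 0) = f w"
  by (induction w arbitrary: f) simp_all

text \<open>In a splitting of a word shorter than \<open>i + j\<close>, the left part is shorter
  than \<open>i\<close> or the right part is shorter than \<open>j\<close>.\<close>

lemma conv_dvd_right:
  assumes "\<And>v. length v < i \<Longrightarrow> f v = 0" "\<And>v. length v < j \<Longrightarrow> d dvd g v" "length w < i + j"
  shows "d dvd conv w f g"
  using assms(1,3)
proof (induction w arbitrary: f i)
  case Nil
  then show ?case using assms(2)[of "[]"] by (cases i) auto
next
  case (Cons a w)
  have "d dvd f [] * g (a # w)"
    using Cons.prems assms(2)[of "a # w"] by (cases i) auto
  moreover have "d dvd conv w (\<lambda>v. f (a # v)) g"
    using Cons.prems by (intro Cons.IH[of "i - 1"]) auto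
  ultimately show ?case by simp
qed

lemma conv_dvd_left:
  assumes "\<And>v. length v < i \<Longrightarrow> d dvd f v" "\<And>v. length v < j \<Longrightarrow> g v = 0" "length w < i + j"
  shows "d dvd conv w f g"
  using assms(1,3)
proof (induction w arbitrary: f i)
  case Nil
  then show ?case using assms(2)[of "[]"] by (cases i) auto
next
  case (Cons a w)
  have "d dvd f [] * g (a # w)"
    using Cons.prems assms(2)[of "a # w"] by (cases i) auto
  moreover have "d dvd conv w (\<lambda>v. f (a # v)) g"
    using Cons.prems by (intro Cons.IH[of "i - 1"]) auto
  ultimately show ?case by simp
qed

lemma conv_homogeneous:
  assumes "\<And>v. length v \<noteq> i \<Longrightarrow> f v = 0" "\<And>v. length v \<noteq> j \<Longrightarrow> g v = 0" "length w \<noteq> i + j"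
  shows "conv w f g = 0"
  using assms(1,3)
proof (induction w arbitrary: f i)
  case Nil
  then show ?case using assms(2)[of "[]"] by (cases i) auto
next
  case (Cons a w)
  have "f [] * g (a # w) = 0"
    using Cons.prems assms(2)[of "a # w"] by (cases i) auto
  moreover have "conv w (\<lambda>v. f (a # v)) g = 0"
  proof (cases i)
    case 0
    then have "(\<lambda>v. f (a # v)) = (\<lambda>v. 0)" using Cons.prems(1) by auto
    then show ?thesis by simp
  next
    case (Suc i')
    then show ?thesis using Cons.prems by (intro Cons.IH[of i']) auto
  qed
  ultimately show ?case by simp
qed

instantiation series :: ring_1
begin

definition "0 = Series (\<lambda>_. 0)"
definition "1 = Series (\<lambda>w. if w = [] then 1 else 0)"
definition "f + g = Series (\<lambda>w. coeff f w + coeff g w)"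
definition "f - g = Series (\<lambda>w. coeff f w - coeff g w)"
definition "- f = Series (\<lambda>w. - coeff f w)"
definition "f * g = Series (\<lambda>w. conv w (coeff f) (coeff g))"

lemmas series_defs = zero_series_def one_series_def plus_series_def minus_series_def
  uminus_series_def times_series_def

instance
proof
  show "(0 :: series) \<noteq> 1" by (simp add: series_defs fun_eq_iff)
qed (simp_all add: series_defs series.expand fun_eq_iff conv_assoc conv_one_left conv_one_right
    conv_add_left conv_add_right)

end

lemma series_eqI: "(\<And>w. coeff f w = coeff g w) \<Longrightarrow> f = g"
  by (rule series.expand) auto

lemma coeff_zero [simp]: "coeff 0 w = 0"
  and coeff_one: "coeff 1 w = (if w = [] then 1 else 0)"
  and coeff_add [simp]: "coeff (f + g) w = coeff f w + coeff g w"
  and coeff_diff [simp]: "coeff (f - g) w = coeff f w - coeff g w"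
  and coeff_uminus [simp]: "coeff (- f) w = - coeff f w"
  and coeff_mult: "coeff (f * g) w = conv w (coeff f) (coeff g)"
  by (simp_all add: series_defs)

text \<open>Membership in \<open>d A + I^k\<close>; for \<open>d = 0\<close> it is membership in
  \<open>I^k\<close>, as 0 divides only 0.\<close>

definition vanishes :: "int \<Rightarrow> nat \<Rightarrow> series \<Rightarrow> bool" where
  "vanishes d k f \<longleftrightarrow> (\<forall>w. length w < k \<longrightarrow> d dvd coeff f w)"

lemma vanishes_add: "\<lbrakk>vanishes d k f; vanishes d k g\<rbrakk> \<Longrightarrow> vanishes d k (f + g)"
  and vanishes_diff: "\<lbrakk>vanishes d k f; vanishes d k g\<rbrakk> \<Longrightarrow> vanishes d k (f - g)"
  and vanishes_uminus: "vanishes d k f \<Longrightarrow> vanishes d k (- f)"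
  and vanishes_zero: "vanishes d k 0"
  and vanishes_0: "vanishes d 0 f"
  by (simp_all add: vanishes_def)

lemma vanishes_mult_right:
  "\<lbrakk>vanishes 0 i f; vanishes d j g; k \<le> i + j\<rbrakk> \<Longrightarrow> vanishes d k (f * g)"
  unfolding vanishes_def coeff_mult by (auto intro!: conv_dvd_right[of i _ j])

lemma vanishes_mult_left:
  "\<lbrakk>vanishes d i f; vanishes 0 j g; k \<le> i + j\<rbrakk> \<Longrightarrow> vanishes d k (f * g)"
  unfolding vanishes_def coeff_mult by (auto intro!: conv_dvd_left[of i _ _ j])

lemma vanishes_ideal_right: "vanishes d k g \<Longrightarrow> vanishes d k (f * g)"
  by (rule vanishes_mult_right[of 0]) (auto simp: vanishes_0)

lemma vanishes_ideal_left: "vanishes d k f \<Longrightarrow> vanishes d k (f * g)"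
  by (rule vanishes_mult_left[of _ _ _ 0]) (auto simp: vanishes_0)

lemma vanishes_mono: "\<lbrakk>vanishes d' k' f; d dvd d'; k \<le> k'\<rbrakk> \<Longrightarrow> vanishes d k f"
  unfolding vanishes_def by (meson dvd_trans order.strict_trans2)

definition homogeneous :: "nat \<Rightarrow> series \<Rightarrow> bool" where
  "homogeneous m f \<longleftrightarrow> (\<forall>w. length w \<noteq> m \<longrightarrow> coeff f w = 0)"

lemma homogeneous_mult: "\<lbrakk>homogeneous i f; homogeneous j g\<rbrakk> \<Longrightarrow> homogeneous (i + j) (f * g)"
  unfolding homogeneous_def coeff_mult by (auto intro!: conv_homogeneous[of i _ j])

definition var :: "letter \<Rightarrow> series" where
  "var l = Series (\<lambda>w. if w = [l] then 1 else 0)"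

lemma coeff_var: "coeff (var l) w = (if w = [l] then 1 else 0)"
  by (simp add: var_def)

lemma coeff_var_mult:
  "coeff (var l * f) w = (case w of [] \<Rightarrow> 0 | a # v \<Rightarrow> if a = l then coeff f v else 0)"
proof (cases w)
  case (Cons a v)
  have "conv v (\<lambda>u. coeff (var l) (a # u)) (coeff f) = (if a = l then coeff f v else 0)"
    using conv_one_left[of v "coeff f"] by (cases "a = l") (simp_all add: coeff_var)
  then show ?thesis using Cons by (simp add: coeff_mult coeff_var)
qed (simp add: coeff_mult coeff_var)

lemma coeff_one_plus_var_power:
  "coeff ((1 + var l) ^ k) w = (if w = replicate (length w) l then int (k choose length w) else 0)"
proof (induction k arbitrary: w)
  case 0
  then show ?case by (cases w) (auto simp: coeff_one)
next
  case (Suc k)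
  show ?case
    by (cases w) (auto simp: distrib_right coeff_var_mult Suc)
qed

lemma one_plus_var_mult_eq_0:
  assumes "(1 + var l) * f = 0"
  shows "f = 0"
proof (rule series_eqI)
  fix w
  have "coeff f w + coeff (var l * f) w = 0" for w
    using arg_cong[OF assms, of "\<lambda>g. coeff g w"] by (simp add: distrib_right)
  then show "coeff f w = coeff 0 w"
  proof (induction w)
    case Nil
    from this[of "[]"] show ?case by (simp add: coeff_var_mult)
  next
    case (Cons a w)
    then show ?case using Cons.prems[of "a # w"] by (auto simp: coeff_var_mult split: if_splits)
  qed
qed

text \<open>The inverse is the geometric series in \<open>- var l\<close>. Coefficients show that it
  is a right inverse, and left cancellation of \<open>1 + var l\<close> makes it two-sided.\<close>

lemma one_plus_var_unit: "\<exists>g. (1 + var l) * g = 1 \<and> g * (1 + var l) = 1"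
proof -
  define g where "g = Series (\<lambda>w. if w = replicate (length w) l then (-1) ^ length w else 0)"
  have 1: "(1 + var l) * g = 1"
  proof (rule series_eqI)
    fix w show "coeff ((1 + var l) * g) w = coeff 1 w"
      by (cases w) (auto simp: distrib_right coeff_var_mult g_def coeff_one)
  qed
  have "(1 + var l) * (g * (1 + var l) - 1) = ((1 + var l) * g) * (1 + var l) - (1 + var l)"
    by (simp only: right_diff_distrib mult.assoc mult_1_right)
  also have "\<dots> = 0" by (simp add: 1)
  finally have "g * (1 + var l) = 1"
    using one_plus_var_mult_eq_0[of l "g * (1 + var l) - 1"] by simp
  then show ?thesis using 1 by blast
qed

section \<open>Units of the power series ring and the Magnus map\<close>

definition series_units :: "series monoid" where
  "series_units = \<lparr>carrier = {f. \<exists>g. f * g = 1 \<and> g * f = 1}, monoid.mult = (*), one = 1\<rparr>"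

lemma mult_series_units [simp]: "f \<otimes>\<^bsub>series_units\<^esub> g = f * g"
  and one_series_units [simp]: "\<one>\<^bsub>series_units\<^esub> = 1"
  by (simp_all add: series_units_def)

lemma group_series_units: "group series_units"
proof (rule groupI)
  fix f g assume "f \<in> carrier series_units" "g \<in> carrier series_units"
  then obtain f' g' where *: "f * f' = 1" "f' * f = 1" "g * g' = 1" "g' * g = 1"
    by (auto simp: series_units_def)
  have "(f * g) * (g' * f') = f * (g * g') * f'" "(g' * f') * (f * g) = g' * (f' * f) * g"
    by (simp_all only: mult.assoc)
  then have "(f * g) * (g' * f') = 1" "(g' * f') * (f * g) = 1"
    by (simp_all add: *)
  then show "f \<otimes>\<^bsub>series_units\<^esub> g \<in> carrier series_units"
    by (auto simp: series_units_def)
qed (auto simp: series_units_def mult.assoc)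

lemma pow_series_units [simp]: "f [^]\<^bsub>series_units\<^esub> (k::nat) = f ^ k"
proof -
  interpret group series_units by (rule group_series_units)
  show ?thesis by (induction k) (simp_all add: power_commutes)
qed

definition gen :: "letter \<Rightarrow> letter word" where
  "gen l = [(True, l)]"

global_interpretation F2: two_generated F2 gen
  unfolding two_generated_def two_generated_axioms_def
proof (intro conjI allI)
  show "group F2" by (rule group_free_group)
  show "carrier F2 = generate F2 (range gen)"
    using generate_free_group[of "UNIV :: letter set"] by (simp add: gen_def[abs_def])
  show "gen l \<in> carrier F2" for l by (simp add: carrier_free_group gen_def)
qed

definition magnus :: "letter word \<Rightarrow> series" where
  "magnus = lift_word series_units (\<lambda>l. 1 + var l)"

interpretation magnus: group_hom F2 series_units magnus
proof -
  have "(\<lambda>l. 1 + var l) ` UNIV \<subseteq> carrier series_units"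
    using one_plus_var_unit by (auto simp: series_units_def)
  from group.lift_word_hom[OF group_series_units this]
  show "group_hom F2 series_units magnus"
    by (simp add: magnus_def group_hom_def group_hom_axioms_def group_series_units F2.is_group)
qed

declare magnus.hom_inv [simp del]

lemma magnus_gen [simp]: "magnus (gen l) = 1 + var l"
  by (simp add: magnus_def gen_def lift_word_def)

lemma magnus_inv:
  assumes "w \<in> carrier F2"
  shows "magnus (inv\<^bsub>F2\<^esub> w) * magnus w = 1" "magnus w * magnus (inv\<^bsub>F2\<^esub> w) = 1"
proof -
  have "magnus (inv\<^bsub>F2\<^esub> w \<otimes>\<^bsub>F2\<^esub> w) = 1" "magnus (w \<otimes>\<^bsub>F2\<^esub> inv\<^bsub>F2\<^esub> w) = 1"
    using assms magnus.hom_one by (simp_all only: F2.l_inv F2.r_inv one_series_units)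
  then show "magnus (inv\<^bsub>F2\<^esub> w) * magnus w = 1" "magnus w * magnus (inv\<^bsub>F2\<^esub> w) = 1"
    using assms by (simp_all only: magnus.hom_mult F2.inv_closed mult_series_units)
qed

text \<open>The dimension subgroup \<open>F2 \<inter> (1 + d A + I\<^sup>k)\<close>, where \<open>I\<close> is the augmentation ideal of the
  power series ring \<open>A\<close>.\<close>

definition dimension_subgroup :: "int \<Rightarrow> nat \<Rightarrow> letter word set" where
  "dimension_subgroup d k = {w \<in> carrier F2. vanishes d k (magnus w - 1)}"

lemma normal_dimension_subgroup: "dimension_subgroup d k \<lhd> F2"
  unfolding F2.normal_inv_iff
proof (intro conjI ballI F2.subgroupI)
  show "dimension_subgroup d k \<noteq> {}"
    using magnus.hom_one by (auto simp: dimension_subgroup_def vanishes_zero intro!: exI[of _ "\<one>\<^bsub>F2\<^esub>"])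
next
  fix w assume w: "w \<in> dimension_subgroup d k"
  have "magnus (inv\<^bsub>F2\<^esub> w) - 1 = - magnus (inv\<^bsub>F2\<^esub> w) * (magnus w - 1)"
    using w magnus_inv[of w] by (simp add: right_diff_distrib dimension_subgroup_def)
  then show "inv\<^bsub>F2\<^esub> w \<in> dimension_subgroup d k"
    using w vanishes_ideal_right vanishes_uminus by (simp add: dimension_subgroup_def)
next
  fix v w assume *: "v \<in> dimension_subgroup d k" "w \<in> dimension_subgroup d k"
  then have "magnus (v \<otimes>\<^bsub>F2\<^esub> w) - 1 = magnus v * (magnus w - 1) + (magnus v - 1)"
    by (simp add: right_diff_distrib dimension_subgroup_def)
  moreover have "vanishes d k (magnus v * (magnus w - 1) + (magnus v - 1))"
    using * by (intro vanishes_add vanishes_ideal_right) (auto simp: dimension_subgroup_def)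
  ultimately show "v \<otimes>\<^bsub>F2\<^esub> w \<in> dimension_subgroup d k"
    using * by (simp only: dimension_subgroup_def mem_Collect_eq F2.m_closed)
next
  fix g w assume g: "g \<in> carrier F2" and w: "w \<in> dimension_subgroup d k"
  then have "magnus (g \<otimes>\<^bsub>F2\<^esub> w \<otimes>\<^bsub>F2\<^esub> inv\<^bsub>F2\<^esub> g) - 1 = magnus g * (magnus w - 1) * magnus (inv\<^bsub>F2\<^esub> g)"
    using magnus_inv[OF g] by (simp add: algebra_simps dimension_subgroup_def)
  then show "g \<otimes>\<^bsub>F2\<^esub> w \<otimes>\<^bsub>F2\<^esub> inv\<^bsub>F2\<^esub> g \<in> dimension_subgroup d k"
    using g w vanishes_ideal_right vanishes_ideal_left by (simp add: dimension_subgroup_def)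
qed (auto simp: dimension_subgroup_def)

lemma dimension_subgroup_1: "dimension_subgroup 0 1 = carrier F2"
proof -
  have "generate F2 (range gen) \<subseteq> dimension_subgroup 0 1"
    by (rule F2.generate_subgroup_incl[OF _ normal_imp_subgroup[OF normal_dimension_subgroup]])
       (auto simp: dimension_subgroup_def vanishes_def coeff_var)
  then show ?thesis using F2.generated by (auto simp: dimension_subgroup_def)
qed

lemma vanishes_magnus: "w \<in> carrier F2 \<Longrightarrow> vanishes 0 1 (magnus w - 1)"
  using dimension_subgroup_1 by (auto simp: dimension_subgroup_def)

text \<open>Subtracting 1 from both arguments does not change a ring commutator. So the degrees of
  \<open>magnus v - 1\<close> and \<open>magnus w - 1\<close> add up, and the units in front
  preserve the ideals.\<close>

lemma magnus_commutator:
  assumes [simp]: "v \<in> carrier F2" "w \<in> carrier F2"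
  shows "magnus (commutator F2 v w) - 1 = magnus (inv\<^bsub>F2\<^esub> v) * magnus (inv\<^bsub>F2\<^esub> w) *
    ((magnus v - 1) * (magnus w - 1) - (magnus w - 1) * (magnus v - 1))"
proof -
  have "magnus (inv\<^bsub>F2\<^esub> v) * magnus (inv\<^bsub>F2\<^esub> w) * (magnus w * magnus v) = 1"
    using magnus_inv[of v] magnus_inv[of w] by (metis assms mult.assoc mult_1_left)
  then have "magnus (commutator F2 v w) - 1 = magnus (inv\<^bsub>F2\<^esub> v) * magnus (inv\<^bsub>F2\<^esub> w) *
    (magnus v * magnus w - magnus w * magnus v)"
    by (simp add: commutator_def right_diff_distrib mult.assoc)
  also have "magnus v * magnus w - magnus w * magnus v =
     (magnus v - 1) * (magnus w - 1) - (magnus w - 1) * (magnus v - 1)"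
    by (simp add: algebra_simps)
  finally show ?thesis .
qed

text \<open>Every further commutation with \<open>F2\<close> multiplies by an element of
  \<open>I\<close> and so raises the degree by one.\<close>

lemma iterated_commutator_dimension_subgroup:
  assumes "R \<subseteq> dimension_subgroup d k"
  shows "iterated_commutator F2 R j \<subseteq> dimension_subgroup d (k + j)"
proof (induction j)
  case (Suc j)
  show ?case unfolding iterated_commutator.simps
  proof (rule F2.commutator_subgroup_subset[OF normal_imp_subgroup[OF normal_dimension_subgroup]])
    fix v w assume "v \<in> iterated_commutator F2 R j" and w: "w \<in> carrier F2"
    then have v: "v \<in> carrier F2" "vanishes d (k + j) (magnus v - 1)"
      using Suc by (auto simp: dimension_subgroup_def)
    have "vanishes d (k + Suc j) ((magnus v - 1) * (magnus w - 1))"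
      using v(2) vanishes_magnus[OF w] by (rule vanishes_mult_left) simp
    moreover have "vanishes d (k + Suc j) ((magnus w - 1) * (magnus v - 1))"
      using vanishes_magnus[OF w] v(2) by (rule vanishes_mult_right) simp
    ultimately show "commutator F2 v w \<in> dimension_subgroup d (k + Suc j)"
      using v(1) w by (simp add: dimension_subgroup_def magnus_commutator vanishes_ideal_right vanishes_diff)
  qed
qed (use assms in simp)

lemma lower_central_dimension_subgroup: "lower_central F2 k \<subseteq> dimension_subgroup 0 k"
proof (cases k)
  case (Suc j)
  then show ?thesis
    using iterated_commutator_dimension_subgroup[of "carrier F2" 0 1 j] dimension_subgroup_1
    by (simp add: lower_central_def)
qed (auto simp: dimension_subgroup_def vanishes_0)

section \<open>Lie polynomials as leading terms\<close>

primrec lie :: "comm \<Rightarrow> series" where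
  "lie (Letter l) = var l"
| "lie (Comm u v) = lie u * lie v - lie v * lie u"

lemma homogeneous_lie: "homogeneous (weight t) (lie t)"
proof (induction t)
  case (Comm u v)
  have "homogeneous (weight u + weight v) (lie v * lie u)"
    using homogeneous_mult[OF Comm.IH(2,1)] by (simp add: add.commute)
  then show ?case
    using homogeneous_mult[OF Comm.IH(1,2)] by (simp add: homogeneous_def)
qed (simp add: homogeneous_def coeff_var)

lemma homogeneous_vanishes: "homogeneous m f \<Longrightarrow> vanishes d m f"
  by (simp add: homogeneous_def vanishes_def)

lemma magnus_val_leading: "vanishes 0 (Suc (weight t)) (magnus (F2.val t) - 1 - lie t)"
proof (induction t)
  case (Comm u v)
  define \<alpha> where "\<alpha> = magnus (F2.val u) - 1"
  define \<beta> where "\<beta> = magnus (F2.val v) - 1"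
  define i where "i = weight u"
  define j where "j = weight v"
  define \<gamma> where "\<gamma> = magnus (inv\<^bsub>F2\<^esub> F2.val u) * magnus (inv\<^bsub>F2\<^esub> F2.val v)"
  have \<alpha>': "vanishes 0 (Suc i) (\<alpha> - lie u)" and \<beta>': "vanishes 0 (Suc j) (\<beta> - lie v)"
    using Comm by (simp_all add: \<alpha>_def \<beta>_def i_def j_def)
  have lu: "vanishes 0 i (lie u)" and lv: "vanishes 0 j (lie v)"
    using homogeneous_lie homogeneous_vanishes by (auto simp: i_def j_def)
  have \<alpha>: "vanishes 0 i \<alpha>" and \<beta>: "vanishes 0 j \<beta>"
    using vanishes_add[OF vanishes_mono[OF \<alpha>', of 0 i] lu] vanishes_add[OF vanishes_mono[OF \<beta>', of 0 j] lv]
    by simp_all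
  have "vanishes 0 1 (magnus (inv\<^bsub>F2\<^esub> F2.val u \<otimes>\<^bsub>F2\<^esub> inv\<^bsub>F2\<^esub> F2.val v) - 1)"
    by (rule vanishes_magnus) simp
  then have \<gamma>: "vanishes 0 1 (\<gamma> - 1)" by (simp add: \<gamma>_def)
  \<comment> \<open>First the unit \<open>\<gamma>\<close>, which is 1 up to positive degree, is
    replaced by 1; then \<open>\<alpha>\<close> and \<open>\<beta>\<close> are replaced by their
    leading terms one at a time. Each error has degree at least \<open>i + j + 1\<close>.\<close>
  have "magnus (F2.val (Comm u v)) - 1 - lie (Comm u v) =
      (\<gamma> - 1) * (\<alpha> * \<beta>) - (\<gamma> - 1) * (\<beta> * \<alpha>) + ((\<alpha> - lie u) * \<beta> + lie u * (\<beta> - lie v))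
      - ((\<beta> - lie v) * \<alpha> + lie v * (\<alpha> - lie u))"
    unfolding tree_value.simps
    by (subst magnus_commutator) (simp_all add: algebra_simps flip: \<alpha>_def \<beta>_def \<gamma>_def)
  moreover have "vanishes 0 (i + j) (\<alpha> * \<beta>)" "vanishes 0 (i + j) (\<beta> * \<alpha>)"
    using \<alpha> \<beta> by (auto intro: vanishes_mult_left)
  then have "vanishes 0 (Suc (i + j)) ((\<gamma> - 1) * (\<alpha> * \<beta>))" "vanishes 0 (Suc (i + j)) ((\<gamma> - 1) * (\<beta> * \<alpha>))"
    using \<gamma> by (auto intro: vanishes_mult_left)
  moreover have "vanishes 0 (Suc (i + j)) ((\<alpha> - lie u) * \<beta>)" "vanishes 0 (Suc (i + j)) (lie u * (\<beta> - lie v))"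
    "vanishes 0 (Suc (i + j)) ((\<beta> - lie v) * \<alpha>)" "vanishes 0 (Suc (i + j)) (lie v * (\<alpha> - lie u))"
    using \<alpha>' \<beta> \<beta>' lu lv \<alpha> by (auto intro: vanishes_mult_left)
  ultimately show ?case
    by (simp add: i_def j_def vanishes_add vanishes_diff)
qed (simp add: vanishes_zero)

section \<open>Independence of the basic Lie polynomials\<close>

abbreviation total_weight :: "comm list \<Rightarrow> nat" where
  "total_weight s \<equiv> sum_list (map weight s)"

primrec foliage :: "comm \<Rightarrow> letter list" where
  "foliage (Letter l) = [l]"
| "foliage (Comm u v) = foliage u @ foliage v"

abbreviation list_foliage :: "comm list \<Rightarrow> letter list" where
  "list_foliage s \<equiv> concat (map foliage s)"

lemma length_foliage [simp]: "length (foliage t) = weight t"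
  by (induction t) auto

lemma length_list_foliage: "length (list_foliage s) = total_weight s"
  by (induction s) auto

text \<open>Lazard elimination. A segment lists the smallest basic commutators, the last eliminated one
  first; after eliminating them, \<open>alphabet\<close> consists of the free generators that remain.\<close>

primrec segment :: "comm list \<Rightarrow> bool" where
  "segment [] \<longleftrightarrow> True"
| "segment (h # gs) \<longleftrightarrow> segment gs \<and> basic h \<and> h \<notin> set gs \<and>
     (\<forall>t. basic t \<and> prec t h \<longrightarrow> t \<in> set gs)"

definition alphabet :: "comm set \<Rightarrow> comm set" where
  "alphabet H = {t. basic t \<and> t \<notin> H \<and> (\<forall>u v. t = Comm u v \<longrightarrow> v \<in> H)}"

text \<open>Ordered monomials in the eliminated commutators. The list has its largest element first,
  so powers are appended and the smallest commutator stands leftmost.\<close>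

primrec prefixes :: "comm list \<Rightarrow> comm list set" where
  "prefixes [] = {[]}"
| "prefixes (h # gs) = {p @ replicate a h |p a. p \<in> prefixes gs}"

text \<open>Monomials of Poincare-Birkhoff-Witt type at an intermediate stage: an ordered part, then
  an arbitrary word in the generators not yet eliminated. For the empty segment these are all words
  in the letters.\<close>

definition standard :: "comm list \<Rightarrow> comm list set" where
  "standard gs = {p @ w |p w. p \<in> prefixes gs \<and> w \<in> lists (alphabet (set gs))}"

lemma standard_ConsE:
  assumes "s \<in> standard (h # gs)"
  obtains p a w where "s = p @ replicate a h @ w" "p \<in> prefixes gs"
    "w \<in> lists (alphabet (insert h (set gs)))"
proof -
  obtain p' w where *: "s = p' @ w" "p' \<in> prefixes (h # gs)" "w \<in> lists (alphabet (set (h # gs)))"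
    using assms unfolding standard_def by blast
  then obtain p a where "p' = p @ replicate a h" "p \<in> prefixes gs" by auto
  then show thesis using that[of p a w] *(1,3) by simp
qed

lemma segment_down_closed: "\<lbrakk>segment gs; t \<in> set gs; basic s; prec s t\<rbrakk> \<Longrightarrow> s \<in> set gs"
  by (induction gs) auto

lemma segment_prec:
  assumes "segment (h # gs)" "t \<in> set gs" shows "prec t h"
proof -
  have "\<not> prec h t" using assms segment_down_closed[of gs t h] by auto
  then show ?thesis using assms prec_total[of t h] by auto
qed

lemma Nil_in_prefixes: "[] \<in> prefixes gs"
  by (induction gs) auto

lemma singleton_in_prefixes: "t \<in> set gs \<Longrightarrow> [t] \<in> prefixes gs"
proof (induction gs)
  case (Cons h gs)
  show ?case
  proof (cases "t = h")
    case True
    then show ?thesis using Nil_in_prefixes[of gs] by (auto intro!: exI[of _ "[]"] exI[of _ "Suc 0"])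
  next
    case False
    then show ?thesis using Cons by (auto intro!: exI[of _ "[t]"] exI[of _ 0])
  qed
qed simp

lemma set_prefixes: "p \<in> prefixes gs \<Longrightarrow> set p \<subseteq> set gs"
  by (induction gs arbitrary: p) (auto, fastforce)

lemma not_prec_sym: "prec u v \<Longrightarrow> \<not> prec v u"
  using prec_trans prec_irrefl by blast

context
  fixes h gs
  assumes seg: "segment (h # gs)"
begin

lemma min_in_alphabet: "h \<in> alphabet (set gs)"
  using seg by (auto simp: alphabet_def)

lemma alphabet_insert_prec:
  assumes "t \<in> alphabet (insert h (set gs))" shows "prec h t"
proof -
  have "basic t" "t \<notin> set gs" "t \<noteq> h" using assms by (auto simp: alphabet_def)
  then show ?thesis using seg prec_total[of h t] by auto
qed

lemma alphabet_insertI: "\<lbrakk>t \<in> alphabet (set gs); t \<noteq> h\<rbrakk> \<Longrightarrow> t \<in> alphabet (insert h (set gs))"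
  by (auto simp: alphabet_def)

text \<open>If \<open>t = [p, q]\<close>, then \<open>q\<close> is \<open>h\<close> or was
  eliminated before it, and so does not exceed \<open>h\<close>; this is the condition for
  \<open>[t, h]\<close> to be basic.\<close>

lemma Comm_in_alphabet:
  assumes t: "t \<in> alphabet (insert h (set gs))"
  shows "Comm t h \<in> alphabet (insert h (set gs))"
proof -
  have "basic (Comm t h)"
  proof -
    have "q = h \<or> prec q h" if "t = Comm p q" for p q
      using t that segment_prec[OF seg] by (auto simp: alphabet_def)
    then show ?thesis
      using t alphabet_insert_prec[OF t] seg by (auto simp: alphabet_def split: comm.splits)
  qed
  moreover have "Comm t h \<notin> set gs"
    using segment_prec[OF seg, of "Comm t h"] not_prec_sym[OF prec_Comm_right[of h t]] by auto
  moreover have "Comm t h \<noteq> h" using prec_Comm_right[of h t] prec_irrefl by metis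
  ultimately show ?thesis by (auto simp: alphabet_def)
qed

text \<open>Iterated, this is the shape of Lazard's theorem: the generators after eliminating
  \<open>h\<close> are \<open>[u, h, ..., h]\<close> with an old generator \<open>u\<close> other
  than \<open>h\<close>.\<close>

lemma alphabet_insert_cases:
  assumes t: "t \<in> alphabet (insert h (set gs))"
  shows "t \<in> alphabet (set gs) - {h} \<or> (\<exists>u\<in>alphabet (insert h (set gs)). t = Comm u h)"
proof (cases t)
  case (Comm u v)
  show ?thesis
  proof (cases "v = h")
    case True
    have bas: "basic u" "prec h u" "\<And>p q. u = Comm p q \<Longrightarrow> q = h \<or> prec q h" "\<And>p q. u = Comm p q \<Longrightarrow> basic q"
      using t Comm True by (auto simp: alphabet_def)
    have "u \<notin> set gs" using bas(2) segment_prec[OF seg, of u] not_prec_sym by blast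
    then have "u \<in> alphabet (insert h (set gs))"
      using bas seg by (auto simp: alphabet_def)
    then show ?thesis using Comm True by blast
  next
    case False
    then show ?thesis using t Comm by (auto simp: alphabet_def)
  qed
qed (use t in \<open>auto simp: alphabet_def\<close>)

end

section \<open>Spanning: words in the letters are integral combinations of standard products\<close>

inductive_set zspan :: "comm list set \<Rightarrow> series set" for K where
  zero: "0 \<in> zspan K"
| add: "\<lbrakk>f \<in> zspan K; s \<in> K\<rbrakk> \<Longrightarrow> f + prod_list (map lie s) \<in> zspan K"
| diff: "\<lbrakk>f \<in> zspan K; s \<in> K\<rbrakk> \<Longrightarrow> f - prod_list (map lie s) \<in> zspan K"

lemma zspan_base: "s \<in> K \<Longrightarrow> prod_list (map lie s) \<in> zspan K"
  using zspan.add[OF zspan.zero] by fastforce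

lemma zspan_plus: "\<lbrakk>f \<in> zspan K; g \<in> zspan K\<rbrakk> \<Longrightarrow> g + f \<in> zspan K"
  by (induction f rule: zspan.induct) (auto simp: add_diff_eq simp flip: add.assoc intro: zspan.intros)

lemma zspan_minus: "\<lbrakk>f \<in> zspan K; g \<in> zspan K\<rbrakk> \<Longrightarrow> g - f \<in> zspan K"
proof (induction f rule: zspan.induct)
  case (add f s)
  then show ?case using zspan.diff[of "g - f"] by (simp add: diff_diff_eq)
next
  case (diff f s)
  then show ?case using zspan.add[of "g - f"] by (simp add: algebra_simps)
qed simp

lemma zspan_mult_left:
  assumes "f \<in> zspan K" "\<And>s. s \<in> K \<Longrightarrow> g * prod_list (map lie s) \<in> zspan K'"
  shows "g * f \<in> zspan K'"
  using assms(1)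
proof (induction f rule: zspan.induct)
  case (add f s)
  then show ?case using zspan_plus[OF assms(2)] by (simp add: distrib_left)
next
  case (diff f s)
  then show ?case using zspan_minus[OF assms(2)] by (simp add: right_diff_distrib)
qed (simp add: zspan.zero)

lemma zspan_of_int: "f \<in> zspan K \<Longrightarrow> of_int c * f \<in> zspan K"
proof (induction c rule: int_induct[of _ 0])
  case (step1 i)
  then show ?case using zspan_plus[of f K "of_int i * f"] by (simp add: distrib_right)
next
  case (step2 i)
  then show ?case using zspan_minus[of f K "of_int i * f"] by (simp add: left_diff_distrib)
qed (simp add: zspan.zero)

lemma zspan_sum: "(\<And>i. i \<in> I \<Longrightarrow> f i \<in> zspan K) \<Longrightarrow> sum f I \<in> zspan K"
  by (induction I rule: infinite_finite_induct) (auto intro: zspan.zero zspan_plus)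

lemma sum_add_delta:
  fixes c g :: "'a \<Rightarrow> int"
  assumes "finite K" "t \<in> K"
  shows "(\<Sum>s\<in>K. (c s + (if s = t then e else 0)) * g s) = (\<Sum>s\<in>K. c s * g s) + e * g t"
proof -
  have "(\<Sum>s\<in>K. (c s + (if s = t then e else 0)) * g s) =
      (\<Sum>s\<in>K. c s * g s + (if s = t then e * g s else 0))"
    by (rule sum.cong) (auto simp: distrib_right)
  then show ?thesis using assms by (simp add: sum.distrib)
qed

lemma zspan_imp_sum:
  assumes "f \<in> zspan K" "finite K"
  shows "\<exists>c :: comm list \<Rightarrow> int. \<forall>w. coeff f w = (\<Sum>s\<in>K. c s * coeff (prod_list (map lie s)) w)"
  using assms(1)
proof (induction f rule: zspan.induct)
  case zero
  then show ?case by (auto intro: exI[of _ "\<lambda>_. 0"])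
next
  case (add f s)
  then obtain c where c: "\<And>w. coeff f w = (\<Sum>s\<in>K. c s * coeff (prod_list (map lie s)) w)" by blast
  show ?case using add.hyps c assms(2)
    by (intro exI[of _ "\<lambda>t. c t + (if t = s then 1 else 0)"]) (simp add: sum_add_delta)
next
  case (diff f s)
  then obtain c where c: "\<And>w. coeff f w = (\<Sum>s\<in>K. c s * coeff (prod_list (map lie s)) w)" by blast
  show ?case using diff.hyps c assms(2)
    by (intro exI[of _ "\<lambda>t. c t + (if t = s then - 1 else 0)"]) (simp add: sum_add_delta)
qed

text \<open>One elimination step only moves powers of \<open>h\<close> to the front. The weight is
  recorded because the later count takes place in a single degree.\<close>

definition eliminated :: "comm \<Rightarrow> comm list \<Rightarrow> nat \<Rightarrow> comm list set" where
  "eliminated h gs m = {replicate a h @ w |a w.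
     w \<in> lists (alphabet (insert h (set gs))) \<and> a * weight h + total_weight w = m}"

lemma eliminatedI:
  "\<lbrakk>w \<in> lists (alphabet (insert h (set gs))); a * weight h + total_weight w = m\<rbrakk> \<Longrightarrow>
    replicate a h @ w \<in> eliminated h gs m"
  by (auto simp: eliminated_def)

lemma prod_list_lie_replicate:
  "prod_list (map lie (replicate a h @ w)) = lie h ^ a * prod_list (map lie w)"
  by (simp add: prod_list_replicate)

lemma zspan_eliminatedI:
  "\<lbrakk>w \<in> lists (alphabet (insert h (set gs))); a * weight h + total_weight w = m\<rbrakk> \<Longrightarrow>
    lie h ^ a * prod_list (map lie w) \<in> zspan (eliminated h gs m)"
  using zspan_base[OF eliminatedI] by (simp only: prod_list_lie_replicate)

text \<open>By \<open>t h = h t + [t, h]\<close> the power of \<open>h\<close> passes to the left of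
  \<open>t\<close>. As \<open>[t, h]\<close> is again a remaining generator, \<open>t\<close> must
  be arbitrary in the induction on \<open>a\<close>.\<close>

lemma zspan_eliminate_letter:
  assumes seg: "segment (h # gs)"
    and w: "w \<in> lists (alphabet (insert h (set gs)))" and t: "t \<in> alphabet (insert h (set gs))"
  shows "lie t * (lie h ^ a * prod_list (map lie w)) \<in>
    zspan (eliminated h gs (weight t + a * weight h + total_weight w))"
  using t
proof (induction a arbitrary: t)
  case 0
  then have "lie h ^ 0 * prod_list (map lie (t # w)) \<in> zspan (eliminated h gs (weight t + total_weight w))"
    using w by (intro zspan_eliminatedI) auto
  then show ?case by simp
next
  case (Suc a)
  let ?W = "lie h ^ a * prod_list (map lie w)" and ?m = "weight t + Suc a * weight h + total_weight w"
  have "lie h * (lie t * ?W) \<in> zspan (eliminated h gs ?m)"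
  proof (rule zspan_mult_left[OF Suc.IH[OF Suc.prems]])
    fix s assume "s \<in> eliminated h gs (weight t + a * weight h + total_weight w)"
    then obtain b w' where s: "s = replicate b h @ w'" "w' \<in> lists (alphabet (insert h (set gs)))"
      "b * weight h + total_weight w' = weight t + a * weight h + total_weight w"
      unfolding eliminated_def by blast
    have "lie h ^ Suc b * prod_list (map lie w') \<in> zspan (eliminated h gs ?m)"
      using s by (intro zspan_eliminatedI) auto
    then show "lie h * prod_list (map lie s) \<in> zspan (eliminated h gs ?m)"
      unfolding s(1) prod_list_lie_replicate by (simp add: mult.assoc)
  qed
  moreover have "lie (Comm t h) * ?W \<in> zspan (eliminated h gs ?m)"
    using Suc.IH[OF Comm_in_alphabet[OF seg Suc.prems]] by (simp add: ac_simps)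
  moreover have "lie t * (lie h ^ Suc a * prod_list (map lie w)) = lie h * (lie t * ?W) + lie (Comm t h) * ?W"
    by (simp add: left_diff_distrib mult.assoc)
  ultimately show ?case using zspan_plus by metis
qed

lemma zspan_eliminate:
  assumes seg: "segment (h # gs)"
  shows "w \<in> lists (alphabet (set gs)) \<Longrightarrow>
    prod_list (map lie w) \<in> zspan (eliminated h gs (total_weight w))"
proof (induction w rule: list.induct)
  case Nil
  have "lie h ^ 0 * prod_list (map lie []) \<in> zspan (eliminated h gs (total_weight []))"
    by (intro zspan_eliminatedI) auto
  then show ?case by simp
next
  case (Cons t w)
  have "lie t * prod_list (map lie w) \<in> zspan (eliminated h gs (weight t + total_weight w))"
  proof (rule zspan_mult_left[OF Cons.IH])
    show "w \<in> lists (alphabet (set gs))" using Cons.prems by simp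
    fix s assume "s \<in> eliminated h gs (total_weight w)"
    then obtain b w' where s: "s = replicate b h @ w'" "w' \<in> lists (alphabet (insert h (set gs)))"
      "b * weight h + total_weight w' = total_weight w" unfolding eliminated_def by blast
    show "lie t * prod_list (map lie s) \<in> zspan (eliminated h gs (weight t + total_weight w))"
    proof (cases "t = h")
      case True
      have "lie h ^ Suc b * prod_list (map lie w') \<in> zspan (eliminated h gs (weight t + total_weight w))"
        using s True by (intro zspan_eliminatedI) auto
      then show ?thesis unfolding s(1) prod_list_lie_replicate True by (simp add: mult.assoc)
    next
      case False
      have "weight t + b * weight h + total_weight w' = weight t + total_weight w"
        using s by simp
      moreover have "t \<in> alphabet (insert h (set gs))"
        using alphabet_insertI[OF seg] Cons.prems False by simp
      ultimately show ?thesis unfolding s(1) prod_list_lie_replicate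
        using zspan_eliminate_letter[OF seg s(2), of t b] by metis
    qed
  qed
  then show ?case by simp
qed

lemma letter_word_in_zspan:
  assumes "segment gs"
  shows "prod_list (map lie (map Letter v)) \<in> zspan (standard gs \<inter> {s. total_weight s = length v})"
  using assms
proof (induction gs)
  case Nil
  have "map Letter v \<in> standard []"
    by (auto simp: standard_def alphabet_def)
  moreover have "total_weight (map Letter v) = length v" by (induction v) auto
  ultimately show ?case by (intro zspan_base) auto
next
  case (Cons h gs)
  let ?K = "standard (h # gs) \<inter> {s. total_weight s = length v}"
  have "1 * prod_list (map lie (map Letter v)) \<in> zspan ?K"
  proof (rule zspan_mult_left)
    show "prod_list (map lie (map Letter v)) \<in> zspan (standard gs \<inter> {s. total_weight s = length v})"
      using Cons by simp
    fix s assume "s \<in> standard gs \<inter> {s. total_weight s = length v}"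
    then obtain p w where s: "s = p @ w" "p \<in> prefixes gs" "w \<in> lists (alphabet (set gs))"
      "total_weight s = length v" unfolding standard_def by blast
    have "prod_list (map lie p) * prod_list (map lie w) \<in> zspan ?K"
    proof (rule zspan_mult_left[OF zspan_eliminate[OF Cons.prems s(3)]])
      fix s' assume "s' \<in> eliminated h gs (total_weight w)"
      then obtain a w' where s': "s' = replicate a h @ w'" "w' \<in> lists (alphabet (insert h (set gs)))"
        "a * weight h + total_weight w' = total_weight w" unfolding eliminated_def by blast
      have "(p @ replicate a h) @ w' \<in> standard (h # gs)"
        unfolding standard_def
        by (rule CollectI, rule exI, rule exI, rule conjI[OF refl]) (use s(2) s'(2) in auto)
      then have "prod_list (map lie ((p @ replicate a h) @ w')) \<in> zspan ?K"
        using s s' by (intro zspan_base) (simp add: sum_list_replicate)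
      then show "prod_list (map lie p) * prod_list (map lie s') \<in> zspan ?K"
        using s' by (simp add: mult.assoc)
    qed
    then show "1 * prod_list (map lie s) \<in> zspan ?K" using s by simp
  qed
  then show ?case by simp
qed

lemma coeff_letter_word: "coeff (prod_list (map lie (map Letter v))) w = (if w = v then 1 else 0)"
proof (induction v arbitrary: w)
  case (Cons a v)
  then show ?case by (cases w) (auto simp: coeff_var_mult)
qed (simp add: coeff_one)

section \<open>Counting: a standard list is determined by its foliage\<close>

fun expand :: "comm \<Rightarrow> comm \<Rightarrow> comm list" where
  "expand h (Letter l) = [Letter l]"
| "expand h (Comm u v) = (if v = h then expand h u @ [h] else [Comm u v])"

lemma foliage_expand: "list_foliage (expand h t) = foliage t"
  by (induction h t rule: expand.induct) auto

lemma foliage_concat_expand: "list_foliage (concat (map (expand h) w)) = list_foliage w"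
  by (induction w) (auto simp: foliage_expand)

text \<open>\<open>expand\<close> undoes one elimination step: \<open>[u, h, ..., h]\<close> becomes
  the word \<open>u h ... h\<close> over the old alphabet, from which it can be read back because
  \<open>u\<close> is not \<open>h\<close>.\<close>

lemma expand_alphabet:
  assumes seg: "segment (h # gs)" and t: "t \<in> alphabet (insert h (set gs))"
  shows "\<exists>u k. u \<in> alphabet (set gs) - {h} \<and> expand h t = u # replicate k h \<and>
    t = ((\<lambda>x. Comm x h) ^^ k) u"
  using t
proof (induction t)
  case (Letter l)
  then show ?case using alphabet_insert_cases[OF seg Letter]
    by (auto intro!: exI[of _ "Letter l"] exI[of _ 0])
next
  case (Comm u v)
  show ?case
  proof (cases "v = h")
    case True
    then have "u \<in> alphabet (insert h (set gs))"
    proof -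
      have "Comm u v \<notin> alphabet (set gs)"
        using True min_in_alphabet[OF seg] seg by (auto simp: alphabet_def)
      then show ?thesis using alphabet_insert_cases[OF seg Comm.prems] by auto
    qed
    from Comm.IH(1)[OF this] obtain x k where x: "x \<in> alphabet (set gs) - {h}"
      "expand h u = x # replicate k h" "u = ((\<lambda>x. Comm x h) ^^ k) x" by blast
    then show ?thesis using True
      by (intro exI[of _ x] exI[of _ "Suc k"]) (simp add: replicate_append_same)
  next
    case False
    then show ?thesis using alphabet_insert_cases[OF seg Comm.prems]
      by (auto intro!: exI[of _ "Comm u v"] exI[of _ 0])
  qed
qed

lemma replicate_append_eq:
  assumes "replicate a h @ x = replicate b h @ y" "x = [] \<or> hd x \<noteq> h" "y = [] \<or> hd y \<noteq> h"
  shows "a = b \<and> x = y"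
  using assms
proof (induction a arbitrary: b)
  case 0
  then show ?case by (cases b) auto
next
  case (Suc a)
  then show ?case by (cases b; cases y) auto
qed

text \<open>The blocks \<open>u h^k\<close> form a uniquely decodable code: a new block begins at
  every entry other than \<open>h\<close>.\<close>

lemma expand_inj:
  assumes seg: "segment (h # gs)"
    and "w1 \<in> lists (alphabet (insert h (set gs)))" "w2 \<in> lists (alphabet (insert h (set gs)))"
    and "concat (map (expand h) w1) = concat (map (expand h) w2)"
  shows "w1 = w2"
  using assms(2-4)
proof (induction w1 arbitrary: w2 rule: list.induct)
  case Nil
  then show ?case using expand_alphabet[OF seg, of "hd w2"] by (cases w2) auto
next
  case (Cons t1 w1)
  have hd: "concat (map (expand h) w) = [] \<or> hd (concat (map (expand h) w)) \<noteq> h"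
    if "w \<in> lists (alphabet (insert h (set gs)))" for w
    using that expand_alphabet[OF seg, of "hd w"] by (cases w) auto
  obtain t2 w2' where w2: "w2 = t2 # w2'"
    using Cons.prems expand_alphabet[OF seg, of t1] by (cases w2) auto
  obtain u1 k1 where 1: "expand h t1 = u1 # replicate k1 h" "t1 = ((\<lambda>x. Comm x h) ^^ k1) u1"
    using expand_alphabet[OF seg, of t1] Cons.prems by auto
  obtain u2 k2 where 2: "expand h t2 = u2 # replicate k2 h" "t2 = ((\<lambda>x. Comm x h) ^^ k2) u2"
    using expand_alphabet[OF seg, of t2] Cons.prems w2 by auto
  have "replicate k1 h @ concat (map (expand h) w1) = replicate k2 h @ concat (map (expand h) w2')"
    and u: "u1 = u2"
    using Cons.prems(3) w2 1(1) 2(1) by simp_all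
  then have k: "k1 = k2 \<and> concat (map (expand h) w1) = concat (map (expand h) w2')"
    using Cons.prems(1,2) w2 hd[of w1] hd[of w2'] by (intro replicate_append_eq) simp_all
  then have "w1 = w2'" using Cons.prems(1,2) w2 by (intro Cons.IH) auto
  then show ?case using k u 1(2) 2(2) w2 by simp
qed

lemma append_eq_split:
  assumes "p1 @ x1 = p2 @ x2" "set p1 \<subseteq> A" "set p2 \<subseteq> A" "set x1 \<inter> A = {}" "set x2 \<inter> A = {}"
  shows "p1 = p2 \<and> x1 = x2"
proof -
  have 1: "takeWhile (\<lambda>z. z \<in> A) (p @ x) = p" if "set p \<subseteq> A" "set x \<inter> A = {}" for p x
    using that by (induction p) (cases x; auto)+
  have "p1 = p2" using 1[of p1 x1] 1[of p2 x2] assms by simp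
  then show ?thesis using assms(1) by simp
qed

text \<open>Expansion maps \<open>standard (h # gs)\<close> injectively into
  \<open>standard gs\<close> and preserves the foliage; for the empty segment the foliage is the
  word itself.\<close>

lemma inj_on_foliage_standard: "segment gs \<Longrightarrow> inj_on list_foliage (standard gs)"
proof (induction gs)
  case Nil
  have 1: "standard [] \<subseteq> lists (range Letter)"
  proof
    fix s assume "s \<in> standard []"
    then have "s \<in> lists (alphabet {})" by (auto simp: standard_def)
    moreover have "alphabet {} \<subseteq> range Letter"
    proof
      fix t assume "t \<in> alphabet {}" then show "t \<in> range Letter" by (cases t) (auto simp: alphabet_def)
    qed
    ultimately show "s \<in> lists (range Letter)" using lists_mono by blast
  qed
  have "s1 = s2" if "s1 \<in> lists (range Letter)" "s2 \<in> lists (range Letter)"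
    "list_foliage s1 = list_foliage s2" for s1 s2
    using that
  proof (induction s1 arbitrary: s2 rule: list.induct)
    case Nil
    then show ?case by (cases s2) auto
  next
    case (Cons t s1)
    then obtain t' s2' where s2: "s2 = t' # s2'" by (cases s2) auto
    with Cons.prems have "t = t'" "list_foliage s1 = list_foliage s2'" by auto
    then show ?case using Cons.IH[of s2'] Cons.prems s2 by simp
  qed
  then show ?case using 1 by (intro inj_onI) blast
next
  case (Cons h gs)
  note seg = Cons.prems
  let ?E = "\<lambda>w. concat (map (expand h) w)"
  show ?case
  proof (rule inj_onI)
    fix s1 s2 assume *: "s1 \<in> standard (h # gs)" "s2 \<in> standard (h # gs)"
      and eq: "list_foliage s1 = list_foliage s2"
    obtain p1 a1 w1 where
      s1: "s1 = p1 @ replicate a1 h @ w1" "p1 \<in> prefixes gs" "w1 \<in> lists (alphabet (insert h (set gs)))"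
      using standard_ConsE[OF *(1)] .
    obtain p2 a2 w2 where
      s2: "s2 = p2 @ replicate a2 h @ w2" "p2 \<in> prefixes gs" "w2 \<in> lists (alphabet (insert h (set gs)))"
      using standard_ConsE[OF *(2)] .
    have E: "?E w \<in> lists (alphabet (set gs))" if "w \<in> lists (alphabet (insert h (set gs)))" for w
    proof -
      have "set (expand h t) \<subseteq> alphabet (set gs)" if "t \<in> set w" for t
      proof -
        have "t \<in> alphabet (insert h (set gs))"
          using that \<open>w \<in> lists (alphabet (insert h (set gs)))\<close> by auto
        from expand_alphabet[OF seg this] obtain u k where
          "u \<in> alphabet (set gs)" "expand h t = u # replicate k h" by blast
        then show ?thesis using min_in_alphabet[OF seg] by auto
      qed
      then show ?thesis by (auto simp: in_lists_conv_set)
    qed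
    have hd: "?E w = [] \<or> hd (?E w) \<noteq> h" if "w \<in> lists (alphabet (insert h (set gs)))" for w
      using that expand_alphabet[OF seg, of "hd w"] by (cases w) auto
    have std: "p @ replicate a h @ ?E w \<in> standard gs"
      if "p \<in> prefixes gs" "w \<in> lists (alphabet (insert h (set gs)))" for p a w
    proof -
      have "replicate a h @ ?E w \<in> lists (alphabet (set gs))"
        using E[OF that(2)] min_in_alphabet[OF seg] by (auto simp: in_lists_conv_set)
      then show ?thesis using that(1) unfolding standard_def by blast
    qed
    have "list_foliage (p1 @ replicate a1 h @ ?E w1) = list_foliage (p2 @ replicate a2 h @ ?E w2)"
      using eq unfolding s1(1) s2(1) map_append concat_append foliage_concat_expand .
    then have *: "p1 @ (replicate a1 h @ ?E w1) = p2 @ (replicate a2 h @ ?E w2)"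
      using Cons.IH seg std[OF s1(2,3)] std[OF s2(2,3)] by (meson inj_onD segment.simps(2))
    have disj: "set (replicate a h @ ?E w) \<inter> set gs = {}" if "w \<in> lists (alphabet (insert h (set gs)))" for a w
      using E[OF that] seg by (auto simp: alphabet_def in_lists_conv_set)
    \<comment> \<open>Entries of the prefix belong to \<open>set gs\<close> and later ones do not,
      which fixes where the prefix ends.\<close>
    have "p1 = p2 \<and> replicate a1 h @ ?E w1 = replicate a2 h @ ?E w2"
      by (rule append_eq_split[OF * set_prefixes[OF s1(2)] set_prefixes[OF s2(2)]
            disj[OF s1(3)] disj[OF s2(3)]])
    moreover from this have "a1 = a2 \<and> ?E w1 = ?E w2"
      using hd[OF s1(3)] hd[OF s2(3)] by (intro replicate_append_eq) simp_all
    moreover from this have "w1 = w2" using expand_inj[OF seg s1(3) s2(3)] by blast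
    ultimately show "s1 = s2" using s1 s2 by simp
  qed
qed

lemma segment_exists:
  "\<exists>gs. segment gs \<and> set gs = {t. basic t \<and> weight t \<le> m}"
proof -
  let ?B = "{t. basic t \<and> weight t \<le> m}"
  have fin: "finite ?B" by (rule finite_subset[OF _ finite_weight_le[of m]]) auto
  have "\<exists>gs'. segment gs' \<and> set gs' = ?B" if "segment gs" "set gs \<subseteq> ?B" for gs
    using that
  proof (induction "card (?B - set gs)" arbitrary: gs rule: less_induct)
    case less
    show ?case
    proof (cases "set gs = ?B")
      case False
      then have ne: "?B - set gs \<noteq> {}" using less.prems by auto
      \<comment> \<open>The number of predecessors serves as a rank; a missing commutator of least
        rank can be adjoined.\<close>
      let ?below = "\<lambda>h. {z \<in> ?B. prec z h}"
      obtain h where h: "h \<in> ?B - set gs" and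
        least: "\<And>t. t \<in> ?B - set gs \<Longrightarrow> card (?below h) \<le> card (?below t)"
        using ex_has_least_nat[of "\<lambda>t. t \<in> ?B - set gs" _ "\<lambda>h. card (?below h)"] ne by blast
      have min: "\<not> prec t h" if t: "t \<in> ?B - set gs" for t
      proof
        assume th: "prec t h"
        then have "?below t \<subseteq> ?below h" using prec_trans[OF _ th] by blast
        moreover have "t \<in> ?below h" "t \<notin> ?below t" using t th by auto
        ultimately have "?below t \<subset> ?below h" by blast
        then have "card (?below t) < card (?below h)" using fin by (intro psubset_card_mono) auto
        then show False using least[OF t] by simp
      qed
      have "t \<in> set gs" if t: "basic t" "prec t h" for t
      proof -
        have "t \<in> ?B" using t h weight_mono_prec[OF t(2)] by auto
        then show ?thesis using min[of t] t(2) by blast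
      qed
      then have "segment (h # gs)" using h less.prems(1) by auto
      moreover have "?B - set (h # gs) \<subset> ?B - set gs" using h by auto
      then have "card (?B - set (h # gs)) < card (?B - set gs)"
        using fin by (intro psubset_card_mono) auto
      ultimately show ?thesis using less.hyps[of "h # gs"] h less.prems(2) by auto
    qed (use less.prems in blast)
  qed
  from this[of "[]"] show ?thesis by simp
qed

text \<open>Every word of length \<open>m\<close> is an integral combination of the products over the standard lists,
  and there are at most as many standard lists as words. Hence modulo \<open>d\<close> the products induce a
  surjective, so injective, map between finite sets of coordinate vectors.\<close>

lemma standard_independent:
  fixes d :: int and m :: nat and e :: "comm list \<Rightarrow> int"
  assumes seg: "segment gs" and d: "0 < d"
  defines "S \<equiv> standard gs \<inter> {s. total_weight s = m}"
  assumes zero: "\<And>v. length v = m \<Longrightarrow> d dvd (\<Sum>s\<in>S. e s * coeff (prod_list (map lie s)) v)"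
    and s: "s \<in> S"
  shows "d dvd e s"
proof -
  define W where "W = {v :: letter list. length v = m}"
  let ?C = "\<lambda>s v. coeff (prod_list (map lie s)) v"
  have finW: "finite W"
    using finite_lists_length_eq[of "UNIV :: letter set" m] by (simp add: W_def)
  have foliage: "inj_on list_foliage S" "list_foliage ` S \<subseteq> W"
    using inj_on_foliage_standard[OF seg] length_list_foliage
    by (auto simp: S_def W_def inj_on_def)
  have finS: "finite S" using inj_on_finite[OF foliage finW] .
  have card: "card S \<le> card W" using card_inj_on_le[OF foliage finW] .
  define P where "P = PiE S (\<lambda>_. {0..<d})"
  define \<Phi> where "\<Phi> = (\<lambda>c. \<lambda>v\<in>W. (\<Sum>s\<in>S. c s * ?C s v) mod d)"
  have finP: "finite P" unfolding P_def using finS by (intro finite_PiE) auto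
  have \<Phi>_mod: "\<Phi> (\<lambda>s\<in>S. c s mod d) = \<Phi> c" for c
  proof -
    have "(\<Sum>s\<in>S. (\<lambda>s\<in>S. c s mod d) s * ?C s v) mod d = (\<Sum>s\<in>S. c s * ?C s v) mod d" for v
    proof -
      have "(\<Sum>s\<in>S. (\<lambda>s\<in>S. c s mod d) s * ?C s v) mod d = (\<Sum>s\<in>S. ((\<lambda>s\<in>S. c s mod d) s * ?C s v) mod d) mod d"
        by (simp add: mod_sum_eq)
      also have "(\<Sum>s\<in>S. ((\<lambda>s\<in>S. c s mod d) s * ?C s v) mod d) = (\<Sum>s\<in>S. (c s * ?C s v) mod d)"
        by (rule sum.cong) (simp_all add: mod_mult_left_eq)
      also have "(\<Sum>s\<in>S. (c s * ?C s v) mod d) mod d = (\<Sum>s\<in>S. c s * ?C s v) mod d"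
        by (simp add: mod_sum_eq)
      finally show ?thesis .
    qed
    then show ?thesis by (simp add: \<Phi>_def)
  qed
  have modP: "(\<lambda>s\<in>S. c s mod d) \<in> P" for c using d by (auto simp: P_def)
  have surj: "PiE W (\<lambda>_. {0..<d}) \<subseteq> \<Phi> ` P"
  proof
    fix b assume b: "b \<in> PiE W (\<lambda>_. {0..<d})"
    \<comment> \<open>The series with prescribed coefficients in degree \<open>m\<close>, since
      words in the letters give unit vectors; spanning rewrites it in standard products and yields a
      preimage of \<open>b\<close>.\<close>
    define f where "f = (\<Sum>v\<in>W. of_int (b v) * prod_list (map lie (map Letter v)))"
    have "f \<in> zspan S" unfolding f_def
      using letter_word_in_zspan[OF seg] by (intro zspan_sum zspan_of_int) (auto simp: W_def S_def)
    then obtain c where c: "\<And>v. coeff f v = (\<Sum>s\<in>S. c s * ?C s v)"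
      using zspan_imp_sum[OF _ finS] by blast
    have of_int: "coeff (of_int k * g) v = k * coeff g v" for k g v
    proof (induction k rule: int_induct[of _ 0])
      case (step1 i) then show ?case by (simp add: distrib_right)
    next
      case (step2 i) then show ?case by (simp add: left_diff_distrib)
    qed simp
    have sum: "coeff (sum g W') v = (\<Sum>u\<in>W'. coeff (g u) v)" for g v and W' :: "letter list set"
      by (induction W' rule: infinite_finite_induct) auto
    have "coeff f v = b v" if "v \<in> W" for v
      using that finW unfolding f_def sum of_int coeff_letter_word by (simp add: if_distrib cong: if_cong)
    then have "\<Phi> c v = b v" if "v \<in> W" for v
      using b that c[of v] by (auto simp: \<Phi>_def PiE_iff dest!: bspec)
    then have "\<Phi> c = b"
      using b by (intro ext) (auto simp: \<Phi>_def PiE_iff extensional_def)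
    then show "b \<in> \<Phi> ` P" using \<Phi>_mod[of c] modP[of c] by (metis image_eqI)
  qed
  have "card P = nat d ^ card S" "card (PiE W (\<lambda>_. {0..<d})) = nat d ^ card W"
    by (simp_all add: P_def card_PiE finS finW)
  moreover have "nat d ^ card S \<le> nat d ^ card W"
    using card d by (intro power_increasing) auto
  ultimately have "card P \<le> card (\<Phi> ` P)"
    using card_mono[OF finite_imageI[OF finP] surj] by simp
  then have inj: "inj_on \<Phi> P"
    using finP card_image_le[OF finP, of \<Phi>] by (intro eq_card_imp_inj_on) auto
  have "\<Phi> e = \<Phi> (\<lambda>_. 0)" using zero by (auto simp: \<Phi>_def W_def fun_eq_iff restrict_def mod_eq_0_iff_dvd)
  then have "\<Phi> (\<lambda>s\<in>S. e s mod d) = \<Phi> (\<lambda>s\<in>S. 0 mod d)"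
    using \<Phi>_mod[of e] \<Phi>_mod[of "\<lambda>_. 0"] by simp
  then have "(\<lambda>s\<in>S. e s mod d) = (\<lambda>s\<in>S. 0 mod d)"
    by (rule inj_onD[OF inj _ modP modP])
  from fun_cong[OF this, of s] have "e s mod d = 0" using s by simp
  then show ?thesis by (simp add: dvd_eq_mod_eq_0)
qed

text \<open>If the segment contains all basic commutators up to weight \<open>m\<close>, those of
  weight \<open>m\<close> are standard lists with one element. The coefficients are extended by 0 to
  the other standard lists.\<close>

theorem basic_lie_independent:
  assumes d: "0 < d" and t: "basic t" "weight t = m"
    and zero: "\<And>v. length v = m \<Longrightarrow> d dvd (\<Sum>t | basic t \<and> weight t = m. e t * coeff (lie t) v)"
  shows "d dvd e t"
proof -
  obtain gs where gs: "segment gs" "set gs = {t. basic t \<and> weight t \<le> m}"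
    using segment_exists by blast
  define S where "S = standard gs \<inter> {s. total_weight s = m}"
  let ?B = "{t. basic t \<and> weight t = m}"
  have B: "(\<lambda>t. [t]) ` ?B \<subseteq> S"
  proof
    fix s assume "s \<in> (\<lambda>t. [t]) ` ?B"
    then obtain t where t: "s = [t]" "basic t" "weight t = m" by auto
    then have "[t] @ [] \<in> standard gs"
      using singleton_in_prefixes[of t gs] gs(2) unfolding standard_def by blast
    then show "s \<in> S" using t by (simp add: S_def)
  qed
  have finS: "finite S"
  proof (rule inj_on_finite)
    show "inj_on list_foliage S" using inj_on_foliage_standard[OF gs(1)] by (auto simp: S_def inj_on_def)
    show "list_foliage ` S \<subseteq> {v. length v = m}" by (auto simp: S_def length_list_foliage)
    show "finite {v :: letter list. length v = m}"
      using finite_lists_length_eq[of "UNIV :: letter set" m] by simp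
  qed
  define e' where "e' = (\<lambda>s. if s \<in> (\<lambda>t. [t]) ` ?B then e (hd s) else 0)"
  have "(\<Sum>s\<in>S. e' s * coeff (prod_list (map lie s)) v) = (\<Sum>t\<in>?B. e t * coeff (lie t) v)" for v
  proof -
    have "(\<Sum>s\<in>S. e' s * coeff (prod_list (map lie s)) v) =
        (\<Sum>s\<in>(\<lambda>t. [t]) ` ?B. e' s * coeff (prod_list (map lie s)) v)"
      using finS B by (intro sum.mono_neutral_right) (auto simp: e'_def)
    also have "\<dots> = (\<Sum>t\<in>?B. e t * coeff (lie t) v)"
      by (subst sum.reindex) (auto simp: inj_on_def e'_def intro!: sum.cong)
    finally show ?thesis .
  qed
  then have "d dvd e' [t]"
    using standard_independent[OF gs(1) d, of m e' "[t]"] zero B t unfolding S_def by auto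
  then show ?thesis using t by (simp add: e'_def)
qed

section \<open>The Baer-invariant of the nilpotent product\<close>

context group
begin

lemma normal_normal_closure:
  assumes S: "S \<subseteq> carrier G"
  shows "normal_closure G S \<lhd> G"
  unfolding normal_closure_def
proof (rule normal_generateI)
  show "{inv g \<otimes> a \<otimes> g |g a. g \<in> carrier G \<and> a \<in> S} \<subseteq> carrier G" using S by auto
next
  fix z x assume "z \<in> {inv g \<otimes> a \<otimes> g |g a. g \<in> carrier G \<and> a \<in> S}" and x: "x \<in> carrier G"
  then obtain g a where g: "g \<in> carrier G" "a \<in> S" "z = inv g \<otimes> a \<otimes> g" by blast
  then have "x \<otimes> z \<otimes> inv x = inv (g \<otimes> inv x) \<otimes> a \<otimes> (g \<otimes> inv x)"
    using S x by (auto simp: inv_mult_group m_assoc)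
  then show "x \<otimes> z \<otimes> inv x \<in> {inv g \<otimes> a \<otimes> g |g a. g \<in> carrier G \<and> a \<in> S}"
    using g x by blast
qed

lemma subset_normal_closure:
  assumes "S \<subseteq> carrier G" shows "S \<subseteq> normal_closure G S"
proof
  fix a assume a: "a \<in> S"
  then have "inv \<one> \<otimes> a \<otimes> \<one> \<in> normal_closure G S"
    unfolding normal_closure_def by (intro generate.incl) blast
  then show "a \<in> normal_closure G S" using a assms by auto
qed

lemma normal_closure_subset:
  assumes "M \<lhd> G" "S \<subseteq> M"
  shows "normal_closure G S \<subseteq> M"
  unfolding normal_closure_def
  using assms normal_inv_op_closed(1)[OF assms(1)]
  by (intro generate_subgroup_incl normal_imp_subgroup) auto

text \<open>Passes from an integer exponent to its absolute value, because polynomial sequences and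
  binomial coefficients are indexed by natural numbers.\<close>

lemma subgroup_int_pow_iff:
  assumes "subgroup H G" "x \<in> carrier G"
  shows "x [^] (r::int) \<in> H \<longleftrightarrow> x [^] nat \<bar>r\<bar> \<in> H"
proof -
  have "inv y \<in> H \<longleftrightarrow> y \<in> H" if "y \<in> carrier G" for y
    using subgroup.m_inv_closed[OF assms(1), of "inv y"] subgroup.m_inv_closed[OF assms(1), of y]
    unfolding inv_inv[OF that] by (rule iffI)
  moreover have "x [^] r = (if r < 0 then inv (x [^] nat \<bar>r\<bar>) else x [^] nat \<bar>r\<bar>)"
    by (simp only: int_pow_def2 abs_if split: if_split) blast
  ultimately show ?thesis using assms(2) by (metis nat_pow_closed)
qed

lemma pow_gcd_eq_one:
  fixes k l :: nat
  assumes [simp]: "x \<in> carrier G" and "x [^] k = \<one>" "x [^] l = \<one>"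
  shows "x [^] gcd k l = \<one>"
proof -
  obtain u v where uv: "u * int k + v * int l = gcd (int k) (int l)" using bezout_int by blast
  have "x [^] gcd (int k) (int l) = (x [^] int k) [^] u \<otimes> (x [^] int l) [^] v"
    unfolding uv[symmetric] by (simp only: int_pow_mult int_pow_pow assms(1) mult.commute)
  also have "\<dots> = \<one>" using assms by (simp add: int_pow_int)
  finally show ?thesis using int_pow_int[of G x "gcd k l"] by simp
qed

end

text \<open>\<open>L\<close> may be 0 and may have terms above degree \<open>m\<close>. This makes
  leading forms additive and gives elements of larger weight the form 0.\<close>

definition has_leading_form :: "nat \<Rightarrow> letter word \<Rightarrow> series \<Rightarrow> bool" where
  "has_leading_form m w L \<longleftrightarrow>
     w \<in> carrier F2 \<and> vanishes 0 m L \<and> vanishes 0 (Suc m) (magnus w - 1 - L)"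

lemma has_leading_form_one: "has_leading_form m \<one>\<^bsub>F2\<^esub> 0"
  using magnus.hom_one by (simp add: has_leading_form_def vanishes_zero)

text \<open>The cross term has degree at least \<open>2 m\<close>, which exceeds \<open>m\<close> as
  \<open>m > 0\<close>.\<close>

lemma has_leading_form_mult:
  assumes v: "has_leading_form m v L" and w: "has_leading_form m w M" and m: "0 < m"
  shows "has_leading_form m (v \<otimes>\<^bsub>F2\<^esub> w) (L + M)"
proof -
  have [simp]: "v \<in> carrier F2" "w \<in> carrier F2" using v w by (auto simp: has_leading_form_def)
  have low: "vanishes 0 m (magnus u - 1)" if "has_leading_form m u N" for u N
    using that vanishes_add[of 0 m "magnus u - 1 - N" N] vanishes_mono[of 0 "Suc m" "magnus u - 1 - N" 0 m]
    by (simp add: has_leading_form_def)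
  have "magnus (v \<otimes>\<^bsub>F2\<^esub> w) - 1 - (L + M) =
      (magnus v - 1) * (magnus w - 1) + (magnus v - 1 - L) + (magnus w - 1 - M)"
    by (simp add: algebra_simps)
  moreover have "vanishes 0 (Suc m) ((magnus v - 1) * (magnus w - 1))"
    using low[OF v] low[OF w] m by (auto intro: vanishes_mult_left)
  ultimately have "vanishes 0 (Suc m) (magnus (v \<otimes>\<^bsub>F2\<^esub> w) - 1 - (L + M))"
    using v w by (simp only: has_leading_form_def vanishes_add)
  then show ?thesis
    using v w by (simp add: has_leading_form_def vanishes_add)
qed

lemma has_leading_form_pow:
  "\<lbrakk>has_leading_form m w L; 0 < m\<rbrakk> \<Longrightarrow> has_leading_form m (w [^]\<^bsub>F2\<^esub> k) (of_nat k * L)"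
proof (induction k)
  case (Suc k)
  then show ?case using has_leading_form_mult[of m "w [^]\<^bsub>F2\<^esub> k" "of_nat k * L" w L]
    by (simp add: distrib_right add.commute)
qed (simp add: has_leading_form_one)

lemma has_leading_form_val:
  assumes "m \<le> weight t"
  shows "has_leading_form m (F2.val t) (if weight t = m then lie t else 0)"
proof (cases "weight t = m")
  case True
  then show ?thesis
    using magnus_val_leading[of t] homogeneous_vanishes[OF homogeneous_lie[of t]]
    by (simp add: has_leading_form_def)
next
  case False
  have "F2.val t \<in> dimension_subgroup 0 (weight t)"
    using F2.val_lower_central lower_central_dimension_subgroup by blast
  then show ?thesis using False assms
    by (auto simp: has_leading_form_def dimension_subgroup_def vanishes_zero
        intro: vanishes_mono[of 0 "weight t"])
qed

lemma coeff_of_nat_mult: "coeff (of_nat k * f) w = int k * coeff f w"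
  by (induction k) (simp_all add: distrib_right)

text \<open>The nonconstant coefficients of \<open>(1 + var l) ^ k\<close> are the binomial
  coefficients \<open>k choose i\<close>, at the powers of one letter.\<close>

lemma gen_pow_dimension_subgroup:
  assumes "\<And>i. \<lbrakk>1 \<le> i; i \<le> n\<rbrakk> \<Longrightarrow> d dvd (k choose i)"
  shows "gen l [^]\<^bsub>F2\<^esub> k \<in> dimension_subgroup (int d) (Suc n)"
proof -
  have "magnus (gen l [^]\<^bsub>F2\<^esub> k) = (1 + var l) ^ k"
    by (simp add: magnus.hom_nat_pow)
  moreover have "int d dvd coeff ((1 + var l) ^ k - 1) w" if "length w < Suc n" for w
    using that assms[of "length w"]
    by (cases w) (auto simp: coeff_one_plus_var_power coeff_one)
  ultimately show ?thesis by (simp add: dimension_subgroup_def vanishes_def)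
qed

text \<open>The arithmetic of \<open>r\<close> and \<open>s\<close> enters through their gcd and the
  divisibility of binomial coefficients; coprimality to small primes appears only at the
  instantiation.\<close>

locale nilpotent_presentation =
  fixes r s :: int and n c d :: nat
  assumes n_le_c: "n \<le> c" and n_pos: "0 < n" and d_pos: "0 < d" and d_gcd: "int d = gcd r s"
    and dvd_choose_r: "\<And>i. \<lbrakk>1 \<le> i; i \<le> n\<rbrakk> \<Longrightarrow> d dvd (nat \<bar>r\<bar> choose i)"
    and dvd_choose_s: "\<And>i. \<lbrakk>1 \<le> i; i \<le> n\<rbrakk> \<Longrightarrow> d dvd (nat \<bar>s\<bar> choose i)"
begin

definition R where
  "R = normal_closure F2 ({gen LX [^]\<^bsub>F2\<^esub> r, gen LY [^]\<^bsub>F2\<^esub> s} \<union> lower_central F2 (n + 1))"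

definition A where "A = lower_central F2 (c + 1)"

definition T where "T = iterated_commutator F2 R c"

lemma relators_closed:
  "{gen LX [^]\<^bsub>F2\<^esub> r, gen LY [^]\<^bsub>F2\<^esub> s} \<union> lower_central F2 (n + 1) \<subseteq> carrier F2"
  using F2.normal_mem_carrier[OF F2.normal_lower_central] by auto

lemma normal_R: "R \<lhd> F2"
  unfolding R_def by (rule F2.normal_normal_closure[OF relators_closed])

lemma relators_in_R: "gen LX [^]\<^bsub>F2\<^esub> nat \<bar>r\<bar> \<in> R" "gen LY [^]\<^bsub>F2\<^esub> nat \<bar>s\<bar> \<in> R"
  and lower_central_R: "lower_central F2 (n + 1) \<subseteq> R"
proof -
  note sub = F2.subset_normal_closure[OF relators_closed, folded R_def]
  note iff = F2.subgroup_int_pow_iff[OF normal_imp_subgroup[OF normal_R] F2.letter_closed]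
  show "gen LX [^]\<^bsub>F2\<^esub> nat \<bar>r\<bar> \<in> R" "gen LY [^]\<^bsub>F2\<^esub> nat \<bar>s\<bar> \<in> R"
    "lower_central F2 (n + 1) \<subseteq> R"
    using sub by (simp_all only: iff[symmetric] Un_subset_iff insert_subset)
qed

lemma R_dimension_subgroup: "R \<subseteq> dimension_subgroup (int d) (Suc n)"
  unfolding R_def
proof (rule F2.normal_closure_subset[OF normal_dimension_subgroup])
  have sub: "subgroup (dimension_subgroup (int d) (Suc n)) F2"
    by (rule normal_imp_subgroup[OF normal_dimension_subgroup])
  have "lower_central F2 (n + 1) \<subseteq> dimension_subgroup (int d) (Suc n)"
    using lower_central_dimension_subgroup[of "n + 1"]
      vanishes_mono[of 0 "n + 1" _ "int d" "Suc n"] by (auto simp: dimension_subgroup_def)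
  then show "{gen LX [^]\<^bsub>F2\<^esub> r, gen LY [^]\<^bsub>F2\<^esub> s} \<union> lower_central F2 (n + 1)
      \<subseteq> dimension_subgroup (int d) (Suc n)"
    using gen_pow_dimension_subgroup[OF dvd_choose_r, of n] gen_pow_dimension_subgroup[OF dvd_choose_s, of n]
    by (simp only: F2.subgroup_int_pow_iff[OF sub F2.letter_closed] insert_subset Un_subset_iff) simp
qed

lemma T_dimension_subgroup: "T \<subseteq> dimension_subgroup (int d) (Suc (c + n))"
  using iterated_commutator_dimension_subgroup[OF R_dimension_subgroup, of c]
  by (simp add: T_def add.commute)

lemma normal_T: "T \<lhd> F2"
  by (simp add: T_def normal_R)

lemma T_subset_A: "T \<subseteq> A"
  unfolding T_def A_def lower_central_def
  using F2.iterated_commutator_mono[of R "carrier F2" c] F2.normal_mem_carrier[OF normal_R] by auto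

text \<open>The term \<open>n + 1\<close> lies in \<open>R\<close>, and \<open>c\<close>
  commutations carry it to the term \<open>c + n + 1\<close>.\<close>

lemma lower_central_T: "lower_central F2 (c + n + 1) \<subseteq> T"
proof -
  have "lower_central F2 (c + n + 1) = iterated_commutator F2 (lower_central F2 (n + 1)) c"
    by (simp add: lower_central_def F2.iterated_commutator_add add.commute)
  then show ?thesis
    unfolding T_def using F2.iterated_commutator_mono[OF lower_central_R] by simp
qed

sublocale sec: abelian_section F2 A T
proof (intro abelian_section.intro abelian_section_axioms.intro F2.is_group)
  show "A \<lhd> F2" "T \<lhd> F2" by (simp_all add: A_def normal_T)
  show "T \<subseteq> A" by (rule T_subset_A)
  fix a b assume "a \<in> A" "b \<in> A"
  then have "commutator F2 a b \<in> lower_central F2 (c + 1 + (c + 1))"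
    unfolding A_def by (rule F2.commutator_lower_central)
  moreover have "lower_central F2 (c + 1 + (c + 1)) \<subseteq> lower_central F2 (c + n + 1)"
    using n_le_c by (intro F2.lower_central_antimono) simp
  ultimately show "commutator F2 a b \<in> T" using lower_central_T by blast
qed

abbreviation coset where "coset g \<equiv> T #>\<^bsub>F2\<^esub> g"

text \<open>Descends from the term \<open>c + n + 1\<close>, which lies in \<open>T\<close>, to the
  term \<open>c + 1\<close>. Each step adds the basic commutators of one weight, with everything of
  larger weight already in \<open>U\<close>.\<close>

lemma A_induct:
  assumes U: "subgroup U F2" and T: "T \<subseteq> U"
    and step: "\<And>t. \<lbrakk>basic t; c < weight t; weight t \<le> c + n;
        lower_central F2 (Suc (weight t)) \<subseteq> U\<rbrakk> \<Longrightarrow> F2.val t \<in> U"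
  shows "A \<subseteq> U"
proof -
  have "lower_central F2 (c + 1) \<subseteq> U"
  proof (rule inc_induct[of "c + 1" "c + n + 1"])
    show "lower_central F2 (c + n + 1) \<subseteq> U" using lower_central_T T by blast
    fix m assume m: "c + 1 \<le> m" "m < c + n + 1" and IH: "lower_central F2 (Suc m) \<subseteq> U"
    have "lower_central F2 m = F2.basic_span m (\<lambda>_. True)"
      using m by (intro F2.lower_central_eq_basic_span) simp
    also have "\<dots> \<subseteq> U"
      using m IH by (intro F2.basic_span_subset U step) auto
    finally show "lower_central F2 m \<subseteq> U" .
  qed simp
  then show ?thesis by (simp add: A_def)
qed

lemma val_in_A: "c < weight t \<Longrightarrow> F2.val t \<in> A"
  using F2.val_lower_central[of t] F2.lower_central_antimono[of "c + 1" "weight t"] by (auto simp: A_def)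

text \<open>By \<open>substitute_power\<close>, \<open>val t\<close> is the first difference of a
  sequence that is trivial modulo \<open>T\<close> at \<open>k\<close>. The higher differences have
  larger weight, where \<open>tors\<close> supplies the exponent \<open>d\<close>.\<close>

lemma coset_val_pow_eq_one:
  fixes k :: nat
  assumes t: "c < weight t" and k: "gen l [^]\<^bsub>F2\<^esub> k \<in> R"
    and choose: "\<And>i. \<lbrakk>1 \<le> i; i \<le> n\<rbrakk> \<Longrightarrow> d dvd (k choose i)"
    and tors: "\<And>g. g \<in> lower_central F2 (Suc (weight t)) \<Longrightarrow> coset g [^]\<^bsub>sec.Q\<^esub> d = \<one>\<^bsub>sec.Q\<^esub>"
  shows "coset (F2.val t) [^]\<^bsub>sec.Q\<^esub> k = \<one>\<^bsub>sec.Q\<^esub>"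
proof (cases "l \<in> letters t")
  case True
  obtain g where g: "\<And>e. F2.poly_seq e (weight t - 1) g" "\<And>k. g k \<in> lower_central F2 (weight t)"
    "g 0 = \<one>\<^bsub>F2\<^esub>" "g 1 = F2.val t" "g k \<in> iterated_commutator F2 R (weight t - 1)"
    using F2.substitute_power[OF normal_R k True] by blast
  have gA: "g k \<in> A" for k
    using g(2)[of k] t F2.lower_central_antimono[of "c + 1" "weight t"] by (auto simp: A_def)
  have D: "(sec.Q.difference ^^ i) (\<lambda>k. coset (g k)) 0 = coset ((F2.difference ^^ i) g 0)" for i
    using sec.difference_coset[OF gA] by simp
  have low: "(F2.difference ^^ i) g 0 \<in> lower_central F2 (weight t - 1 + i)" for i
    using F2.poly_seq_difference[OF g(1), of i "Suc i"] by simp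
  have one: "\<one>\<^bsub>F2\<^esub> \<in> T" using subgroup.one_closed[OF normal_imp_subgroup[OF normal_T]] .
  have "coset (g 1) [^]\<^bsub>sec.Q\<^esub> k = \<one>\<^bsub>sec.Q\<^esub>"
  proof (rule sec.Q.pow_first_difference[where n = n and d = d])
    show "coset (g k) \<in> carrier sec.Q" for k using gA by simp
    show "coset (g 0) = \<one>\<^bsub>sec.Q\<^esub>" using one by (simp add: g(3) sec.coset_eq_one_iff)
    \<comment> \<open>As \<open>weight t - 1 \<ge> c\<close>, the value at \<open>k\<close> lies in
      a subgroup with at least \<open>c\<close> commutations of \<open>R\<close> with
      \<open>F2\<close>.\<close>
    have "iterated_commutator F2 R (weight t - 1) \<subseteq> T"
      unfolding T_def using t by (intro F2.iterated_commutator_antimono normal_R) simp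
    then show "coset (g k) = \<one>\<^bsub>sec.Q\<^esub>"
      using g(5) gA sec.A_carrier by (auto simp: sec.coset_eq_one_iff)
  next
    fix i assume "2 \<le> i" "i \<le> n"
    then have "lower_central F2 (weight t - 1 + i) \<subseteq> lower_central F2 (Suc (weight t))"
      by (intro F2.lower_central_antimono) simp
    then show "(sec.Q.difference ^^ i) (\<lambda>k. coset (g k)) 0 [^]\<^bsub>sec.Q\<^esub> d = \<one>\<^bsub>sec.Q\<^esub>"
      unfolding D using low[of i] by (intro tors) blast
  next
    fix i assume "n < i"
    then have "lower_central F2 (weight t - 1 + i) \<subseteq> lower_central F2 (c + n + 1)"
      using t by (intro F2.lower_central_antimono) simp
    then have "(F2.difference ^^ i) g 0 \<in> T" using low[of i] lower_central_T by blast
    then show "(sec.Q.difference ^^ i) (\<lambda>k. coset (g k)) 0 = \<one>\<^bsub>sec.Q\<^esub>"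
      unfolding D using F2.normal_mem_carrier[OF normal_T] by (simp add: sec.coset_eq_one_iff)
  qed (rule choose)
  then show ?thesis using g(4) by simp
next
  \<comment> \<open>Only the other letter occurs in \<open>t\<close>, and the weight exceeds 1
    because \<open>weight t > c \<ge> n > 0\<close>.\<close>
  case False
  then obtain z where "\<And>l. l \<in> letters t \<Longrightarrow> gen l = z"
    by (cases l) (metis letter.exhaust)+
  then have "F2.val t = \<one>\<^bsub>F2\<^esub>"
    using F2.val_single_letter[of t z] t n_le_c n_pos by simp
  then have "coset (F2.val t) = \<one>\<^bsub>sec.Q\<^esub>"
    using subgroup.one_closed[OF normal_imp_subgroup[OF normal_T]] by (simp add: sec.coset_eq_one_iff)
  then show ?thesis by simp
qed

text \<open>In descending weight: replacing an \<open>x\<close> kills the power \<open>r\<close>,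
  replacing a \<open>y\<close> the power \<open>s\<close>, and Bezout gives the gcd.\<close>

lemma coset_pow_d:
  assumes "g \<in> A"
  shows "coset g [^]\<^bsub>sec.Q\<^esub> d = \<one>\<^bsub>sec.Q\<^esub>"
proof -
  let ?U = "{g \<in> A. coset g [^]\<^bsub>sec.Q\<^esub> d = \<one>\<^bsub>sec.Q\<^esub>}"
  have sub: "subgroup ?U F2"
  proof (rule F2.subgroupI)
    show "?U \<subseteq> carrier F2" using sec.A_carrier by auto
    have "\<one>\<^bsub>F2\<^esub> \<in> ?U"
      using subgroup.one_closed[OF sec.subgroup_A] subgroup.one_closed[OF normal_imp_subgroup[OF normal_T]]
        sec.coset_eq_one_iff[of "\<one>\<^bsub>F2\<^esub>"] by simp
    then show "?U \<noteq> {}" by blast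
  next
    fix a assume "a \<in> ?U"
    then show "inv\<^bsub>F2\<^esub> a \<in> ?U"
      using subgroup.m_inv_closed[OF sec.subgroup_A, of a] sec.Q.nat_pow_inv[of "coset a" d]
      by (simp flip: sec.coset_inv)
  next
    fix a b assume "a \<in> ?U" "b \<in> ?U"
    then show "a \<otimes>\<^bsub>F2\<^esub> b \<in> ?U"
      using subgroup.m_closed[OF sec.subgroup_A, of a b] sec.Q.nat_pow_distrib[of "coset a" "coset b" d]
      by (simp flip: sec.coset_mult)
  qed
  have "A \<subseteq> ?U"
  proof (rule A_induct[OF sub])
    have "coset g = \<one>\<^bsub>sec.Q\<^esub>" if "g \<in> T" for g
      using that F2.normal_mem_carrier[OF normal_T] sec.coset_eq_one_iff by blast
    then show "T \<subseteq> ?U" using T_subset_A by auto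
  next
    fix t assume t: "basic t" "c < weight t" "weight t \<le> c + n"
      and low: "lower_central F2 (Suc (weight t)) \<subseteq> ?U"
    then have tors: "coset g [^]\<^bsub>sec.Q\<^esub> d = \<one>\<^bsub>sec.Q\<^esub>" if "g \<in> lower_central F2 (Suc (weight t))" for g
      using that by blast
    have "coset (F2.val t) [^]\<^bsub>sec.Q\<^esub> gcd (nat \<bar>r\<bar>) (nat \<bar>s\<bar>) = \<one>\<^bsub>sec.Q\<^esub>"
      using val_in_A[OF t(2)] coset_val_pow_eq_one[OF t(2) relators_in_R(1) dvd_choose_r tors]
        coset_val_pow_eq_one[OF t(2) relators_in_R(2) dvd_choose_s tors]
      by (intro sec.Q.pow_gcd_eq_one) auto
    moreover have "gcd (nat \<bar>r\<bar>) (nat \<bar>s\<bar>) = d"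
      using d_gcd by (metis gcd_int_def nat_int)
    ultimately have "coset (F2.val t) [^]\<^bsub>sec.Q\<^esub> d = \<one>\<^bsub>sec.Q\<^esub>" by (simp only:)
    then show "F2.val t \<in> ?U" using val_in_A[OF t(2)] by simp
  qed
  then show ?thesis using assms by blast
qed

section \<open>The isomorphism with the direct sum of cyclic groups\<close>

definition B where "B = {t. basic t \<and> c < weight t \<and> weight t \<le> c + n}"

lemma finite_B: "finite B"
  unfolding B_def by (rule finite_subset[OF _ finite_weight_le[of "c + n"]]) auto

lemma card_B: "card B = (\<Sum>i=1..n. num_basic_commutators (c + i))"
proof -
  have "B = (\<Union>i\<in>{1..n}. {t. basic t \<and> weight t = c + i})"
  proof (intro equalityI subsetI)
    fix t assume "t \<in> B"
    then show "t \<in> (\<Union>i\<in>{1..n}. {t. basic t \<and> weight t = c + i})"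
      by (auto simp: B_def intro!: bexI[of _ "weight t - c"])
  qed (auto simp: B_def)
  also have "card \<dots> = (\<Sum>i=1..n. num_basic_commutators (c + i))"
    unfolding num_basic_commutators_def by (subst card_UN_disjoint) auto
  finally show ?thesis .
qed

definition \<Phi> :: "(nat \<Rightarrow> comm) \<Rightarrow> (nat \<Rightarrow> int) \<Rightarrow> letter word set" where
  "\<Phi> b f = finprod sec.Q (\<lambda>i. coset (F2.val (b i)) [^]\<^bsub>sec.Q\<^esub> f i) {..<card B}"

lemma carrier_cyclic_sum:
  "carrier (cyclic_sum (int d) k) = {..<k} \<rightarrow>\<^sub>E {0..<int d}"
  using d_pos by (auto simp: cyclic_sum_def carrier_sum_group carrier_integer_mod_group)

lemma group_cyclic_sum: "group (cyclic_sum (int d) k)"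
  by (simp add: cyclic_sum_def)

context
  fixes b assumes b: "bij_betw b {..<card B} B"
begin

lemma coset_b: "i < card B \<Longrightarrow> coset (F2.val (b i)) \<in> carrier sec.Q"
  using b bij_betw_apply[OF b, of i] by (simp add: val_in_A B_def)

text \<open>The exponent \<open>d\<close> is what lets \<open>\<Phi>\<close> respect the addition of
  residues in \<open>cyclic_sum\<close>.\<close>

lemma coset_b_pow_mod:
  assumes "i < card B"
  shows "coset (F2.val (b i)) [^]\<^bsub>sec.Q\<^esub> (k mod int d) = coset (F2.val (b i)) [^]\<^bsub>sec.Q\<^esub> (k :: int)"
proof -
  let ?x = "coset (F2.val (b i))"
  have x: "?x \<in> carrier sec.Q" using coset_b[OF assms] .
  have "F2.val (b i) \<in> A" using bij_betw_apply[OF b, of i] assms by (simp add: val_in_A B_def)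
  then have "?x [^]\<^bsub>sec.Q\<^esub> int d = \<one>\<^bsub>sec.Q\<^esub>"
    using coset_pow_d by (simp add: int_pow_int)
  then have "?x [^]\<^bsub>sec.Q\<^esub> (int d * (k div int d)) = \<one>\<^bsub>sec.Q\<^esub>"
    using x by (simp flip: sec.Q.int_pow_pow)
  then show ?thesis
    using x sec.Q.int_pow_mult[OF x, of "int d * (k div int d)" "k mod int d"] by simp
qed

lemma \<Phi>_hom: "\<Phi> b \<in> hom (cyclic_sum (int d) (card B)) sec.Q"
proof (rule homI)
  fix f g assume "f \<in> carrier (cyclic_sum (int d) (card B))" "g \<in> carrier (cyclic_sum (int d) (card B))"
  have "\<Phi> b (f \<otimes>\<^bsub>cyclic_sum (int d) (card B)\<^esub> g) =
      finprod sec.Q (\<lambda>i. coset (F2.val (b i)) [^]\<^bsub>sec.Q\<^esub> f i \<otimes>\<^bsub>sec.Q\<^esub> coset (F2.val (b i)) [^]\<^bsub>sec.Q\<^esub> g i) {..<card B}"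
    unfolding \<Phi>_def using coset_b
    by (intro sec.Q.finprod_cong') (auto simp: cyclic_sum_def coset_b_pow_mod sec.Q.int_pow_mult)
  also have "\<dots> = \<Phi> b f \<otimes>\<^bsub>sec.Q\<^esub> \<Phi> b g"
    unfolding \<Phi>_def using coset_b by (intro sec.Q.finprod_multf) auto
  finally show "\<Phi> b (f \<otimes>\<^bsub>cyclic_sum (int d) (card B)\<^esub> g) = \<Phi> b f \<otimes>\<^bsub>sec.Q\<^esub> \<Phi> b g" .
qed (use coset_b in \<open>auto simp: \<Phi>_def intro!: sec.Q.finprod_closed\<close>)

interpretation \<Phi>: group_hom "cyclic_sum (int d) (card B)" sec.Q "\<Phi> b"
  using \<Phi>_hom group_cyclic_sum by (simp add: group_hom_def group_hom_axioms_def sec.Q.is_group)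

lemma \<Phi>_surj: "carrier sec.Q \<subseteq> \<Phi> b ` carrier (cyclic_sum (int d) (card B))"
proof -
  let ?H = "\<Phi> b ` carrier (cyclic_sum (int d) (card B))"
  have H: "subgroup ?H sec.Q" by (rule \<Phi>.img_is_subgroup)
  let ?U = "{g \<in> A. coset g \<in> ?H}"
  have sub: "subgroup ?U F2"
  proof (rule F2.subgroupI)
    show "?U \<subseteq> carrier F2" using sec.A_carrier by auto
    have "coset \<one>\<^bsub>F2\<^esub> = \<one>\<^bsub>sec.Q\<^esub>"
      using subgroup.one_closed[OF normal_imp_subgroup[OF normal_T]]
        sec.coset_eq_one_iff[of "\<one>\<^bsub>F2\<^esub>"] by simp
    then show "?U \<noteq> {}" using subgroup.one_closed[OF H] subgroup.one_closed[OF sec.subgroup_A] by force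
  next
    fix a assume "a \<in> ?U"
    then show "inv\<^bsub>F2\<^esub> a \<in> ?U"
      using subgroup.m_inv_closed[OF sec.subgroup_A, of a] subgroup.m_inv_closed[OF H, of "coset a"]
      by (simp add: sec.coset_inv)
  next
    fix a a' assume "a \<in> ?U" "a' \<in> ?U"
    then show "a \<otimes>\<^bsub>F2\<^esub> a' \<in> ?U"
      using subgroup.m_closed[OF sec.subgroup_A, of a a'] subgroup.m_closed[OF H, of "coset a" "coset a'"]
      by simp
  qed
  have "A \<subseteq> ?U"
  proof (rule A_induct[OF sub])
    have "coset g = \<one>\<^bsub>sec.Q\<^esub>" if "g \<in> T" for g
      using that F2.normal_mem_carrier[OF normal_T] sec.coset_eq_one_iff by blast
    then show "T \<subseteq> ?U" using T_subset_A subgroup.one_closed[OF H] by auto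
  next
    fix t assume "basic t" "c < weight t" "weight t \<le> c + n"
    then have t: "t \<in> B" and tA: "F2.val t \<in> A" by (auto simp: B_def val_in_A)
    then obtain j where j: "j < card B" "b j = t"
      using b unfolding bij_betw_def by (metis imageE lessThan_iff)
    \<comment> \<open>A unit vector, with \<open>1 mod int d\<close> because for
      \<open>d = 1\<close> the only residue is 0.\<close>
    define f where "f = (\<lambda>i\<in>{..<card B}. if j = i then 1 mod int d else 0)"
    have "f \<in> carrier (cyclic_sum (int d) (card B))"
      using d_pos by (auto simp: carrier_cyclic_sum f_def)
    moreover have "\<Phi> b f = finprod sec.Q (\<lambda>i. if j = i then coset (F2.val (b i)) else \<one>\<^bsub>sec.Q\<^esub>) {..<card B}"
      unfolding \<Phi>_def using coset_b coset_b_pow_mod[of _ 1]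
      by (intro sec.Q.finprod_cong') (auto simp: f_def)
    then have "\<Phi> b f = coset (F2.val t)"
      using j coset_b by (subst (asm) sec.Q.finprod_singleton) auto
    ultimately have "coset (F2.val t) \<in> ?H" by (metis image_eqI)
    then show "F2.val t \<in> ?U" using tA by blast
  qed
  then show ?thesis by (auto simp: sec.carrier_Q)
qed

text \<open>A representative of \<open>\<Phi> b f\<close> in \<open>F2\<close>, as the Magnus map
  takes elements and not cosets. The recursion fixes the order of the factors, since
  \<open>F2\<close> is not commutative.\<close>

definition product :: "(nat \<Rightarrow> int) \<Rightarrow> nat \<Rightarrow> letter word" where
  "product f k = rec_nat \<one>\<^bsub>F2\<^esub> (\<lambda>i g. F2.val (b i) [^]\<^bsub>F2\<^esub> nat (f i) \<otimes>\<^bsub>F2\<^esub> g) k"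

lemma product_simps:
  "product f 0 = \<one>\<^bsub>F2\<^esub>"
  "product f (Suc k) = F2.val (b k) [^]\<^bsub>F2\<^esub> nat (f k) \<otimes>\<^bsub>F2\<^esub> product f k"
  by (simp_all add: product_def)

lemma pow_in_A: "a \<in> A \<Longrightarrow> a [^]\<^bsub>F2\<^esub> (k :: nat) \<in> A"
  using subgroup.one_closed[OF sec.subgroup_A] subgroup.m_closed[OF sec.subgroup_A]
  by (induction k) auto

lemma coset_product:
  assumes f: "\<And>i. i < card B \<Longrightarrow> 0 \<le> f i" and "k \<le> card B"
  shows "product f k \<in> A \<and> coset (product f k) =
    finprod sec.Q (\<lambda>i. coset (F2.val (b i)) [^]\<^bsub>sec.Q\<^esub> f i) {..<k}"
  using assms(2)
proof (induction k)
  case 0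
  have "coset \<one>\<^bsub>F2\<^esub> = \<one>\<^bsub>sec.Q\<^esub>"
    using subgroup.one_closed[OF normal_imp_subgroup[OF normal_T]]
      sec.coset_eq_one_iff[of "\<one>\<^bsub>F2\<^esub>"] by simp
  then show ?case using subgroup.one_closed[OF sec.subgroup_A] by (simp add: product_simps)
next
  case (Suc k)
  have bk: "F2.val (b k) \<in> A"
    using bij_betw_apply[OF b, of k] Suc.prems by (simp add: val_in_A B_def)
  have "coset (F2.val (b k)) [^]\<^bsub>sec.Q\<^esub> f k = coset (F2.val (b k) [^]\<^bsub>F2\<^esub> nat (f k))"
    using sec.coset_pow[OF bk, of "nat (f k)"] f[of k] Suc.prems by simp
  moreover have "finprod sec.Q (\<lambda>i. coset (F2.val (b i)) [^]\<^bsub>sec.Q\<^esub> f i) {..<Suc k} =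
      coset (F2.val (b k)) [^]\<^bsub>sec.Q\<^esub> f k \<otimes>\<^bsub>sec.Q\<^esub>
      finprod sec.Q (\<lambda>i. coset (F2.val (b i)) [^]\<^bsub>sec.Q\<^esub> f i) {..<k}"
    using coset_b Suc.prems unfolding lessThan_Suc by (intro sec.Q.finprod_insert) auto
  ultimately show ?case
    using Suc.IH Suc.prems pow_in_A[OF bk] subgroup.m_closed[OF sec.subgroup_A]
      sec.coset_mult[OF pow_in_A[OF bk], of "product f k" "nat (f k)"]
    by (simp only: product_simps Suc_leD)
qed

lemma product_leading_form:
  assumes m: "c < m" and f: "\<And>i. \<lbrakk>i < card B; weight (b i) < m\<rbrakk> \<Longrightarrow> f i = 0"
    and k: "k \<le> card B"
  shows "has_leading_form m (product f k)
    (\<Sum>i<k. of_nat (nat (f i)) * (if weight (b i) = m then lie (b i) else 0))"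
  using k
proof (induction k)
  case 0
  then show ?case by (simp add: product_simps has_leading_form_one)
next
  case (Suc k)
  have "has_leading_form m (F2.val (b k) [^]\<^bsub>F2\<^esub> nat (f k))
      (of_nat (nat (f k)) * (if weight (b k) = m then lie (b k) else 0))"
  proof (cases "m \<le> weight (b k)")
    case True
    then show ?thesis using has_leading_form_val m by (intro has_leading_form_pow) auto
  next
    case False
    then show ?thesis using f[of k] Suc.prems by (simp add: has_leading_form_one)
  qed
  from has_leading_form_mult[OF this Suc.IH] Suc.prems m show ?case
    by (simp add: product_simps add.commute)
qed

text \<open>Once the coordinates of smaller weight are 0, the degree \<open>m\<close> part of the
  Magnus image is a combination of basic Lie polynomials. The product lies in \<open>T\<close> and
  \<open>m \<le> c + n\<close>, so this part is divisible by \<open>d\<close>; independence gives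
  divisible coordinates, and a residue divisible by \<open>d\<close> is 0.\<close>

lemma \<Phi>_inj:
  assumes f: "f \<in> carrier (cyclic_sum (int d) (card B))" and one: "\<Phi> b f = \<one>\<^bsub>sec.Q\<^esub>"
    and i: "i < card B"
  shows "f i = 0"
  using i
proof (induction "weight (b i)" arbitrary: i rule: less_induct)
  case less
  define m where "m = weight (b i)"
  have "b i \<in> B" using bij_betw_apply[OF b, of i] less.prems by simp
  then have bi: "basic (b i)" and m: "c < m" "m \<le> c + n" by (auto simp: B_def m_def)
  have f_range: "0 \<le> f j \<and> f j < int d" if "j < card B" for j
    using PiE_mem[OF f[unfolded carrier_cyclic_sum], of j] that by simp
  let ?p = "product f (card B)"
  let ?L = "\<lambda>t. if weight t = m then lie t else 0"
  define \<Lambda> where "\<Lambda> = (\<Sum>j<card B. of_nat (nat (f j)) * ?L (b j))"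
  have lead: "has_leading_form m ?p \<Lambda>"
    unfolding \<Lambda>_def
  proof (rule product_leading_form[OF m(1)])
    show "f j = 0" if "j < card B" "weight (b j) < m" for j
      using less.hyps[of j] that by (simp add: m_def)
  qed simp
  have "?p \<in> A \<and> coset ?p = \<Phi> b f"
    unfolding \<Phi>_def by (rule coset_product) (use f_range in auto)
  then have "?p \<in> T" using one sec.coset_eq_one_iff sec.A_carrier by metis
  then have "vanishes (int d) (Suc (c + n)) (magnus ?p - 1)"
    using T_dimension_subgroup by (auto simp: dimension_subgroup_def)
  then have 1: "vanishes (int d) (Suc m) (magnus ?p - 1)"
    by (rule vanishes_mono) (use m in auto)
  have 2: "vanishes (int d) (Suc m) (magnus ?p - 1 - \<Lambda>)"
    using lead vanishes_mono[of 0 "Suc m" "magnus ?p - 1 - \<Lambda>" "int d" "Suc m"]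
    by (simp add: has_leading_form_def)
  have \<Lambda>: "vanishes (int d) (Suc m) \<Lambda>" using vanishes_diff[OF 1 2] by simp
  define e where "e = (\<lambda>t. f (inv_into {..<card B} b t))"
  have eb: "e (b j) = f j" if "j < card B" for j
    using that b by (simp add: e_def bij_betw_def)
  have coeff_sum: "coeff (sum g J) v = (\<Sum>j\<in>J. coeff (g j) v)" for g v and J :: "nat set"
    by (induction J rule: infinite_finite_induct) auto
  have sum: "coeff \<Lambda> v = (\<Sum>t | basic t \<and> weight t = m. e t * coeff (lie t) v)" for v
  proof -
    have "coeff \<Lambda> v = (\<Sum>j<card B. e (b j) * coeff (?L (b j)) v)"
      unfolding \<Lambda>_def coeff_sum coeff_of_nat_mult
      using f_range eb by (intro sum.cong) auto
    also have "\<dots> = (\<Sum>t\<in>B. e t * coeff (?L t) v)"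
      by (rule sum.reindex_bij_betw[OF b])
    also have "\<dots> = (\<Sum>t | basic t \<and> weight t = m. e t * coeff (?L t) v)"
      using m finite_B by (intro sum.mono_neutral_right) (auto simp: B_def)
    also have "\<dots> = (\<Sum>t | basic t \<and> weight t = m. e t * coeff (lie t) v)"
      by (intro sum.cong) auto
    finally show ?thesis .
  qed
  have "int d dvd e (b i)"
  proof (rule basic_lie_independent[OF _ bi])
    show "weight (b i) = m" by (simp add: m_def)
    show "int d dvd (\<Sum>t | basic t \<and> weight t = m. e t * coeff (lie t) v)" if "length v = m" for v
      using \<Lambda> that unfolding sum[symmetric] vanishes_def by simp
  qed (use d_pos in simp)
  then show "f i = 0"
    using f_range[OF less.prems] eb[OF less.prems] zdvd_imp_le by fastforce
qed

lemma \<Phi>_iso: "\<Phi> b \<in> iso (cyclic_sum (int d) (card B)) sec.Q"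
proof -
  have "f = \<one>\<^bsub>cyclic_sum (int d) (card B)\<^esub>"
    if f: "f \<in> carrier (cyclic_sum (int d) (card B))" "\<Phi> b f = \<one>\<^bsub>sec.Q\<^esub>" for f
  proof
    fix i show "f i = \<one>\<^bsub>cyclic_sum (int d) (card B)\<^esub> i"
      using \<Phi>_inj[OF f, of i] f(1)
      by (cases "i < card B") (auto simp: cyclic_sum_def carrier_sum_group PiE_iff extensional_def)
  qed
  then have "kernel (cyclic_sum (int d) (card B)) sec.Q (\<Phi> b) = {\<one>\<^bsub>cyclic_sum (int d) (card B)\<^esub>}"
    using \<Phi>.one_closed \<Phi>.hom_one by (auto simp: kernel_def)
  then have "inj_on (\<Phi> b) (carrier (cyclic_sum (int d) (card B)))"
    by (rule \<Phi>.trivial_ker_imp_inj)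
  moreover have "\<Phi> b ` carrier (cyclic_sum (int d) (card B)) = carrier sec.Q"
    using \<Phi>_surj \<Phi>.hom_closed by blast
  ultimately show ?thesis using \<Phi>_hom by (simp add: iso_def bij_betw_def)
qed

end

theorem baer_invariant_F2:
  "baer_invariant c F2 R \<cong> cyclic_sum (int d) (\<Sum>i=1..n. num_basic_commutators (c + i))"
proof -
  obtain b where "bij_betw b {..<card B} B"
    using ex_bij_betw_nat_finite[OF finite_B] by (auto simp: atLeast0LessThan)
  then have "cyclic_sum (int d) (card B) \<cong> sec.Q"
    using \<Phi>_iso by (auto simp: is_iso_def)
  then have "sec.Q \<cong> cyclic_sum (int d) (card B)"
    by (rule group.iso_sym[OF group_cyclic_sum])
  moreover have "R \<inter> lower_central F2 (c + 1) = A"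
    using lower_central_R F2.lower_central_antimono[of "n + 1" "c + 1"] n_le_c by (auto simp: A_def)
  then have "baer_invariant c F2 R = sec.Q"
    by (simp only: baer_invariant_def sec.Q_def T_def[symmetric])
  ultimately show ?thesis by (simp add: card_B)
qed

lemma nilpotent_product_eq: "nilpotent_product r s n = F2 Mod R"
  by (simp add: nilpotent_product_def R_def gen_def)

theorem baer_invariant_nilpotent_product:
  fixes F :: "('f, 'm) monoid_scheme"
  assumes "free_presentation F \<pi> (nilpotent_product r s n)"
  shows "baer_invariant c F (kernel F (nilpotent_product r s n) \<pi>)
    \<cong> cyclic_sum (gcd r s) (\<Sum>i=1..n. num_basic_commutators (c + i))"
proof -
  let ?G = "nilpotent_product r s n"
  define \<rho> where "\<rho> = (\<lambda>w. R #>\<^bsub>F2\<^esub> w)"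
  have G: "group ?G"
    unfolding nilpotent_product_eq by (rule normal.factorgroup_is_group[OF normal_R])
  have \<rho>: "\<rho> \<in> epi F2 ?G"
    unfolding nilpotent_product_eq epi_def \<rho>_def
    using normal.r_coset_hom_Mod[OF normal_R] by (auto simp: carrier_FactGroup)
  have "kernel F2 ?G \<rho> = R"
    using F2.coset_join1[OF _ _ normal_imp_subgroup[OF normal_R]]
      F2.coset_join2[OF _ normal_imp_subgroup[OF normal_R]] F2.normal_mem_carrier[OF normal_R]
    by (auto simp: kernel_def nilpotent_product_eq \<rho>_def)
  then have "baer_invariant c F (kernel F ?G \<pi>) \<cong> baer_invariant c F2 R"
    using baer_invariant_free_presentation[OF assms G \<rho>] by simp
  then show ?thesis
    using iso_trans baer_invariant_F2 d_gcd by metis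
qed

end

lemma dvd_choose_coprime:
  fixes d k i :: nat
  assumes "d dvd k" "coprime d i" "0 < i"
  shows "d dvd (k choose i)"
proof -
  have "i * (k choose i) = k * (k - 1 choose (i - 1))"
    using assms(3) by (rule times_binomial_minus1_eq)
  then have "d dvd i * (k choose i)" using assms(1) by simp
  then show ?thesis using assms(2) by (simp add: coprime_dvd_mult_right_iff)
qed

text \<open>\<open>r \<noteq> 0\<close> makes the gcd positive, as the counting modulo
  \<open>d\<close> requires.\<close>

lemma nilpotent_presentation_intro:
  fixes r s :: int
  assumes "n \<le> c" "0 < n" "r \<noteq> 0"
    and coprime: "\<And>i. \<lbrakk>1 \<le> i; i \<le> n\<rbrakk> \<Longrightarrow> coprime (nat (gcd r s)) i"
  shows "nilpotent_presentation r s n c (nat (gcd r s))"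
proof
  have "nat (gcd r s) dvd nat \<bar>r\<bar>" "nat (gcd r s) dvd nat \<bar>s\<bar>"
    by (simp_all add: nat_dvd_iff)
  then show "nat (gcd r s) dvd (nat \<bar>r\<bar> choose i)" "nat (gcd r s) dvd (nat \<bar>s\<bar> choose i)"
    if "1 \<le> i" "i \<le> n" for i
    using that coprime by (auto intro: dvd_choose_coprime)
qed (use assms in auto)

lemma coprime_nat_gcd:
  fixes r s :: int and p :: nat
  assumes "prime p" "\<not> int p dvd r"
  shows "coprime (nat (gcd r s)) p"
proof -
  have "\<not> p dvd nat (gcd r s)"
    using assms(2) by (metis dvd_trans gcd_dvd1 gcd_ge_0_int int_dvd_int_iff int_nat_eq)
  then show ?thesis
    using prime_imp_coprime[OF assms(1)] coprime_commute by blast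
qed

theorem theorem3p5:
  shows
    "(\<forall>(r::int) (s::int) (c::nat). odd r \<and> odd s \<and> 2 \<le> c \<longrightarrow>
       (\<forall>(F :: 'f monoid) \<pi>. free_presentation F \<pi> (nilpotent_product r s 2) \<longrightarrow>
          baer_invariant c F (kernel F (nilpotent_product r s 2) \<pi>)
            \<cong> cyclic_sum (gcd r s) (\<Sum>i=1..2. num_basic_commutators (c + i)))) \<and>
     (\<forall>(r::int) (s::int).
       0 \<le> r \<and> 0 \<le> s \<and> \<not> 2 dvd r \<and> \<not> 3 dvd r \<and> \<not> 2 dvd s \<and> \<not> 3 dvd s \<longrightarrow>
       (\<forall>c::nat. 3 \<le> c \<longrightarrow>
         (\<forall>(F :: 'f monoid) \<pi>. free_presentation F \<pi> (nilpotent_product r s 3) \<longrightarrow>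
            baer_invariant c F (kernel F (nilpotent_product r s 3) \<pi>)
              \<cong> cyclic_sum (gcd r s) (\<Sum>i=1..3. num_basic_commutators (c + i)))) \<and>
       (\<forall>c::nat. 4 \<le> c \<longrightarrow>
         (\<forall>(F :: 'f monoid) \<pi>. free_presentation F \<pi> (nilpotent_product r s 4) \<longrightarrow>
            baer_invariant c F (kernel F (nilpotent_product r s 4) \<pi>)
              \<cong> cyclic_sum (gcd r s) (\<Sum>i=1..4. num_basic_commutators (c + i)))))"
proof -
  have two: "coprime (nat (gcd r s)) 2" if "\<not> 2 dvd r" for r s :: int
    using coprime_nat_gcd[OF two_is_prime_nat, of r s] that by simp
  have three: "coprime (nat (gcd r s)) 3" if "\<not> 3 dvd r" for r s :: int
    using coprime_nat_gcd[of 3 r s] that by simp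
  \<comment> \<open>\<open>nilpotent_presentation_intro\<close> asks for every
    \<open>i \<le> n\<close>; 4 brings no prime besides 2, so the classes 3 and 4 share their
    hypotheses.\<close>
  have four: "coprime (nat (gcd r s)) 4" if "\<not> 2 dvd r" for r s :: int
    using two[OF that, of s] coprime_mult_right_iff[of _ 2 "2 :: nat"] by simp
  have pres2: "nilpotent_presentation r s 2 c (nat (gcd r s))" if "odd r" "2 \<le> c" for r s :: int and c
  proof (rule nilpotent_presentation_intro)
    fix i :: nat assume "1 \<le> i" "i \<le> 2"
    then have "i = 1 \<or> i = 2" by linarith
    then show "coprime (nat (gcd r s)) i" using two that by auto
  qed (use that in auto)
  have pres: "nilpotent_presentation r s n c (nat (gcd r s))"
    if "\<not> 2 dvd r" "\<not> 3 dvd r" "n \<le> c" "n = 3 \<or> n = 4" for r s :: int and n c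
  proof (rule nilpotent_presentation_intro)
    fix i :: nat assume "1 \<le> i" "i \<le> n"
    then have "i = 1 \<or> i = 2 \<or> i = 3 \<or> i = 4" using that(4) by linarith
    then show "coprime (nat (gcd r s)) i" using two three four that by auto
  qed (use that in auto)
  show ?thesis
    using nilpotent_presentation.baer_invariant_nilpotent_product[OF pres2]
      nilpotent_presentation.baer_invariant_nilpotent_product[OF pres] by blast
qed

end
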